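(* There is a Las Vegas randomized comparison-based algorithm which, given an $n\times n$ matrix $A$ with pairwise distinct entries, finds the strict saddlepoint of $A$ or reports that none exists, and which terminates after $O(n)$ time with probability at least $1-e^{-\Omega(n^{1/21})}$.
   Context: A strict saddlepoint of a matrix is an entry that is the strict maximum of its row and the strict minimum of its column. The entries come from a totally ordered set and are accessed only via unit-cost binary comparisons; the algorithm may draw a uniformly random integer from $\{1,\dots,k\}$ (for $k\le n$) in $O(1)$ time. A Las Vegas algorithm always returns the correct answer; only its running time is random. *)

theory Defs
  imports "HOL-Probability.Probability" "HOL-Library.Landau_Symbols"
begin

text \<open>An n by n matrix is a function on index pairs, of which only the values at indices below n matter.\<close>

definition strict_saddlepoint ::
    "nat \<Rightarrow> (nat \<Rightarrow> nat \<Rightarrow> 'a::linorder) \<Rightarrow> nat \<Rightarrow> nat \<Rightarrow> bool" where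
  "strict_saddlepoint n A i j \<longleftrightarrow> i < n \<and> j < n \<and>
     (\<forall>j'<n. j' \<noteq> j \<longrightarrow> A i j' < A i j) \<and>
     (\<forall>i'<n. i' \<noteq> i \<longrightarrow> A i j < A i' j)"

definition distinct_entries :: "nat \<Rightarrow> (nat \<Rightarrow> nat \<Rightarrow> 'a) \<Rightarrow> bool" where
  "distinct_entries n A \<longleftrightarrow> inj_on (\<lambda>(i, j). A i j) ({..<n} \<times> {..<n})"

text \<open>
  Algorithms are programs of a word RAM with registers and a random access memory, both
  holding natural numbers. Programs do not mention matrix entries: the matrix is a separate
  read-only input, and Compare is the only command that depends on it.
\<close>

datatype expr =
    Num nat
  | Reg nat
  | Load expr
  | Add expr expr
  | Sub expr expr
  | Mul expr expr
  | Div expr expr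
  | Mod expr expr
  | Less expr expr
  | Equal expr expr

datatype com =
    Skip
  | Assign nat expr
  | Store expr expr
  | Compare nat expr expr expr expr
  | Draw nat expr
  | Seq com com
  | Cond expr com com
  | While expr com

record state =
  regs :: "nat \<Rightarrow> nat"
  mem :: "nat \<Rightarrow> nat"

type_synonym config = "com \<times> state"

text \<open>
  Arithmetic is modulo the word modulus N, applied after every single operation, so that no
  unit-cost operation acts on a number longer than a machine word.
\<close>

fun eval :: "nat \<Rightarrow> state \<Rightarrow> expr \<Rightarrow> nat" where
  "eval N s (Num k) = k mod N"
| "eval N s (Reg r) = regs s r"
| "eval N s (Load e) = mem s (eval N s e)"
| "eval N s (Add e f) = (eval N s e + eval N s f) mod N"
| "eval N s (Sub e f) = eval N s e - eval N s f"
| "eval N s (Mul e f) = (eval N s e * eval N s f) mod N"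
| "eval N s (Div e f) = eval N s e div eval N s f"
| "eval N s (Mod e f) = eval N s e mod eval N s f"
| "eval N s (Less e f) = (if eval N s e < eval N s f then 1 else 0) mod N"
| "eval N s (Equal e f) = (if eval N s e = eval N s f then 1 else 0) mod N"

definition set_reg :: "nat \<Rightarrow> nat \<Rightarrow> state \<Rightarrow> state" where
  "set_reg r v s = s\<lparr>regs := (regs s)(r := v)\<rparr>"

definition set_mem :: "nat \<Rightarrow> nat \<Rightarrow> state \<Rightarrow> state" where
  "set_mem a v s = s\<lparr>mem := (mem s)(a := v)\<rparr>"

text \<open>
  The answer to the query whether the entry at (i, j) is below the entry at (k, l);
  queries outside the matrix return 0 and so reveal nothing.
\<close>

definition compare_entries ::
    "nat \<Rightarrow> (nat \<Rightarrow> nat \<Rightarrow> 'a::linorder) \<Rightarrow> nat \<Rightarrow> nat \<Rightarrow> nat \<Rightarrow> nat \<Rightarrow> nat" where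
  "compare_entries n A i j k l =
     (if i < n \<and> j < n \<and> k < n \<and> l < n \<and> A i j < A k l then 1 else 0)"

text \<open>A request for a random integer from an illegal range returns 0.\<close>

definition draw :: "nat \<Rightarrow> nat \<Rightarrow> nat pmf" where
  "draw n k = (if 1 \<le> k \<and> k \<le> n then pmf_of_set {1..k} else return_pmf 0)"

text \<open>
  One step is one unit of time. A step evaluates boundedly many expressions of the program;
  their size does not depend on the input, so this counts operations up to a constant factor.
\<close>

fun step :: "nat \<Rightarrow> nat \<Rightarrow> (nat \<Rightarrow> nat \<Rightarrow> 'a::linorder) \<Rightarrow> config \<Rightarrow> config pmf" where
  "step N n A (Skip, s) = return_pmf (Skip, s)"
| "step N n A (Assign r e, s) = return_pmf (Skip, set_reg r (eval N s e) s)"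
| "step N n A (Store e f, s) = return_pmf (Skip, set_mem (eval N s e) (eval N s f) s)"
| "step N n A (Compare r e f g h, s) =
     return_pmf (Skip, set_reg r
       (compare_entries n A (eval N s e) (eval N s f) (eval N s g) (eval N s h)) s)"
| "step N n A (Draw r e, s) =
     map_pmf (\<lambda>v. (Skip, set_reg r v s)) (draw n (eval N s e))"
| "step N n A (Seq c d, s) =
     (if c = Skip then return_pmf (d, s)
      else map_pmf (\<lambda>(c', s'). (Seq c' d, s')) (step N n A (c, s)))"
| "step N n A (Cond e c d, s) = return_pmf (if eval N s e \<noteq> 0 then c else d, s)"
| "step N n A (While e c, s) =
     return_pmf (if eval N s e \<noteq> 0 then Seq c (While e c) else Skip, s)"

fun run :: "nat \<Rightarrow> nat \<Rightarrow> (nat \<Rightarrow> nat \<Rightarrow> 'a::linorder) \<Rightarrow> nat \<Rightarrow> config \<Rightarrow> config pmf" where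
  "run N n A 0 C = return_pmf C"
| "run N n A (Suc t) C = bind_pmf (step N n A C) (run N n A t)"

text \<open>The only initial information besides the matrix is n, in register 0.\<close>

definition init_state :: "nat \<Rightarrow> state" where
  "init_state n = \<lparr>regs = (\<lambda>_. 0)(0 := n), mem = (\<lambda>_. 0)\<rparr>"

text \<open>
  The configuration after t steps. With the modulus a power of n + 2, a machine word has
  w * log (n + 2) bits, where w is a constant of the algorithm.
\<close>

definition execute ::
    "nat \<Rightarrow> com \<Rightarrow> nat \<Rightarrow> (nat \<Rightarrow> nat \<Rightarrow> 'a::linorder) \<Rightarrow> nat \<Rightarrow> config pmf" where
  "execute w P n A t = run ((n + 2) ^ w) n A t (P, init_state n)"

definition halted :: "config \<Rightarrow> bool" where
  "halted C \<longleftrightarrow> fst C = Skip"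

definition prob_halted_within ::
    "nat \<Rightarrow> com \<Rightarrow> nat \<Rightarrow> (nat \<Rightarrow> nat \<Rightarrow> 'a::linorder) \<Rightarrow> nat \<Rightarrow> real" where
  "prob_halted_within w P n A t = measure_pmf.prob (execute w P n A t) {C. halted C}"

text \<open>Register 0 holds 0 to report that there is no saddlepoint.\<close>

definition result :: "state \<Rightarrow> (nat \<times> nat) option" where
  "result s = (if regs s 0 = 0 then None else Some (regs s 1, regs s 2))"

definition correct_output ::
    "nat \<Rightarrow> (nat \<Rightarrow> nat \<Rightarrow> 'a::linorder) \<Rightarrow> (nat \<times> nat) option \<Rightarrow> bool" where
  "correct_output n A out \<longleftrightarrow>
     (case out of
        None \<Rightarrow> \<not> (\<exists>i j. strict_saddlepoint n A i j)
      | Some (i, j) \<Rightarrow> strict_saddlepoint n A i j)"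

text \<open>
  The output is correct in every halting run, whatever the random draws, and the program
  halts with probability 1.
\<close>

definition las_vegas_finds_saddlepoint ::
    "nat \<Rightarrow> com \<Rightarrow> nat \<Rightarrow> (nat \<Rightarrow> nat \<Rightarrow> 'a::linorder) \<Rightarrow> bool" where
  "las_vegas_finds_saddlepoint w P n A \<longleftrightarrow>
     (\<forall>t. \<forall>C \<in> set_pmf (execute w P n A t). halted C \<longrightarrow> correct_output n A (result (snd C))) \<and>
     (\<lambda>t. prob_halted_within w P n A t) \<longlonglongrightarrow> 1"

text \<open>
  The execution depends on the matrix only through the outcomes of comparisons. Hence a
  program that works for one infinite entry type works for every entry type.
\<close>

lemma execute_cong:
  fixes A :: "nat \<Rightarrow> nat \<Rightarrow> 'a::linorder" and B :: "nat \<Rightarrow> nat \<Rightarrow> 'b::linorder"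
  assumes "\<And>i j k l. i < n \<Longrightarrow> j < n \<Longrightarrow> k < n \<Longrightarrow> l < n \<Longrightarrow>
             A i j < A k l \<longleftrightarrow> B i j < B k l"
  shows "execute w P n A t = execute w P n B t"
proof -
  have cmp: "compare_entries n A = compare_entries n B"
    using assms by (auto simp: compare_entries_def fun_eq_iff)
  have "step N n A C = step N n B C" for N C
  proof -
    obtain c s where "C = (c, s)" by (cases C)
    moreover have "step N n A (c, s) = step N n B (c, s)"
      by (induction c) (auto simp: cmp)
    ultimately show ?thesis by simp
  qed
  then have "run N n A t C = run N n B t C" for N C
    by (induction t arbitrary: C) (auto intro: bind_pmf_cong)
  then show ?thesis by (simp add: execute_def)
qed

end

theory Submission
  imports Defs "HOL-Real_Asymp.Real_Asymp"
begin

text \<open>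
  Let v be the value of the saddlepoint. If every remaining column has an entry at most p, then
  v is at most p, and every row that contains an entry above p can be deleted. So it suffices to
  find, in linear time, such a pivot p together with a column in which p lies in the lower half:
  deleting the rows whose entry in that column exceeds p halves the number of rows. The same step
  on the transposed matrix with reversed order halves the number of columns, and the costs of
  the rounds form a geometric series. In the end a single candidate is left and is verified.

  With d about the fourth root of n, the pivot is found as follows. First d * d random entries are
  tried; the largest one that a sample of d rows shows to be in the lower part of its
  column is kept. Then, with overwhelming probability, all but a fraction 1 / d of the columns have
  a constant fraction of their entries below p, so that each of them is certified by a geometrically
  distributed number of random probes. A column for which d probes fail replaces p by the
  least probed entry, which again is in the lower half of its column except with probability
  2 to the power -d. An exponential moment bounds the total number of probes. Whatever the random
  draws are, only rows and columns without saddlepoint are deleted, so the answer is always correct.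
\<close>

section \<open>Terminating programs and couplings\<close>

text \<open>The pivot must be large, so that few probes certify a column, and yet low in its own
  column, so that half of the rows go. Both fit together because it is only ever raised:
  certificates and the bound on bad columns persist, and each replacement is tested for its rank.
  One trial reaches the threshold with probability of order \<open>1 / d\<close>, so
  \<open>d * d\<close> trials miss it with probability exponentially small in \<open>d\<close>. Each
  trial samples \<open>d\<close> rows, which makes order \<open>d ^ 3\<close> steps per reduction,
  however few rows and columns remain. With the crude bound \<open>4 * (d + 1)\<close> on the number
  of rounds this sums to order \<open>d ^ 4\<close>, hence the fourth root. All error terms are
  polynomial in \<open>n\<close> times \<open>(99 / 100) ^ d\<close>. Bad luck must not affect the
  answer. So the rounds are counted by halving register 6, whether or not the sizes shrink, and
  whatever remains is searched exhaustively; bad luck costs time only. Time stays out of the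
  probability theory: programs are coupled with abstract distributions whose results already bound
  the running time.\<close>

text \<open>The joint law of halting time and final state. Since the predicate is inductive, every
  branch must end, whatever is drawn, so halting with probability 1 comes for free.\<close>

inductive runs :: "nat \<Rightarrow> nat \<Rightarrow> (nat \<Rightarrow> nat \<Rightarrow> 'a::linorder) \<Rightarrow> config \<Rightarrow> (nat \<times> state) pmf \<Rightarrow> bool"
  for N n A where
  runs_Skip: "runs N n A (Skip, s) (return_pmf (0, s))"
| runs_step: "c \<noteq> Skip \<Longrightarrow> (\<forall>C\<in>set_pmf (step N n A (c, s)). runs N n A C (F C)) \<Longrightarrow>
    runs N n A (c, s) (bind_pmf (step N n A (c, s)) (\<lambda>C. map_pmf (apfst Suc) (F C)))"

text \<open>A halted configuration is a fixed point of \<open>step\<close>, so being halted after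
  \<open>T\<close> steps means having halted by time \<open>T\<close>.\<close>

lemma runs_prob_halted:
  assumes "runs N n A C E"
  shows "measure_pmf.prob (run N n A T C) {C. halted C} = measure_pmf.prob E {x. fst x \<le> T}"
  using assms
proof (induction arbitrary: T rule: runs.induct)
  case (runs_Skip s)
  have "run N n A T (Skip, s) = return_pmf (Skip, s)"
    by (induction T) (auto simp: bind_return_pmf)
  then show ?case by (simp add: halted_def)
next
  case (runs_step c s F)
  show ?case
  proof (cases T)
    case 0
    have "measure_pmf.prob (step N n A (c, s) \<bind> (\<lambda>C. map_pmf (apfst Suc) (F C))) {x. fst x \<le> 0} = 0"
      by (subst measure_pmf_zero_iff) (auto simp: apfst_def)
    then show ?thesis using 0 runs_step by (simp add: halted_def)
  next
    case (Suc T')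
    have "measure_pmf.prob (run N n A T' C) {C. halted C} =
        measure_pmf.prob (map_pmf (apfst Suc) (F C)) {x. fst x \<le> T}"
      if "C \<in> set_pmf (step N n A (c, s))" for C
    proof -
      have "apfst Suc -` {x. fst x \<le> T} = {x :: nat \<times> state. fst x \<le> T'}"
        using Suc by auto
      then show ?thesis using runs_step that by simp
    qed
    then show ?thesis
      by (auto simp: Suc measure_pmf_bind measure_pmf.measure_bind[where N="count_space UNIV"]
          measure_pmf_in_subprob_space intro!: integral_cong_AE simp: AE_measure_pmf_iff)
  qed
qed

lemma runs_halted_state:
  assumes "runs N n A C E" "C' \<in> set_pmf (run N n A T C)" "halted C'"
  shows "snd C' \<in> snd ` set_pmf E"
  using assms
proof (induction arbitrary: T rule: runs.induct)
  case (runs_Skip s)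
  have "run N n A T (Skip, s) = return_pmf (Skip, s)"
    by (induction T) (auto simp: bind_return_pmf)
  then show ?case using runs_Skip by simp
next
  case (runs_step c s F)
  show ?case
  proof (cases T)
    case 0
    then show ?thesis using runs_step by (auto simp: halted_def)
  next
    case (Suc T')
    then obtain D where D: "D \<in> set_pmf (step N n A (c, s))" "C' \<in> set_pmf (run N n A T' D)"
      using runs_step.prems by auto
    then have "snd C' \<in> snd ` set_pmf (F D)" using runs_step by blast
    then show ?thesis using D by (force simp: image_iff)
  qed
qed

lemma runs_Seq:
  assumes "runs N n A (c, s) E"
    "\<forall>x\<in>set_pmf E. runs N n A (d, snd x) (G x)"
  shows "runs N n A (Seq c d, s) (bind_pmf E (\<lambda>x. map_pmf (apfst (\<lambda>u. fst x + 1 + u)) (G x)))"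
  using assms
proof (induction "(c, s)" E arbitrary: c s G rule: runs.induct)
  case (runs_Skip s)
  have "runs N n A (Seq Skip d, s) (bind_pmf (step N n A (Seq Skip d, s))
      (\<lambda>C. map_pmf (apfst Suc) (G (0, s))))"
    by (rule runs.runs_step) (use runs_Skip in auto)
  moreover have "(+) (Suc 0) = Suc" by auto
  ultimately show ?case by (simp add: bind_return_pmf)
next
  case (runs_step c s F)
  \<comment> \<open>\<open>G\<close> may depend on the time at which \<open>c\<close> ends; after
    one step of \<open>c\<close> it must be consulted at a time that is larger by one.\<close>
  define H where "H C = bind_pmf (F C) (\<lambda>x. map_pmf (apfst (\<lambda>u. fst x + 1 + u)) (G (apfst Suc x)))" for C
  \<comment> \<open>\<open>runs_step\<close> wants a function of the successor of
    \<open>Seq c d\<close>; \<open>H'\<close> reads the configuration of \<open>c\<close> back from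
    it.\<close>
  define H' where "H' D = (case D of (Seq c' d', s') \<Rightarrow> H (c', s') | _ \<Rightarrow> return_pmf (0, s))" for D
  have 1: "runs N n A (Seq (fst C) d, snd C) (H C)" if C: "C \<in> set_pmf (step N n A (c, s))" for C
  proof -
    have "\<forall>x\<in>set_pmf (F C). runs N n A (d, snd x) (G (apfst Suc x))"
    proof
      fix x assume "x \<in> set_pmf (F C)"
      then have "apfst Suc x \<in> set_pmf (step N n A (c, s) \<bind> (\<lambda>C. map_pmf (apfst Suc) (F C)))"
        using C by auto
      then show "runs N n A (d, snd x) (G (apfst Suc x))"
        using runs_step.prems by fastforce
    qed
    note IH = this
    have "\<forall>G. (\<forall>x\<in>set_pmf (F C). runs N n A (d, snd x) (G x)) \<longrightarrow>
        runs N n A (Seq (fst C) d, snd C)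
          (F C \<bind> (\<lambda>x. map_pmf (apfst (\<lambda>u. fst x + 1 + u)) (G x)))"
      by (rule conjunct2[OF bspec[OF runs_step.hyps(2) C], THEN spec, THEN spec, THEN mp,
            OF prod.collapse[symmetric]])
    from mp[OF spec[OF this] IH] show ?thesis unfolding H_def .
  qed
  have "runs N n A (Seq c d, s) (bind_pmf (step N n A (Seq c d, s)) (\<lambda>C. map_pmf (apfst Suc) (H' C)))"
    by (rule runs.runs_step) (use runs_step.hyps(1) 1 in \<open>auto simp: H'_def\<close>)
  moreover have "H' (case C of (c', s') \<Rightarrow> (Seq c' d, s')) = H C" for C
    by (cases C) (auto simp: H'_def)
  ultimately show ?case
    using runs_step.hyps(1)
    by (simp add: bind_map_pmf H_def bind_assoc_pmf map_bind_pmf map_pmf_comp o_def apfst_def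
        map_prod_def split_def)
qed

lemma runs_unique:
  assumes "runs N n A C E" "runs N n A C E'"
  shows "E = E'"
  using assms
proof (induction arbitrary: E' rule: runs.induct)
  case (runs_Skip s)
  then show ?case by (auto elim: runs.cases)
next
  case (runs_step c s F)
  from runs_step.prems obtain F' where
    "\<forall>C\<in>set_pmf (step N n A (c, s)). runs N n A C (F' C)"
    "E' = bind_pmf (step N n A (c, s)) (\<lambda>C. map_pmf (apfst Suc) (F' C))"
    using runs_step.hyps(1) by (auto elim: runs.cases)
  then show ?case using runs_step.IH by (auto intro!: bind_pmf_cong)
qed

text \<open>
  The program is coupled with a distribution \<open>D\<close> on abstract results; the time is only related to
  the result, so \<open>D\<close> need not carry it.
\<close>

definition refines :: "nat \<Rightarrow> nat \<Rightarrow> (nat \<Rightarrow> nat \<Rightarrow> 'a::linorder) \<Rightarrow> com \<Rightarrow> state \<Rightarrow>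
    'b pmf \<Rightarrow> ('b \<Rightarrow> nat \<Rightarrow> state \<Rightarrow> bool) \<Rightarrow> bool" where
  "refines N n A c s D Q \<longleftrightarrow>
     (\<exists>E. runs N n A (c, s) E \<and> rel_pmf (\<lambda>x b. Q b (fst x) (snd x)) E D)"

lemma refines_mono:
  assumes "refines N n A c s D Q" "\<And>b t s'. b \<in> set_pmf D \<Longrightarrow> Q b t s' \<Longrightarrow> Q' b t s'"
  shows "refines N n A c s D Q'"
  using assms unfolding refines_def by (blast intro: pmf.rel_mono_strong)

lemma refines_Seq:
  assumes "refines N n A c s D Q"
    "\<And>b t s'. b \<in> set_pmf D \<Longrightarrow> Q b t s' \<Longrightarrow> refines N n A d s' (F b) (\<lambda>b' t' s''. Q' b' (t + 1 + t') s'')"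
  shows "refines N n A (Seq c d) s (bind_pmf D F) Q'"
proof -
  obtain E where E: "runs N n A (c, s) E" "rel_pmf (\<lambda>x b. Q b (fst x) (snd x)) E D"
    using assms(1) by (auto simp: refines_def)
  \<comment> \<open>Several \<open>b\<close> may be coupled with the same \<open>x\<close>, each
    with its own witness. By \<open>runs_unique\<close> these agree, so a single function of
    \<open>x\<close> serves all of them.\<close>
  define G where "G x = (THE G. runs N n A (d, snd x) G)" for x :: "nat \<times> state"
  have G: "runs N n A (d, snd x) (G x)"
    "rel_pmf (\<lambda>y b'. Q' b' (fst x + 1 + fst y) (snd y)) (G x) (F b)"
    if b: "b \<in> set_pmf D" "Q b (fst x) (snd x)" for x b
  proof -
    obtain H where "runs N n A (d, snd x) H"
      "rel_pmf (\<lambda>y b'. Q' b' (fst x + 1 + fst y) (snd y)) H (F b)"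
      using assms(2)[OF b] unfolding refines_def by blast
    moreover from this have "G x = H"
      unfolding G_def using runs_unique by blast
    ultimately show "runs N n A (d, snd x) (G x)"
      "rel_pmf (\<lambda>y b'. Q' b' (fst x + 1 + fst y) (snd y)) (G x) (F b)" by auto
  qed
  have "\<forall>x\<in>set_pmf E. \<exists>b\<in>set_pmf D. Q b (fst x) (snd x)"
    using E(2) by (auto elim!: rel_pmf.cases) force
  then have "runs N n A (Seq c d, s) (bind_pmf E (\<lambda>x. map_pmf (apfst (\<lambda>u. fst x + 1 + u)) (G x)))"
    using G(1) by (intro runs_Seq E(1)) blast
  moreover have "rel_pmf (\<lambda>x b. Q' b (fst x) (snd x))
     (bind_pmf E (\<lambda>x. map_pmf (apfst (\<lambda>u. fst x + 1 + u)) (G x))) (bind_pmf D F)"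
  proof (rule rel_pmf_bindI)
    show "rel_pmf (\<lambda>x b. b \<in> set_pmf D \<and> Q b (fst x) (snd x)) E D"
      using E(2) by (rule pmf.rel_mono_strong) auto
  next
    fix x b assume "b \<in> set_pmf D \<and> Q b (fst x) (snd x)"
    then show "rel_pmf (\<lambda>x b. Q' b (fst x) (snd x)) (map_pmf (apfst (\<lambda>u. fst x + 1 + u)) (G x)) (F b)"
      using G(2)[of b x] by (simp add: pmf.rel_map)
  qed
  ultimately show ?thesis unfolding refines_def by blast
qed

section \<open>Straight-line code, draws and loops\<close>

fun loopfree :: "com \<Rightarrow> bool" where
  "loopfree (Seq c d) = (loopfree c \<and> loopfree d)"
| "loopfree (Cond e c d) = (loopfree c \<and> loopfree d)"
| "loopfree (While e c) = False"
| "loopfree (Draw r e) = False"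
| "loopfree c = True"

fun exec :: "nat \<Rightarrow> nat \<Rightarrow> (nat \<Rightarrow> nat \<Rightarrow> 'a::linorder) \<Rightarrow> com \<Rightarrow> state \<Rightarrow> state" where
  "exec N n A Skip s = s"
| "exec N n A (Assign r e) s = set_reg r (eval N s e) s"
| "exec N n A (Store e f) s = set_mem (eval N s e) (eval N s f) s"
| "exec N n A (Compare r e f g h) s = set_reg r
     (compare_entries n A (eval N s e) (eval N s f) (eval N s g) (eval N s h)) s"
| "exec N n A (Seq c d) s = exec N n A d (exec N n A c s)"
| "exec N n A (Cond e c d) s = (if eval N s e \<noteq> 0 then exec N n A c s else exec N n A d s)"
| "exec N n A c s = s"

fun weight :: "com \<Rightarrow> nat" where
  "weight (Seq c d) = weight c + weight d + 1"
| "weight (Cond e c d) = weight c + weight d + 1"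
| "weight c = 1"

lemma refines_Skip: "Q b 0 s \<Longrightarrow> refines N n A Skip s (return_pmf b) Q"
  unfolding refines_def by (intro exI[of _ "return_pmf (0, s)"]) (auto intro: runs_Skip)

lemma runs_step_return:
  assumes "c \<noteq> Skip" "step N n A (c, s) = return_pmf (d, s')" "runs N n A (d, s') E"
  shows "runs N n A (c, s) (map_pmf (apfst Suc) E)"
  using runs_step[of c N n A s "\<lambda>_. E"] assms by (simp add: bind_return_pmf)

lemma refines_step:
  assumes "c \<noteq> Skip" "step N n A (c, s) = return_pmf (d, s')"
    "refines N n A d s' D (\<lambda>b t. Q b (Suc t))"
  shows "refines N n A c s D Q"
proof -
  obtain E where "runs N n A (d, s') E" "rel_pmf (\<lambda>x b. Q b (Suc (fst x)) (snd x)) E D"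
    using assms(3) by (auto simp: refines_def)
  then show ?thesis
    unfolding refines_def using runs_step_return[OF assms(1,2)]
    by (intro exI[of _ "map_pmf (apfst Suc) E"]) (simp add: pmf.rel_map)
qed

lemma loopfree_refines:
  assumes "loopfree c"
  shows "refines N n A c s (return_pmf ()) (\<lambda>_ t s'. t \<le> weight c \<and> s' = exec N n A c s)"
  using assms
proof (induction c arbitrary: s)
  case (Seq c d)
  have "refines N n A (Seq c d) s (bind_pmf (return_pmf ()) (\<lambda>_. return_pmf ()))
      (\<lambda>_ t s'. t \<le> weight (Seq c d) \<and> s' = exec N n A (Seq c d) s)"
    by (rule refines_Seq[OF Seq.IH(1)]) (use Seq.prems in \<open>auto intro!: refines_mono[OF Seq.IH(2)]\<close>)
  then show ?case by (simp add: bind_return_pmf)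
next
  case (Cond e c d)
  show ?case
    by (rule refines_step[OF _ step.simps(7)])
      (use Cond in \<open>auto intro!: refines_mono[OF Cond.IH(1)] refines_mono[OF Cond.IH(2)]\<close>)
next
  case Skip
  show ?case by (simp add: refines_Skip)
next
  case (Assign r e)
  show ?case by (rule refines_step[OF _ step.simps(2)]) (auto intro!: refines_Skip)
next
  case (Store e f)
  show ?case by (rule refines_step[OF _ step.simps(3)]) (auto intro!: refines_Skip)
next
  case (Compare r e f g h)
  show ?case by (rule refines_step[OF _ step.simps(4)]) (auto intro!: refines_Skip)
qed simp_all

lemma refines_loopfree:
  assumes "loopfree c" "\<And>t. t \<le> weight c \<Longrightarrow> Q b t (exec N n A c s)"
  shows "refines N n A c s (return_pmf b) Q"
proof -
  have "refines N n A c s (map_pmf (\<lambda>_. b) (return_pmf ())) Q"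
    using loopfree_refines[OF assms(1), of N n A s] assms(2) unfolding refines_def pmf.rel_map
    by (auto elim!: pmf.rel_mono_strong)
  then show ?thesis by simp
qed

lemma refines_Draw:
  assumes "1 \<le> eval N s e" "eval N s e \<le> n"
    "\<And>v. 1 \<le> v \<Longrightarrow> v \<le> eval N s e \<Longrightarrow> Q v 1 (set_reg r v s)"
  shows "refines N n A (Draw r e) s (pmf_of_set {1..eval N s e}) Q"
proof -
  define D where "D = pmf_of_set {1..eval N s e}"
  have D: "draw n (eval N s e) = D" "set_pmf D = {1..eval N s e}"
    using assms by (auto simp: draw_def D_def)
  have "runs N n A (Draw r e, s) (bind_pmf (step N n A (Draw r e, s))
      (\<lambda>C. map_pmf (apfst Suc) (return_pmf (0, snd C))))"
    by (rule runs_step) (auto intro: runs_Skip)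
  then have "runs N n A (Draw r e, s) (map_pmf (\<lambda>v. (1, set_reg r v s)) D)"
    by (simp add: D bind_map_pmf map_pmf_def[symmetric] map_pmf_comp)
  moreover have "rel_pmf (\<lambda>x b. Q b (fst x) (snd x)) (map_pmf (\<lambda>v. (1, set_reg r v s)) D) D"
    unfolding pmf.rel_map using assms D by (auto intro!: rel_pmf_reflI)
  ultimately show ?thesis unfolding refines_def D_def[symmetric] by blast
qed

text \<open>The number counts the iterations left and falls like the counter registers of the code.
  The body sees it already decremented, so it can serve as an index into a list.\<close>

fun loop_pmf :: "('b \<Rightarrow> bool) \<Rightarrow> (nat \<Rightarrow> 'b \<Rightarrow> 'b pmf) \<Rightarrow> nat \<Rightarrow> 'b \<Rightarrow> 'b pmf" where
  "loop_pmf g F 0 b = return_pmf b"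
| "loop_pmf g F (Suc k) b = (if g b then bind_pmf (F k b) (loop_pmf g F k) else return_pmf b)"

text \<open>\<open>I\<close> carries the iterations left and the time spent. An iteration costs 2
  besides its body, for the guard and for leaving the sequence; the failing guard at the end is the
  1 in \<open>post\<close>.\<close>

lemma refines_While:
  assumes I: "I k b t s"
    and guard: "\<And>k b t s. I k b t s \<Longrightarrow> eval N s e \<noteq> 0 \<longleftrightarrow> 0 < k \<and> g b"
    and body: "\<And>k b t s. I (Suc k) b t s \<Longrightarrow> g b \<Longrightarrow>
        refines N n A c s (F k b) (\<lambda>b' t' s'. I k b' (t + t' + 2) s')"
    and post: "\<And>k b u t' s'. I k b u s' \<Longrightarrow> k = 0 \<or> \<not> g b \<Longrightarrow> t + t' = u + 1 \<Longrightarrow> Q b t' s'"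
  shows "refines N n A (While e c) s (loop_pmf g F k b) Q"
proof -
  have "refines N n A (While e c) s (loop_pmf g F k b)
     (\<lambda>b t' s'. \<exists>k u. I k b u s' \<and> (k = 0 \<or> \<not> g b) \<and> t + t' = u + 1)"
    using I
  proof (induction k arbitrary: b t s)
    case 0
    then have "eval N s e = 0" using guard by blast
    then show ?case using 0
      by (auto intro!: refines_step[OF _ step.simps(8)] refines_Skip exI[of _ "0::nat"])
  next
    case (Suc k)
    show ?case
    proof (cases "g b")
      case False
      then have "eval N s e = 0" using guard Suc.prems by blast
      then show ?thesis using Suc.prems False
        by (auto intro!: refines_step[OF _ step.simps(8)] refines_Skip exI[of _ "Suc k"])
    next
      case True
      then have "eval N s e \<noteq> 0" using guard Suc.prems by blast
      then have "refines N n A (While e c) s (F k b \<bind> loop_pmf g F k)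
         (\<lambda>b t' s'. \<exists>k u. I k b u s' \<and> (k = 0 \<or> \<not> g b) \<and> t + t' = u + 1)"
      proof (intro refines_step[OF _ step.simps(8)])
        assume "eval N s e \<noteq> 0"
        have "refines N n A (Seq c (While e c)) s (F k b \<bind> loop_pmf g F k)
         (\<lambda>b t' s'. \<exists>k u. I k b u s' \<and> (k = 0 \<or> \<not> g b) \<and> t + Suc t' = u + 1)"
        proof (rule refines_Seq[OF body[OF Suc.prems True]])
          fix b' t' s' assume "I k b' (t + t' + 2) s'"
          from Suc.IH[OF this] show "refines N n A (While e c) s' (loop_pmf g F k b')
            (\<lambda>b u' s''. \<exists>k u. I k b u s'' \<and> (k = 0 \<or> \<not> g b) \<and> t + Suc (t' + 1 + u') = u + 1)"
            by (rule refines_mono) (simp add: algebra_simps)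
        qed
        then show "refines N n A (if eval N s e \<noteq> 0 then Seq c (While e c) else Skip) s (F k b \<bind> loop_pmf g F k)
         (\<lambda>b t' s'. \<exists>k u. I k b u s' \<and> (k = 0 \<or> \<not> g b) \<and> t + Suc t' = u + 1)"
          using \<open>eval N s e \<noteq> 0\<close> by simp
      qed simp
      then show ?thesis using True by simp
    qed
  qed
  then show ?thesis by (rule refines_mono) (use post in blast)
qed

section \<open>Bounds on expectations\<close>

text \<open>Negative values of the integrand count as 0.\<close>

definition expect_le :: "'b pmf \<Rightarrow> ('b \<Rightarrow> real) \<Rightarrow> real \<Rightarrow> bool" where
  "expect_le D f e \<longleftrightarrow> (\<integral>\<^sup>+x. ennreal (f x) \<partial>measure_pmf D) \<le> ennreal e"

lemma expect_le_return: "f x \<le> e \<Longrightarrow> expect_le (return_pmf x) f e"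
  by (simp add: expect_le_def ennreal_leI)

lemma expect_le_mono:
  assumes "expect_le D f e" "\<And>x. x \<in> set_pmf D \<Longrightarrow> g x \<le> f x" "e \<le> e'"
  shows "expect_le D g e'"
proof -
  have "(\<integral>\<^sup>+x. ennreal (g x) \<partial>measure_pmf D) \<le> (\<integral>\<^sup>+x. ennreal (f x) \<partial>measure_pmf D)"
    by (intro nn_integral_mono_AE) (auto simp: AE_measure_pmf_iff assms ennreal_leI)
  also have "\<dots> \<le> ennreal e" using assms(1) by (simp add: expect_le_def)
  also have "\<dots> \<le> ennreal e'" by (rule ennreal_leI[OF assms(3)])
  finally show ?thesis by (simp add: expect_le_def)
qed

lemma expect_le_bind:
  assumes "expect_le D h e" "\<And>x. x \<in> set_pmf D \<Longrightarrow> expect_le (F x) f (h x)"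
  shows "expect_le (bind_pmf D F) f e"
proof -
  have "(\<integral>\<^sup>+x. ennreal (f x) \<partial>measure_pmf (bind_pmf D F)) =
      (\<integral>\<^sup>+x. (\<integral>\<^sup>+y. ennreal (f y) \<partial>measure_pmf (F x)) \<partial>measure_pmf D)"
    by simp
  also have "\<dots> \<le> (\<integral>\<^sup>+x. ennreal (h x) \<partial>measure_pmf D)"
    using assms(2) by (intro nn_integral_mono_AE) (auto simp: AE_measure_pmf_iff expect_le_def)
  also have "\<dots> \<le> ennreal e" using assms(1) by (simp add: expect_le_def)
  finally show ?thesis by (simp add: expect_le_def)
qed

lemma expect_le_map: "expect_le (map_pmf g D) f e \<longleftrightarrow> expect_le D (\<lambda>x. f (g x)) e"
  by (simp add: expect_le_def)

lemma expect_le_const: "expect_le D (\<lambda>_. c) c"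
  by (simp add: expect_le_def)

lemma expect_le_cmult:
  assumes "expect_le D f e" "0 \<le> c" "0 \<le> e"
  shows "expect_le D (\<lambda>x. c * f x) (c * e)"
proof -
  have "(\<integral>\<^sup>+x. ennreal (c * f x) \<partial>measure_pmf D) = ennreal c * (\<integral>\<^sup>+x. ennreal (f x) \<partial>measure_pmf D)"
    using assms(2) by (simp add: ennreal_mult' nn_integral_cmult)
  also have "\<dots> \<le> ennreal c * ennreal e"
    using assms(1) by (intro mult_left_mono) (auto simp: expect_le_def)
  finally show ?thesis using assms by (simp add: expect_le_def ennreal_mult)
qed

lemma expect_le_add:
  assumes "expect_le D f a" "expect_le D g b" "\<And>x. 0 \<le> f x" "\<And>x. 0 \<le> g x" "0 \<le> a" "0 \<le> b"
  shows "expect_le D (\<lambda>x. f x + g x) (a + b)"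
  using assms by (auto simp: expect_le_def nn_integral_add intro: add_mono)

lemma expect_le_pmf_of_set:
  fixes f :: "'b \<Rightarrow> real" and e :: real
  assumes "finite S" "S \<noteq> {}" "\<And>x. x \<in> S \<Longrightarrow> 0 \<le> f x" "sum f S \<le> e * card S"
  shows "expect_le (pmf_of_set S) f e"
proof -
  have c: "0 < card S" using assms by (simp add: card_gt_0_iff)
  have "(\<integral>\<^sup>+x. ennreal (f x) \<partial>measure_pmf (pmf_of_set S)) = (\<Sum>x\<in>S. ennreal (f x)) / card S"
    using nn_integral_pmf_of_set[OF assms(2,1)] by simp
  also have "\<dots> = ennreal (sum f S / card S)"
    using assms c by (simp add: sum_ennreal divide_ennreal sum_nonneg ennreal_of_nat_eq_real_of_nat)
  also have "\<dots> \<le> ennreal e"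
    using assms c by (intro ennreal_leI) (simp add: field_simps)
  finally show ?thesis by (simp add: expect_le_def)
qed

lemma expect_le_prob:
  assumes "0 \<le> e"
  shows "expect_le D (\<lambda>x. of_bool (P x)) e \<longleftrightarrow> measure_pmf.prob D {x. P x} \<le> e"
proof -
  have "(\<integral>\<^sup>+x. ennreal (of_bool (P x)) \<partial>measure_pmf D) = (\<integral>\<^sup>+x. indicator {x. P x} x \<partial>measure_pmf D)"
    by (intro nn_integral_cong) (auto simp: indicator_def)
  also have "\<dots> = ennreal (measure_pmf.prob D {x. P x})"
    by (simp add: measure_pmf.emeasure_eq_measure)
  finally show ?thesis using assms by (simp add: expect_le_def)
qed

text \<open>A supermartingale argument: \<open>\<Phi> k b\<close> bounds the expected final value of
  \<open>f\<close> when \<open>k\<close> iterations are left. Counts, trials and probes differ only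
  in the potential.\<close>

lemma expect_le_loop:
  assumes "\<And>b. Inv b \<Longrightarrow> f b \<le> \<Phi> 0 b" "\<And>k b. Inv b \<Longrightarrow> \<not> g b \<Longrightarrow> f b \<le> \<Phi> k b"
    "\<And>k b. Inv b \<Longrightarrow> g b \<Longrightarrow> expect_le (F k b) (\<Phi> k) (\<Phi> (Suc k) b)"
    "\<And>k b b'. Inv b \<Longrightarrow> g b \<Longrightarrow> b' \<in> set_pmf (F k b) \<Longrightarrow> Inv b'"
    "Inv b"
  shows "expect_le (loop_pmf g F k b) f (\<Phi> k b)"
  using assms(5)
proof (induction k arbitrary: b)
  case 0
  then show ?case using assms(1) by (auto intro: expect_le_return)
next
  case (Suc k)
  show ?case
  proof (cases "g b")
    case True
    then have "expect_le (F k b \<bind> loop_pmf g F k) f (\<Phi> (Suc k) b)"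
      using Suc assms by (intro expect_le_bind[OF assms(3)]) auto
    then show ?thesis using True by simp
  qed (use Suc assms in \<open>auto intro: expect_le_return\<close>)
qed

lemma loop_pmf_Inv:
  assumes "\<And>k b b'. Inv b \<Longrightarrow> g b \<Longrightarrow> b' \<in> set_pmf (F k b) \<Longrightarrow> Inv b'" "Inv b"
    "b' \<in> set_pmf (loop_pmf g F k b)"
  shows "Inv b'"
  using assms(2,3) by (induction k arbitrary: b) (auto split: if_splits dest: assms(1))

section \<open>Ranks and Chernoff bounds for sample counts\<close>

lemma rank_bij:
  fixes f :: "'a \<Rightarrow> 'b::linorder"
  assumes "finite R" "inj_on f R"
  shows "bij_betw (\<lambda>r. card {x\<in>R. f x < f r}) R {..<card R}"
proof -
  have inj: "inj_on (\<lambda>r. card {x\<in>R. f x < f r}) R"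
  proof (rule inj_onI, rule ccontr)
    have less: "card {x\<in>R. f x < f r} < card {x\<in>R. f x < f r'}" if "r \<in> R" "f r < f r'" for r r'
      using assms that by (intro psubset_card_mono) auto
    fix r r' assume r: "r \<in> R" "r' \<in> R" "card {x\<in>R. f x < f r} = card {x\<in>R. f x < f r'}" "r \<noteq> r'"
    then have "f r \<noteq> f r'" using assms by (auto dest: inj_onD)
    then have "f r < f r' \<or> f r' < f r" by auto
    then show False using less[of r r'] less[of r' r] r by auto
  qed
  have "card {x\<in>R. f x < f r} < card R" if "r \<in> R" for r
    using assms that by (intro psubset_card_mono) auto
  then have "(\<lambda>r. card {x\<in>R. f x < f r}) ` R \<subseteq> {..<card R}" by auto
  moreover have "card ((\<lambda>r. card {x\<in>R. f x < f r}) ` R) = card R"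
    using inj by (rule card_image)
  ultimately have "(\<lambda>r. card {x\<in>R. f x < f r}) ` R = {..<card R}"
    by (intro card_subset_eq) auto
  then show ?thesis using inj by (simp add: bij_betw_def)
qed

text \<open>Reduces the size of the lower half or quarter of a column to counting an initial or
  final segment of the naturals.\<close>

lemma card_rank:
  fixes f :: "'a \<Rightarrow> 'b::linorder"
  assumes "finite R" "inj_on f R"
  shows "card {r\<in>R. P (card {x\<in>R. f x < f r})} = card {i. i < card R \<and> P i}"
proof -
  have "bij_betw (\<lambda>r. card {x\<in>R. f x < f r}) {r\<in>R. P (card {x\<in>R. f x < f r})} {i. i < card R \<and> P i}"
  proof (rule bij_betw_imageI)
    show "inj_on (\<lambda>r. card {x\<in>R. f x < f r}) {r\<in>R. P (card {x\<in>R. f x < f r})}"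
      using rank_bij[OF assms] unfolding bij_betw_def by (rule inj_on_subset[OF conjunct1]) auto
    have *: "(\<lambda>r. card {x\<in>R. f x < f r}) ` R = {..<card R}"
      using rank_bij[OF assms] by (simp add: bij_betw_def)
    show "(\<lambda>r. card {x\<in>R. f x < f r}) ` {r\<in>R. P (card {x\<in>R. f x < f r})} = {i. i < card R \<and> P i}"
    proof (intro set_eqI iffI)
      fix i assume "i \<in> {i. i < card R \<and> P i}"
      then have "i \<in> (\<lambda>r. card {x\<in>R. f x < f r}) ` R" "P i" using * by auto
      then show "i \<in> (\<lambda>r. card {x\<in>R. f x < f r}) ` {r\<in>R. P (card {x\<in>R. f x < f r})}" by auto
    next
      fix i assume "i \<in> (\<lambda>r. card {x\<in>R. f x < f r}) ` {r\<in>R. P (card {x\<in>R. f x < f r})}"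
      then have "i \<in> (\<lambda>r. card {x\<in>R. f x < f r}) ` R" "P i" by auto
      then show "i \<in> {i. i < card R \<and> P i}" using * by auto
    qed
  qed
  then show ?thesis by (rule bij_betw_same_card)
qed

text \<open>The exponential moment of a binomial count: one sample contributes the mean
  \<open>1 + (w - 1) * p\<close>, where \<open>p\<close> is the fraction of \<open>R\<close>
  satisfying \<open>P\<close>, and assumption \<open>mu\<close> bounds this by \<open>\<mu>\<close>
  with the denominator cleared.\<close>

lemma expect_le_count:
  fixes w \<mu> :: real
  assumes R: "finite R" "R \<noteq> {}" and w: "0 \<le> w"
    and mu: "real (card {x\<in>R. P x}) * (w - 1) \<le> (\<mu> - 1) * card R"
  shows "expect_le (loop_pmf (\<lambda>_. True) (\<lambda>_ a. map_pmf (\<lambda>x. if P x then Suc a else a) (pmf_of_set R)) k 0)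
     (\<lambda>a. w ^ a) (\<mu> ^ k)"
proof -
  have m: "0 < card R" using R by (simp add: card_gt_0_iff)
  have split: "(\<Sum>x\<in>R. if P x then w else 1) = card {x\<in>R. P x} * (w - 1) + card R"
  proof -
    have "(\<Sum>x\<in>R. if P x then w else 1) = (\<Sum>x\<in>R. (if P x then w - 1 else 0) + 1)"
      by (intro sum.cong) auto
    also have "\<dots> = (\<Sum>x\<in>{x\<in>R. P x}. w - 1) + card R"
      using R by (simp only: sum.distrib sum.inter_filter) simp
    finally show ?thesis by simp
  qed
  have mu0: "0 \<le> \<mu>"
  proof -
    have "0 \<le> (\<Sum>x\<in>R. if P x then w else 1)" using w by (intro sum_nonneg) auto
    then have "0 \<le> \<mu> * card R" using mu split by (simp add: algebra_simps)
    then show ?thesis using m by (simp add: zero_le_mult_iff)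
  qed
  have "expect_le (loop_pmf (\<lambda>_. True) (\<lambda>_ a. map_pmf (\<lambda>x. if P x then Suc a else a) (pmf_of_set R)) k 0)
     (\<lambda>a. w ^ a) (w ^ 0 * \<mu> ^ k)"
  proof (rule expect_le_loop[where Inv = "\<lambda>_. True" and \<Phi> = "\<lambda>k a. w ^ a * \<mu> ^ k"])
    fix k a
    have "(\<Sum>x\<in>R. w ^ (if P x then Suc a else a) * \<mu> ^ k) = w ^ a * \<mu> ^ k * (\<Sum>x\<in>R. if P x then w else 1)"
      unfolding sum_distrib_left by (intro sum.cong) auto
    also have "\<dots> \<le> w ^ a * \<mu> ^ k * (\<mu> * card R)"
      using mu split w mu0 by (intro mult_left_mono) (auto simp: algebra_simps)
    finally show "expect_le (map_pmf (\<lambda>x. if P x then Suc a else a) (pmf_of_set R))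
        (\<lambda>a. w ^ a * \<mu> ^ k) (w ^ a * \<mu> ^ Suc k)"
      unfolding expect_le_map using w mu0 by (intro expect_le_pmf_of_set[OF R]) (auto simp: algebra_simps)
  qed auto
  then show ?thesis by simp
qed

lemma count_upper_tail:
  assumes R: "finite R" "R \<noteq> {}" and "4 * card {x\<in>R. P x} \<le> card R"
  shows "expect_le (loop_pmf (\<lambda>_. True) (\<lambda>_ a. map_pmf (\<lambda>x. if P x then Suc a else a) (pmf_of_set R)) d 0)
     (\<lambda>a. of_bool (d < 3 * a)) ((99 / 100) ^ d)"
proof -
  let ?D = "loop_pmf (\<lambda>_. True) (\<lambda>_ a. map_pmf (\<lambda>x. if P x then Suc a else a) (pmf_of_set R)) d 0"
  \<comment> \<open>Chernoff with \<open>512 / 343 = (8 / 7) ^ 3\<close>, so that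
    \<open>d < 3 * a\<close> compares exponents of \<open>8 / 7\<close>. A fraction of at most 1/4
    gives the mean \<open>1 + (512 / 343 - 1) / 4 = 1541 / 1372\<close>.\<close>
  have "real (card {x\<in>R. P x}) * (512 / 343 - 1) \<le> (1541 / 1372 - 1) * card R"
    using assms(3) by simp
  then have "expect_le ?D (\<lambda>a. (512 / 343) ^ a) ((1541 / 1372) ^ d)"
    using expect_le_count[OF R] by force
  then have "expect_le ?D (\<lambda>a. (7 / 8) ^ d * (512 / 343) ^ a) ((7 / 8) ^ d * (1541 / 1372) ^ d)"
    by (rule expect_le_cmult) auto
  then show ?thesis
  proof (rule expect_le_mono)
    fix a
    show "of_bool (d < 3 * a) \<le> (7 / 8 :: real) ^ d * (512 / 343) ^ a"
    proof (cases "d < 3 * a")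
      case True
      have "(512 / 343 :: real) ^ a = (8 / 7) ^ (3 * a)"
        by (simp add: power_mult power3_eq_cube)
      also have "\<dots> \<ge> (8 / 7) ^ d" using True by (intro power_increasing) auto
      finally have "(7 / 8 :: real) ^ d * (512 / 343) ^ a \<ge> (7 / 8) ^ d * (8 / 7) ^ d"
        by (intro mult_left_mono) auto
      then show ?thesis using True by (simp flip: power_mult_distrib)
    qed auto
    show "(7 / 8) ^ d * (1541 / 1372) ^ d \<le> (99 / 100 :: real) ^ d"
      unfolding power_mult_distrib[symmetric] by (intro power_mono) auto
  qed
qed

lemma count_lower_tail:
  assumes R: "finite R" "R \<noteq> {}" and "card R \<le> 2 * card {x\<in>R. P x}"
  shows "expect_le (loop_pmf (\<lambda>_. True) (\<lambda>_ a. map_pmf (\<lambda>x. if P x then Suc a else a) (pmf_of_set R)) d 0)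
     (\<lambda>a. of_bool (3 * a \<le> d)) ((99 / 100) ^ d)"
proof -
  let ?D = "loop_pmf (\<lambda>_. True) (\<lambda>_ a. map_pmf (\<lambda>x. if P x then Suc a else a) (pmf_of_set R)) d 0"
  \<comment> \<open>The mirror image, with \<open>343 / 512 = (7 / 8) ^ 3\<close>; a fraction of at
    least 1/2 gives the mean \<open>1 - (1 - 343 / 512) / 2 = 855 / 1024\<close>.\<close>
  have "real (card {x\<in>R. P x}) * (343 / 512 - 1) \<le> (855 / 1024 - 1) * card R"
    using assms(3) by simp
  then have "expect_le ?D (\<lambda>a. (343 / 512) ^ a) ((855 / 1024) ^ d)"
    using expect_le_count[OF R] by force
  then have "expect_le ?D (\<lambda>a. (8 / 7) ^ d * (343 / 512) ^ a) ((8 / 7) ^ d * (855 / 1024) ^ d)"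
    by (rule expect_le_cmult) auto
  then show ?thesis
  proof (rule expect_le_mono)
    fix a
    show "of_bool (3 * a \<le> d) \<le> (8 / 7 :: real) ^ d * (343 / 512) ^ a"
    proof (cases "3 * a \<le> d")
      case True
      have "(343 / 512 :: real) ^ a = (7 / 8) ^ (3 * a)"
        by (simp add: power_mult power3_eq_cube)
      also have "\<dots> \<ge> (7 / 8) ^ d" using True by (intro power_decreasing) auto
      finally have "(8 / 7 :: real) ^ d * (343 / 512) ^ a \<ge> (8 / 7) ^ d * (7 / 8) ^ d"
        by (intro mult_left_mono) auto
      then show ?thesis using True by (simp flip: power_mult_distrib)
    qed auto
    show "(8 / 7) ^ d * (855 / 1024) ^ d \<le> (99 / 100 :: real) ^ d"
      unfolding power_mult_distrib[symmetric] by (intro power_mono) auto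
  qed
qed

section \<open>Random search for a pivot\<close>

locale submatrix =
  fixes R C :: "nat set" and B :: "nat \<Rightarrow> nat \<Rightarrow> int" and d :: nat
  assumes finR: "finite R" and R_ne: "R \<noteq> {}" and finC: "finite C" and C_ne: "C \<noteq> {}"
    and inj: "\<And>j. j \<in> C \<Longrightarrow> inj_on (\<lambda>r. B r j) R" and d_pos: "1 \<le> d"
begin

text \<open>
  A \<open>valid\<close> pivot deletes about half of the rows, since at most \<open>below\<close> + 1 rows survive it.
  A column that is not \<open>bad\<close> shows an entry below the pivot within expected 8 random probes.
\<close>

definition below :: "nat \<Rightarrow> nat \<Rightarrow> nat" where
  "below r j = card {x\<in>R. B x j < B r j}"

definition valid :: "nat \<times> nat \<Rightarrow> bool" where
  "valid p \<longleftrightarrow> 2 * below (fst p) (snd p) < card R"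

abbreviation val :: "nat \<times> nat \<Rightarrow> int" where
  "val p \<equiv> B (fst p) (snd p)"

definition bad :: "int \<Rightarrow> nat \<Rightarrow> bool" where
  "bad v j \<longleftrightarrow> 8 * card {r\<in>R. B r j \<le> v} < card R"

text \<open>A bad column may consume all \<open>d\<close> probes of its loop. The factor
  \<open>d\<close> limits the bad columns together to \<open>card C\<close> probes.\<close>

definition good_pivot :: "int \<Rightarrow> bool" where
  "good_pivot v \<longleftrightarrow> d * card {j\<in>C. bad v j} \<le> card C"

text \<open>The second component of \<open>probe\<close> and \<open>pass\<close> counts loop iterations, which bound the running time.\<close>

definition count :: "nat \<Rightarrow> nat \<Rightarrow> nat pmf" where
  "count r c = loop_pmf (\<lambda>_. True) (\<lambda>_ a. map_pmf (\<lambda>x. if B x c < B r c then Suc a else a) (pmf_of_set R)) d 0"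

text \<open>The cutoff 1/3 for the sampled rank lies between 1/4, where an entry is rarely rejected,
  and 1/2, from where on it is rarely accepted. In between the entry is valid, and either decision
  is harmless.\<close>

definition trial :: "nat \<times> nat \<Rightarrow> (nat \<times> nat) pmf" where
  "trial p = pmf_of_set C \<bind> (\<lambda>c. pmf_of_set R \<bind> (\<lambda>r.
     map_pmf (\<lambda>a. if val p < B r c \<and> 3 * a \<le> d then (r, c) else p) (count r c)))"

definition trials :: "nat \<times> nat \<Rightarrow> (nat \<times> nat) pmf" where
  "trials = loop_pmf (\<lambda>_. True) (\<lambda>_. trial) (d * d)"

definition probe_loop :: "nat \<Rightarrow> int \<Rightarrow> nat \<Rightarrow> nat \<times> nat \<Rightarrow> (nat \<times> nat) pmf" where
  "probe_loop j v = loop_pmf (\<lambda>(q, t). v < B q j)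
     (\<lambda>_ (q, t). map_pmf (\<lambda>x. (if B x j < B q j then x else q, Suc t)) (pmf_of_set R))"

definition probe :: "nat \<Rightarrow> nat \<times> nat \<Rightarrow> ((nat \<times> nat) \<times> nat) pmf" where
  "probe j p = pmf_of_set R \<bind> (\<lambda>q.
     map_pmf (\<lambda>(q, t). (if val p < B q j then (q, j) else p, t)) (probe_loop j (val p) d (q, 0)))"

definition pass_from :: "nat list \<Rightarrow> nat \<Rightarrow> (nat \<times> nat) \<times> nat \<Rightarrow> ((nat \<times> nat) \<times> nat) pmf" where
  "pass_from cs = loop_pmf (\<lambda>_. True) (\<lambda>k (p, T). map_pmf (\<lambda>(p', t). (p', T + t)) (probe (cs ! k) p))"

definition pass :: "nat list \<Rightarrow> nat \<times> nat \<Rightarrow> ((nat \<times> nat) \<times> nat) pmf" where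
  "pass cs p = pass_from cs (length cs) (p, 0)"

lemma cardR: "0 < card R" and cardC: "0 < card C"
  using finR R_ne finC C_ne by (auto simp: card_gt_0_iff)

lemma set_R: "set_pmf (pmf_of_set R) = R" and set_C: "set_pmf (pmf_of_set C) = C"
  using finR R_ne finC C_ne by auto

lemma bad_antimono: "bad w j \<Longrightarrow> v \<le> w \<Longrightarrow> bad v j"
proof -
  assume *: "bad w j" "v \<le> w"
  have "card {r\<in>R. B r j \<le> v} \<le> card {r\<in>R. B r j \<le> w}"
    using finR *(2) by (intro card_mono) auto
  then show "bad v j" using *(1) by (simp add: bad_def)
qed

text \<open>Raising the pivot can only remove bad columns, so it suffices to reach or exceed some
  good threshold.\<close>

lemma good_pivot_mono:
  assumes "good_pivot v" "v \<le> w"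
  shows "good_pivot w"
proof -
  have "card {j\<in>C. bad w j} \<le> card {j\<in>C. bad v j}"
    using finC assms(2) bad_antimono by (intro card_mono) auto
  then have "d * card {j\<in>C. bad w j} \<le> d * card {j\<in>C. bad v j}" by (rule mult_le_mono2)
  also have "\<dots> \<le> card C" using assms(1) by (simp add: good_pivot_def)
  finally show ?thesis by (simp add: good_pivot_def)
qed

lemma card_low_half:
  assumes "j \<in> C"
  shows "2 * card {r\<in>R. \<not> 2 * below r j < card R} \<le> card R"
proof -
  have "card {r\<in>R. \<not> 2 * below r j < card R} = card {i. i < card R \<and> \<not> 2 * i < card R}"
    unfolding below_def using finR inj[OF assms] by (rule card_rank)
  also have "{i. i < card R \<and> \<not> 2 * i < card R} = {(card R + 1) div 2..<card R}" by auto
  finally show ?thesis by simp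
qed

lemma card_low_quarter:
  assumes "j \<in> C"
  shows "card R < 4 * card {r\<in>R. 4 * below r j \<le> card R}"
proof -
  have "card {r\<in>R. 4 * below r j \<le> card R} = card {i. i < card R \<and> 4 * i \<le> card R}"
    unfolding below_def using finR inj[OF assms] by (rule card_rank)
  also have "{i. i < card R \<and> 4 * i \<le> card R} = {..card R div 4}" using cardR by auto
  finally show ?thesis by simp
qed

section \<open>Random trials for a high pivot\<close>

lemma trial_support:
  assumes "p' \<in> set_pmf (trial p)" "p \<in> R \<times> C"
  shows "p' \<in> R \<times> C \<and> val p \<le> val p'"
  using assms by (auto simp: trial_def set_R set_C split: if_splits)

lemma trials_support:
  assumes "p' \<in> set_pmf (trials p)" "p \<in> R \<times> C"
  shows "p' \<in> R \<times> C \<and> val p \<le> val p'"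
  using assms(1) unfolding trials_def
proof (rule loop_pmf_Inv[where Inv = "\<lambda>p'. p' \<in> R \<times> C \<and> val p \<le> val p'", rotated 2])
  fix b b' assume "b \<in> R \<times> C \<and> val p \<le> val b" "b' \<in> set_pmf (trial b)"
  then show "b' \<in> R \<times> C \<and> val p \<le> val b'" using trial_support[of b' b] by auto
qed (use assms in auto)

text \<open>Only the acceptance of an entry from the upper half does harm, and that is the lower
  tail of its sample count.\<close>

lemma trial_valid:
  assumes "valid p"
  shows "expect_le (trial p) (\<lambda>p. of_bool (\<not> valid p)) ((99 / 100) ^ d)"
proof -
  have "expect_le (count r c) (\<lambda>a. of_bool (\<not> valid (if val p < B r c \<and> 3 * a \<le> d then (r, c) else p))) ((99 / 100) ^ d)"
    if "r \<in> R" "c \<in> C" for r c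
  proof (cases "valid (r, c)")
    case True
    then show ?thesis using assms by (intro expect_le_mono[OF expect_le_const[of _ 0]]) auto
  next
    case False
    then have "card R \<le> 2 * card {x\<in>R. B x c < B r c}" by (simp add: valid_def below_def)
    from count_lower_tail[OF finR R_ne this, of d] show ?thesis
      unfolding count_def by (rule expect_le_mono) (use assms in auto)
  qed
  then show ?thesis unfolding trial_def
    by (intro expect_le_bind[OF expect_le_const]) (auto simp: set_R set_C expect_le_map)
qed

text \<open>A union bound in the form of a potential: every trial that is left adds one error term,
  and an invalid pivot already accounts for 1.\<close>

lemma trials_valid:
  assumes "valid p"
  shows "expect_le (trials p) (\<lambda>p. of_bool (\<not> valid p)) (real (d * d) * (99 / 100) ^ d)"
proof -
  have "expect_le (trials p) (\<lambda>p. of_bool (\<not> valid p)) (of_bool (\<not> valid p) + real (d * d) * (99 / 100) ^ d)"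
    unfolding trials_def
  proof (rule expect_le_loop[where Inv = "\<lambda>_. True" and \<Phi> = "\<lambda>k p. of_bool (\<not> valid p) + real k * (99 / 100) ^ d"])
    fix k b
    show "expect_le (trial b) (\<lambda>p. of_bool (\<not> valid p) + real k * (99 / 100) ^ d)
        (of_bool (\<not> valid b) + real (Suc k) * (99 / 100) ^ d)"
    proof (cases "valid b")
      case True
      have "expect_le (trial b) (\<lambda>p. of_bool (\<not> valid p) + real k * (99 / 100) ^ d) ((99 / 100) ^ d + real k * (99 / 100) ^ d)"
        using trial_valid[OF True] by (intro expect_le_add expect_le_const) auto
      then show ?thesis by (rule expect_le_mono) (use True in \<open>auto simp: algebra_simps\<close>)
    next
      case False
      then show ?thesis
        by (intro expect_le_mono[OF expect_le_const[of _ "1 + real k * (99 / 100) ^ d"]]) (auto simp: algebra_simps)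
    qed
  qed auto
  then show ?thesis using assms by simp
qed

text \<open>
  The threshold is the least entry that is a good pivot. The entry just below it is not, so many
  columns are almost entirely above that entry, and hence above or at the threshold.
\<close>

lemma good_threshold:
  obtains v where "good_pivot v"
    "card C \<le> d * card {j\<in>C. 8 * card {r\<in>R. B r j < v} < card R}"
proof -
  define V where "V = (\<lambda>(r, j). B r j) ` (R \<times> C)"
  have V: "finite V" "V \<noteq> {}" using finR R_ne finC C_ne by (auto simp: V_def)
  have "\<not> bad (Max V) j" if "j \<in> C" for j
  proof -
    have "{r\<in>R. B r j \<le> Max V} = R" using V(1) that by (force simp: V_def intro!: Max_ge)
    then show ?thesis using cardR by (simp add: bad_def)
  qed
  then have "{j\<in>C. bad (Max V) j} = {}" by blast
  then have "good_pivot (Max V)" unfolding good_pivot_def by (metis card.empty mult_0_right zero_le)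
  define G where "G = {v\<in>V. good_pivot v}"
  have G: "finite G" "G \<noteq> {}" using V(1) \<open>good_pivot (Max V)\<close> Max_in[OF V] unfolding G_def by auto
  define v where "v = Min G"
  have v: "v \<in> V" "good_pivot v" using Min_in[OF G] by (auto simp: v_def G_def)
  have "card C \<le> d * card {j\<in>C. 8 * card {r\<in>R. B r j < v} < card R}"
  proof (cases "{w\<in>V. w < v} = {}")
    case True
    \<comment> \<open>\<open>v\<close> is the least entry of all, so every column qualifies because
      \<open>R\<close> is not empty.\<close>
    then have "{r\<in>R. B r j < v} = {}" if "j \<in> C" for j using that by (auto simp: V_def)
    then have "{j\<in>C. 8 * card {r\<in>R. B r j < v} < card R} = C" using cardR
      by (metis (mono_tags, lifting) Collect_cong Collect_mem_eq card.empty mult_0_right)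
    then show ?thesis using d_pos by simp
  next
    case False
    define u where "u = Max {w\<in>V. w < v}"
    have u: "u \<in> V" "u < v" using Max_in[of "{w\<in>V. w < v}"] False V by (auto simp: u_def)
    then have "\<not> good_pivot u" using Min_le[OF G(1), of u] by (auto simp: v_def G_def)
    have "B r j < v \<longleftrightarrow> B r j \<le> u" if "r \<in> R" "j \<in> C" for r j
    proof
      assume "B r j < v"
      then have "B r j \<in> {w\<in>V. w < v}" using that by (auto simp: V_def)
      then show "B r j \<le> u" unfolding u_def using V by (intro Max_ge) auto
    qed (use u in auto)
    then have "{r\<in>R. B r j < v} = {r\<in>R. B r j \<le> u}" if "j \<in> C" for j using that by auto
    then have "{j\<in>C. 8 * card {r\<in>R. B r j < v} < card R} = {j\<in>C. bad u j}"
      by (auto simp: bad_def)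
    then show ?thesis using \<open>\<not> good_pivot u\<close> by (simp add: good_pivot_def)
  qed
  then show ?thesis using that v by blast
qed

text \<open>A column of \<open>top\<close> is drawn with probability at least \<open>1 / d\<close>.
  More than 1/4 of its rows have low rank and fewer than 1/8 lie below \<open>v\<close>, so more
  than 1/8 are favourable, and a favourable entry passes the rank test with probability at least
  1/2. The product is \<open>1 / (16 * d)\<close>.\<close>

lemma trial_good:
  assumes v: "card C \<le> d * card {j\<in>C. 8 * card {r\<in>R. B r j < v} < card R}"
    and half: "(99 / 100) ^ d \<le> (1 / 2 :: real)"
  shows "expect_le (trial p) (\<lambda>p. of_bool (val p < v)) (1 - 1 / (16 * d))"
proof -
  define fav where "fav c r \<longleftrightarrow> \<not> B r c < v \<and> 4 * below r c \<le> card R" for c r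
  define top where "top = {j\<in>C. 8 * card {r\<in>R. B r j < v} < card R}"
  have 1: "expect_le (count r c) (\<lambda>a. of_bool (val (if val p < B r c \<and> 3 * a \<le> d then (r, c) else p) < v))
      (1 - of_bool (fav c r) / 2)" if "r \<in> R" "c \<in> C" for r c
  proof (cases "fav c r")
    case False
    then show ?thesis by (intro expect_le_mono[OF expect_le_const[of _ 1]]) auto
  next
    case True
    then have "4 * card {x\<in>R. B x c < B r c} \<le> card R" by (simp add: fav_def below_def)
    from count_upper_tail[OF finR R_ne this, of d] show ?thesis
      unfolding count_def by (rule expect_le_mono) (use half True in \<open>auto simp: fav_def\<close>)
  qed
  have 2: "expect_le (pmf_of_set R) (\<lambda>r. 1 - of_bool (fav c r) / 2) (1 - of_bool (c \<in> top) / 16)"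
    if c: "c \<in> C" for c
  proof (rule expect_le_pmf_of_set[OF finR R_ne])
    have eq: "(\<Sum>r\<in>R. 1 - of_bool (fav c r) / 2 :: real) = card R - card {r\<in>R. fav c r} / 2"
      using finR by (simp add: sum_subtractf sum_divide_distrib[symmetric] Int_def)
    have "real (card R) \<le> 8 * card {r\<in>R. fav c r}" if "c \<in> top"
    proof -
      have "{r\<in>R. 4 * below r c \<le> card R} \<subseteq> {r\<in>R. fav c r} \<union> {r\<in>R. B r c < v}"
        by (auto simp: fav_def)
      then have "card {r\<in>R. 4 * below r c \<le> card R} \<le> card {r\<in>R. fav c r} + card {r\<in>R. B r c < v}"
        using finR by (intro order_trans[OF card_mono card_Un_le]) auto
      moreover have "8 * card {r\<in>R. B r c < v} < card R" using that by (simp add: top_def)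
      ultimately show ?thesis using card_low_quarter[OF c] by linarith
    qed
    then show "(\<Sum>r\<in>R. 1 - of_bool (fav c r) / 2) \<le> (1 - of_bool (c \<in> top) / 16) * real (card R)"
      unfolding eq by (cases "c \<in> top") (auto simp: algebra_simps)
  qed auto
  have 3: "expect_le (pmf_of_set C) (\<lambda>c. 1 - of_bool (c \<in> top) / 16) (1 - 1 / (16 * d))"
  proof (rule expect_le_pmf_of_set[OF finC C_ne])
    have "C \<inter> top = top" by (auto simp: top_def)
    then have "(\<Sum>c\<in>C. 1 - of_bool (c \<in> top) / 16 :: real) = card C - card top / 16"
      using finC by (simp add: sum_subtractf sum_divide_distrib[symmetric] Int_def[symmetric])
    moreover have "real (card C) \<le> d * card top" using v unfolding top_def[symmetric]
      by (metis of_nat_le_iff of_nat_mult)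
    moreover have "(1 - 1 / real (16 * d)) * real (card C) = card C - card C / d / 16"
      by (simp add: algebra_simps)
    moreover have "card C / d \<le> card top" if "real (card C) \<le> d * card top"
      using that d_pos by (simp add: field_simps)
    ultimately show "(\<Sum>c\<in>C. 1 - of_bool (c \<in> top) / 16) \<le> (1 - 1 / real (16 * d)) * real (card C)"
      by simp
  qed auto
  show ?thesis
    unfolding trial_def
    by (rule expect_le_bind[OF 3], rule expect_le_bind[OF 2]) (simp_all only: set_R set_C expect_le_map 1)
qed

text \<open>The pivot never falls, so one success suffices, and \<open>d * d\<close> trials all fail
  with probability at most \<open>exp (- d / 16)\<close>.\<close>

lemma trials_good:
  assumes half: "(99 / 100) ^ d \<le> (1 / 2 :: real)" and p: "p \<in> R \<times> C"
  shows "expect_le (trials p) (\<lambda>p. of_bool (\<not> good_pivot (val p))) ((99 / 100) ^ d)"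
proof -
  obtain v where v: "good_pivot v" "card C \<le> d * card {j\<in>C. 8 * card {r\<in>R. B r j < v} < card R}"
    by (rule good_threshold)
  define \<gamma> :: real where "\<gamma> = 1 - 1 / (16 * d)"
  have \<gamma>: "0 \<le> \<gamma>" "\<gamma> \<le> 1" using d_pos by (auto simp: \<gamma>_def field_simps)
  have "expect_le (trials p) (\<lambda>p. of_bool (val p < v)) (of_bool (val p < v) * \<gamma> ^ (d * d))"
    unfolding trials_def
  proof (rule expect_le_loop[where Inv = "\<lambda>p. p \<in> R \<times> C" and \<Phi> = "\<lambda>k p. of_bool (val p < v) * \<gamma> ^ k"])
    fix k b assume b: "b \<in> R \<times> C"
    show "expect_le (trial b) (\<lambda>p. of_bool (val p < v) * \<gamma> ^ k) (of_bool (val b < v) * \<gamma> ^ Suc k)"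
    proof (cases "val b < v")
      case True
      have "expect_le (trial b) (\<lambda>p. \<gamma> ^ k * of_bool (val p < v)) (\<gamma> ^ k * \<gamma>)"
        using trial_good[OF v(2) half] \<gamma> by (intro expect_le_cmult) (auto simp: \<gamma>_def)
      then show ?thesis by (rule expect_le_mono) (use True in auto)
    next
      case False
      then show ?thesis
        using trial_support b by (intro expect_le_mono[OF expect_le_const[of _ 0]]) fastforce+
    qed
  qed (use p trial_support in auto)
  then show ?thesis
  proof (rule expect_le_mono)
    fix p show "of_bool (\<not> good_pivot (val p)) \<le> (of_bool (val p < v) :: real)"
      using good_pivot_mono[OF v(1), of "val p"] by (cases "val p < v") auto
  next
    have "\<gamma> \<le> exp (- 1 / (16 * d))" using exp_ge_add_one_self[of "- 1 / (16 * d)"] by (simp add: \<gamma>_def)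
    then have "\<gamma> ^ (d * d) \<le> exp (- 1 / (16 * d)) ^ (d * d)" using \<gamma> by (intro power_mono) auto
    also have "\<dots> = exp (- 1 / 16) ^ d"
      using d_pos by (simp add: exp_of_nat_mult[symmetric])
    also have "\<dots> \<le> (99 / 100) ^ d"
    proof (intro power_mono)
      have "1 / exp (1 / 16) \<le> 1 / (1 + 1 / 16 :: real)"
        using exp_ge_add_one_self[of "1 / 16"] by (intro divide_left_mono) auto
      then show "exp (- 1 / 16) \<le> (99 / 100 :: real)" by (simp add: exp_minus field_simps)
    qed auto
    finally show "of_bool (val p < v) * \<gamma> ^ (d * d) \<le> (99 / 100) ^ d" by auto
  qed
qed

section \<open>Probing a single column\<close>

lemma probe_loop_support:
  assumes "y \<in> set_pmf (probe_loop j v k (q, t))" "q \<in> R"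
  shows "fst y \<in> R \<and> snd y \<le> t + k"
  using assms
proof (induction k arbitrary: q t)
  case 0
  then show ?case by (simp add: probe_loop_def)
next
  case (Suc k)
  show ?case
  proof (cases "v < B q j")
    case True
    then obtain x where "x \<in> R" "y \<in> set_pmf (probe_loop j v k (if B x j < B q j then x else q, Suc t))"
      using Suc.prems by (auto simp: probe_loop_def set_R)
    then show ?thesis using Suc.IH[of "if B x j < B q j then x else q" "Suc t"] Suc.prems by auto
  qed (use Suc.prems in \<open>auto simp: probe_loop_def\<close>)
qed

text \<open>Either a probed entry of column \<open>j\<close> is at most the old pivot, or the new
  pivot itself lies in column \<open>j\<close>. Hence the column is certified in every run, not just
  probably.\<close>

lemma probe_support:
  assumes "y \<in> set_pmf (probe j p)" "p \<in> R \<times> C" "j \<in> C"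
  shows "fst y \<in> R \<times> C \<and> val p \<le> val (fst y) \<and> (\<exists>r\<in>R. B r j \<le> val (fst y)) \<and> snd y \<le> d"
proof -
  obtain q z where q: "q \<in> R" "z \<in> set_pmf (probe_loop j (val p) d (q, 0))"
    and y: "y = (if val p < B (fst z) j then (fst z, j) else p, snd z)"
    using assms(1) by (auto simp: probe_def set_R split_def)
  have "fst z \<in> R" "snd z \<le> d" using probe_loop_support[OF q(2,1)] by auto
  then show ?thesis using y assms by (auto intro!: bexI[of _ "fst z"])
qed

text \<open>The smaller entry is kept, so the kept row stays in the upper half \<open>H\<close> only
  if the fresh row is in \<open>H\<close> too, which has probability at most 1/2. A loop that stops
  early holds an entry at most \<open>v\<close>, and then the event is false.\<close>

lemma probe_loop_valid:
  assumes "q \<in> R" and j: "j \<in> C"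
  shows "expect_le (probe_loop j v k (q, t))
    (\<lambda>y. of_bool (v < B (fst y) j \<and> \<not> 2 * below (fst y) j < card R)) ((1 / 2) ^ k)"
proof -
  define H where "H = {x\<in>R. \<not> 2 * below x j < card R}"
  have up: "y \<in> H" if "x \<in> H" "y \<in> R" "B x j \<le> B y j" for x y
  proof -
    have "below x j \<le> below y j" unfolding below_def using that finR by (intro card_mono) auto
    then show ?thesis using that by (auto simp: H_def)
  qed
  have "expect_le (probe_loop j v k (q, t)) (\<lambda>y. of_bool (v < B (fst y) j \<and> fst y \<in> H))
      (of_bool (fst (q, t) \<in> H) * (1 / 2) ^ k)"
    unfolding probe_loop_def
  proof (rule expect_le_loop[where Inv = "\<lambda>y. fst y \<in> R" and \<Phi> = "\<lambda>k y. of_bool (fst y \<in> H) * (1 / 2) ^ k"])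
    fix k and b :: "nat \<times> nat" assume b: "fst b \<in> R"
    obtain q t where [simp]: "b = (q, t)" by (cases b)
    have "expect_le (pmf_of_set R) (\<lambda>x. of_bool ((if B x j < B q j then x else q) \<in> H) * (1 / 2) ^ k)
        (of_bool (q \<in> H) * (1 / 2) ^ Suc k)"
    proof (rule expect_le_pmf_of_set[OF finR R_ne])
      have "(\<Sum>x\<in>R. of_bool ((if B x j < B q j then x else q) \<in> H) * (1 / 2 :: real) ^ k)
         \<le> (\<Sum>x\<in>R. of_bool (x \<in> H \<and> q \<in> H) * (1 / 2) ^ k)"
        using up b by (intro sum_mono mult_right_mono) (auto simp: not_less)
      also have "\<dots> = of_bool (q \<in> H) * card H * (1 / 2) ^ k"
        using finR by (auto simp: sum_distrib_right[symmetric] H_def Int_def conj_commute)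
      also have "\<dots> \<le> of_bool (q \<in> H) * (card R / 2) * (1 / 2) ^ k"
        using card_low_half[OF j] unfolding H_def[symmetric] by (intro mult_right_mono mult_left_mono) auto
      finally show "(\<Sum>x\<in>R. of_bool ((if B x j < B q j then x else q) \<in> H) * (1 / 2 :: real) ^ k)
         \<le> of_bool (q \<in> H) * (1 / 2) ^ Suc k * real (card R)" by (cases "q \<in> H") (auto simp: mult.commute)
    qed auto
    then show "expect_le (case b of (q, t) \<Rightarrow> map_pmf (\<lambda>x. (if B x j < B q j then x else q, Suc t)) (pmf_of_set R))
        (\<lambda>y. of_bool (fst y \<in> H) * (1 / 2) ^ k) (of_bool (fst b \<in> H) * (1 / 2) ^ Suc k)"
      by (simp add: expect_le_map)
  qed (use assms in \<open>auto simp: set_R split_def\<close>)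
  then show ?thesis
  proof (rule expect_le_mono)
    fix y assume "y \<in> set_pmf (probe_loop j v k (q, t))"
    then have "fst y \<in> R" using probe_loop_support assms by blast
    then show "of_bool (v < B (fst y) j \<and> \<not> 2 * below (fst y) j < card R)
        \<le> (of_bool (v < B (fst y) j \<and> fst y \<in> H) :: real)"
      by (auto simp: H_def)
  qed auto
qed

lemma probe_valid:
  assumes "valid p" "j \<in> C"
  shows "expect_le (probe j p) (\<lambda>y. of_bool (\<not> valid (fst y))) ((1 / 2) ^ d)"
  unfolding probe_def
proof (rule expect_le_bind[OF expect_le_const])
  fix q assume "q \<in> set_pmf (pmf_of_set R)"
  then have "q \<in> R" by (simp add: set_R)
  from probe_loop_valid[OF this assms(2), of "val p" d 0]
  show "expect_le (map_pmf (\<lambda>(q, t). (if val p < B q j then (q, j) else p, t)) (probe_loop j (val p) d (q, 0)))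
     (\<lambda>y. of_bool (\<not> valid (fst y))) ((1 / 2) ^ d)"
    unfolding expect_le_map by (rule expect_le_mono) (use assms in \<open>auto simp: valid_def split: if_splits\<close>)
qed

lemma probe_cost:
  assumes "\<not> bad (val p) j"
  shows "expect_le (probe j p) (\<lambda>y. (15 / 14) ^ snd y) (15 / 7)"
  unfolding probe_def
proof (rule expect_le_bind[OF expect_le_const])
  define v where "v = val p"
  fix q
  have "expect_le (probe_loop j v d (q, 0)) (\<lambda>y. (15 / 14) ^ snd y)
      ((15 / 14) ^ snd (q, 0::nat) * (if v < B (fst (q, 0::nat)) j then 15 / 7 else 1))"
    unfolding probe_loop_def
  \<comment> \<open>The weight 15/7 of an unfinished search is a fixed point: with probability at
    least 1/8 a probe lowers it to 1, so its mean is at most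
    \<open>15 / 7 - (8 / 7) / 8 = 2\<close>, and counting the probe multiplies this by
    15/14.\<close>
  proof (rule expect_le_loop[where Inv = "\<lambda>_. True" and
        \<Phi> = "\<lambda>k y. (15 / 14) ^ snd y * (if v < B (fst y) j then 15 / 7 else 1)"])
    fix k and b :: "nat \<times> nat" assume g: "case b of (q, t) \<Rightarrow> v < B q j"
    obtain q t where [simp]: "b = (q, t)" by (cases b)
    have "expect_le (pmf_of_set R) (\<lambda>x. (15 / 14) ^ Suc t * (if v < B (if B x j < B q j then x else q) j then 15 / 7 else 1))
        ((15 / 14) ^ t * (15 / 7))"
    proof (rule expect_le_pmf_of_set[OF finR R_ne])
      have "(\<Sum>x\<in>R. if v < B (if B x j < B q j then x else q) j then 15 / 7 else 1 :: real)
          \<le> (\<Sum>x\<in>R. 15 / 7 - of_bool (B x j \<le> v) * (8 / 7))"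
        using g by (intro sum_mono) auto
      also have "\<dots> = card R * (15 / 7) - card {x\<in>R. B x j \<le> v} * (8 / 7)"
        using finR by (simp add: sum_subtractf sum_distrib_right[symmetric] sum_divide_distrib[symmetric] Int_def)
      also have "\<dots> \<le> 2 * card R"
        using assms by (simp add: bad_def v_def)
      finally have "(15 / 14) ^ Suc t * (\<Sum>x\<in>R. if v < B (if B x j < B q j then x else q) j then 15 / 7 else 1 :: real)
          \<le> (15 / 14) ^ Suc t * (2 * card R)"
        by (intro mult_left_mono) auto
      then show "(\<Sum>x\<in>R. (15 / 14) ^ Suc t * (if v < B (if B x j < B q j then x else q) j then 15 / 7 else 1))
          \<le> (15 / 14) ^ t * (15 / 7) * real (card R)"
        unfolding sum_distrib_left by (simp add: mult_ac)
    qed auto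
    then show "expect_le (case b of (q, t) \<Rightarrow> map_pmf (\<lambda>x. (if B x j < B q j then x else q, Suc t)) (pmf_of_set R))
        (\<lambda>y. (15 / 14) ^ snd y * (if v < B (fst y) j then 15 / 7 else 1))
        ((15 / 14) ^ snd b * (if v < B (fst b) j then 15 / 7 else 1))"
      using g by (simp add: expect_le_map)
  qed auto
  then show "expect_le (map_pmf (\<lambda>(q, t). (if val p < B q j then (q, j) else p, t)) (probe_loop j (val p) d (q, 0)))
     (\<lambda>y. (15 / 14) ^ snd y) (15 / 7)"
    unfolding expect_le_map v_def by (rule expect_le_mono) auto
qed

section \<open>The pass over all columns\<close>

text \<open>The pivot only rises during the pass, so a column certified earlier remains
  certified.\<close>

lemma pass_from_support:
  assumes "y \<in> set_pmf (pass_from cs k (p, T))" "p \<in> R \<times> C" "set cs \<subseteq> C" "k \<le> length cs"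
  shows "fst y \<in> R \<times> C \<and> val p \<le> val (fst y) \<and> (\<forall>i<k. \<exists>r\<in>R. B r (cs ! i) \<le> val (fst y))"
  using assms
proof (induction k arbitrary: p T)
  case 0
  then show ?case by (simp add: pass_from_def)
next
  case (Suc k)
  then obtain p' t where pt: "(p', t) \<in> set_pmf (probe (cs ! k) p)"
      "y \<in> set_pmf (pass_from cs k (p', T + t))"
    by (auto simp: pass_from_def)
  have "cs ! k \<in> C" using Suc.prems by auto
  from probe_support[OF pt(1) Suc.prems(2) this]
  obtain r where r: "p' \<in> R \<times> C" "val p \<le> val p'" "r \<in> R" "B r (cs ! k) \<le> val p'" by auto
  have "fst y \<in> R \<times> C" "val p' \<le> val (fst y)" "\<forall>i<k. \<exists>r\<in>R. B r (cs ! i) \<le> val (fst y)"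
    using Suc.IH[OF pt(2) r(1)] Suc.prems by auto
  then show ?case using r by (auto simp: less_Suc_eq intro!: bexI[of _ r])
qed

lemma pass_support:
  assumes "y \<in> set_pmf (pass cs p)" "p \<in> R \<times> C" "set cs = C"
  shows "fst y \<in> R \<times> C" "\<forall>j\<in>C. \<exists>r\<in>R. B r j \<le> val (fst y)"
  using pass_from_support[of y cs "length cs" p 0] assms
  by (auto simp: pass_def in_set_conv_nth)

lemma pass_valid:
  assumes "valid p" "set cs = C"
  shows "expect_le (pass cs p) (\<lambda>y. of_bool (\<not> valid (fst y))) (real (length cs) * (1 / 2) ^ d)"
proof -
  have "expect_le (pass_from cs k (p, T)) (\<lambda>y. of_bool (\<not> valid (fst y)))
      (of_bool (\<not> valid p) + real k * (1 / 2) ^ d)" if "k \<le> length cs" for k T p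
    using that
  proof (induction k arbitrary: p T)
    case 0
    then show ?case by (simp add: pass_from_def expect_le_return)
  next
    case (Suc k)
    have "expect_le (probe (cs ! k) p \<bind> (\<lambda>(p', t). pass_from cs k (p', T + t))) (\<lambda>y. of_bool (\<not> valid (fst y)))
      (of_bool (\<not> valid p) + real (Suc k) * (1 / 2) ^ d)"
    proof (rule expect_le_bind)
      show "expect_le (case y of (p', t) \<Rightarrow> pass_from cs k (p', T + t)) (\<lambda>y. of_bool (\<not> valid (fst y)))
         (of_bool (\<not> valid (fst y)) + real k * (1 / 2) ^ d)" for y
        using Suc by (cases y) auto
      show "expect_le (probe (cs ! k) p) (\<lambda>y. of_bool (\<not> valid (fst y)) + real k * (1 / 2) ^ d)
         (of_bool (\<not> valid p) + real (Suc k) * (1 / 2) ^ d)"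
      proof (cases "valid p")
        case True
        have "cs ! k \<in> C" using Suc.prems assms(2) by auto
        from probe_valid[OF True this]
        have "expect_le (probe (cs ! k) p) (\<lambda>y. of_bool (\<not> valid (fst y)) + real k * (1 / 2) ^ d)
          ((1 / 2) ^ d + real k * (1 / 2) ^ d)"
          by (intro expect_le_add expect_le_const) auto
        then show ?thesis by (rule expect_le_mono) (use True in \<open>auto simp: algebra_simps\<close>)
      next
        case False
        then show ?thesis
          by (intro expect_le_mono[OF expect_le_const[of _ "1 + real k * (1 / 2) ^ d"]]) (auto simp: algebra_simps)
      qed
    qed
    then show ?case by (simp add: pass_from_def bind_map_pmf split_def)
  qed
  from this[of "length cs" p 0] assms show ?thesis by (simp add: pass_def)
qed

text \<open>A bad column is charged all \<open>d\<close> probes outright, any other column the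
  factor 15/7. The count may refer to the initial pivot, because a rising pivot creates no bad
  columns.\<close>

lemma pass_from_cost:
  assumes "k \<le> length cs" "set cs = C" "p \<in> R \<times> C"
  shows "expect_le (pass_from cs k (p, T)) (\<lambda>y. (15 / 14) ^ snd y)
      ((15 / 14) ^ (T + d * card {i. i < k \<and> bad (val p) (cs ! i)}) * (15 / 7) ^ k)"
  using assms
proof (induction k arbitrary: p T)
  case 0
  then show ?case by (simp add: pass_from_def expect_le_return)
next
  case (Suc k)
  define b where "b k p = card {i. i < k \<and> bad (val p) (cs ! i)}" for k p
  have k: "cs ! k \<in> C" using Suc.prems by auto
  have "expect_le (probe (cs ! k) p \<bind> (\<lambda>(p', t). pass_from cs k (p', T + t))) (\<lambda>y. (15 / 14) ^ snd y)
      ((15 / 14) ^ (T + d * b (Suc k) p) * (15 / 7) ^ Suc k)"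
  proof (rule expect_le_bind)
    show "expect_le (case y of (p', t) \<Rightarrow> pass_from cs k (p', T + t)) (\<lambda>y. (15 / 14) ^ snd y)
       ((15 / 14) ^ (T + snd y + d * b k p) * (15 / 7) ^ k)"
      if y: "y \<in> set_pmf (probe (cs ! k) p)" for y
    proof -
      obtain p' t where [simp]: "y = (p', t)" by (cases y)
      have p': "p' \<in> R \<times> C" "val p \<le> val p'" using probe_support[OF y Suc.prems(3) k] by auto
      have "b k p' \<le> b k p" unfolding b_def
        using bad_antimono p'(2) by (intro card_mono) auto
      then have "(15 / 14 :: real) ^ (T + t + d * b k p') * (15 / 7) ^ k \<le> (15 / 14) ^ (T + t + d * b k p) * (15 / 7) ^ k"
        by (intro mult_right_mono power_increasing add_left_mono mult_left_mono) auto
      then show ?thesis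
        using expect_le_mono[OF Suc.IH[of p' "T + t"]] Suc.prems p' by (simp add: b_def)
    qed
    show "expect_le (probe (cs ! k) p) (\<lambda>y. (15 / 14) ^ (T + snd y + d * b k p) * (15 / 7) ^ k)
       ((15 / 14) ^ (T + d * b (Suc k) p) * (15 / 7) ^ Suc k)"
    proof (cases "bad (val p) (cs ! k)")
      case True
      then have "{i. i < Suc k \<and> bad (val p) (cs ! i)} = insert k {i. i < k \<and> bad (val p) (cs ! i)}"
        by (auto simp: less_Suc_eq)
      then have bS: "b (Suc k) p = Suc (b k p)" by (simp add: b_def)
      show ?thesis
      proof (rule expect_le_mono[OF expect_le_const])
        fix y assume "y \<in> set_pmf (probe (cs ! k) p)"
        then have "snd y \<le> d" using probe_support[OF _ Suc.prems(3) k] by blast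
        then show "(15 / 14) ^ (T + snd y + d * b k p) * (15 / 7) ^ k
            \<le> (15 / 14 :: real) ^ (T + d * b (Suc k) p) * (15 / 7) ^ k"
          unfolding bS by (intro mult_right_mono power_increasing) auto
      qed (intro mult_left_mono power_increasing, auto)
    next
      case False
      then have "{i. i < Suc k \<and> bad (val p) (cs ! i)} = {i. i < k \<and> bad (val p) (cs ! i)}"
        by (auto simp: less_Suc_eq)
      then have bS: "b (Suc k) p = b k p" by (simp add: b_def)
      have "expect_le (probe (cs ! k) p) (\<lambda>y. ((15 / 14) ^ (T + d * b k p) * (15 / 7) ^ k) * (15 / 14) ^ snd y)
         (((15 / 14) ^ (T + d * b k p) * (15 / 7) ^ k) * (15 / 7))"
        using probe_cost[OF False] by (intro expect_le_cmult) auto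
      then show ?thesis by (rule expect_le_mono) (auto simp: bS power_add)
    qed
  qed
  then show ?case by (simp add: pass_from_def bind_map_pmf split_def b_def)
qed

lemma pass_time:
  assumes "good_pivot (val p)" "set cs = C" "distinct cs" "p \<in> R \<times> C"
  shows "expect_le (pass cs p) (\<lambda>y. of_bool (13 * length cs + d < snd y)) ((99 / 100) ^ d)"
proof -
  let ?k = "length cs"
  have k: "?k = card C" using assms distinct_card by metis
  have "card {i. i < ?k \<and> bad (val p) (cs ! i)} = card {j\<in>C. bad (val p) j}"
  proof (rule bij_betw_same_card[where f = "\<lambda>i. cs ! i"])
    show "bij_betw ((!) cs) {i. i < ?k \<and> bad (val p) (cs ! i)} {j\<in>C. bad (val p) j}"
      using assms by (auto simp: bij_betw_def inj_on_def nth_eq_iff_index_eq in_set_conv_nth image_iff)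
  qed
  then have le: "d * card {i. i < ?k \<and> bad (val p) (cs ! i)} \<le> ?k"
    using assms(1) k by (simp add: good_pivot_def)
  have "expect_le (pass_from cs ?k (p, 0)) (\<lambda>y. (15 / 14) ^ snd y) ((15 / 14) ^ ?k * (15 / 7) ^ ?k)"
    by (rule expect_le_mono[OF pass_from_cost]) (use assms le in \<open>auto intro!: power_increasing\<close>)
  \<comment> \<open>Markov's inequality. Per column the moment is at most 15/14 for the share of the
    bad columns times 15/7; 13 is the least integer whose power of 14/15 outweighs this product, and
    the extra \<open>d\<close> provides the exponentially small factor.\<close>
  then have "expect_le (pass cs p) (\<lambda>y. (14 / 15) ^ (13 * ?k + d) * (15 / 14) ^ snd y)
      ((14 / 15) ^ (13 * ?k + d) * ((15 / 14) ^ ?k * (15 / 7) ^ ?k))"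
    unfolding pass_def by (rule expect_le_cmult) auto
  then show ?thesis
  proof (rule expect_le_mono)
    fix y :: "(nat \<times> nat) \<times> nat"
    show "of_bool (13 * ?k + d < snd y) \<le> (14 / 15 :: real) ^ (13 * ?k + d) * (15 / 14) ^ snd y"
    proof (cases "13 * ?k + d < snd y")
      case True
      then have "(15 / 14 :: real) ^ (13 * ?k + d) \<le> (15 / 14) ^ snd y" by (intro power_increasing) auto
      then have "(14 / 15 :: real) ^ (13 * ?k + d) * (15 / 14) ^ (13 * ?k + d)
         \<le> (14 / 15) ^ (13 * ?k + d) * (15 / 14) ^ snd y" by (intro mult_left_mono) auto
      then show ?thesis using True by (simp flip: power_mult_distrib)
    qed auto
  next
    have "(14 / 15 :: real) ^ (13 * ?k + d) * ((15 / 14) ^ ?k * (15 / 7) ^ ?k)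
        = ((14 / 15) ^ 13 * (15 / 14) * (15 / 7)) ^ ?k * (14 / 15) ^ d"
      by (simp only: power_add power_mult power_mult_distrib) (simp only: mult_ac)
    also have "\<dots> \<le> 1 ^ ?k * (99 / 100) ^ d"
      by (intro mult_mono power_mono) (auto simp: power_divide)
    finally show "(14 / 15 :: real) ^ (13 * ?k + d) * ((15 / 14) ^ ?k * (15 / 7) ^ ?k) \<le> (99 / 100) ^ d"
      by simp
  qed
qed

text \<open>The summands of the error: \<open>d * d\<close> for a trial that accepts an invalid
  entry, 1 for missing the threshold, \<open>card C\<close> for an invalid replacement during the
  pass, and 1 for too many probes.\<close>

lemma pivot_search:
  assumes p: "valid p" "p \<in> R \<times> C" and cs: "set cs = C" "distinct cs"
    and half: "(99 / 100) ^ d \<le> (1 / 2 :: real)"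
  shows "expect_le (trials p \<bind> pass cs)
     (\<lambda>y. of_bool (\<not> (valid (fst y) \<and> snd y \<le> 13 * card C + d)))
     ((real (d * d) + 2 + card C) * (99 / 100) ^ d)"
proof (rule expect_le_bind)
  let ?e = "real (card C) * (1 / 2) ^ d + (99 / 100) ^ d"
  have len: "length cs = card C" using cs distinct_card by metis
  show "expect_le (pass cs p') (\<lambda>y. of_bool (\<not> (valid (fst y) \<and> snd y \<le> 13 * card C + d)))
      (of_bool (\<not> valid p') + of_bool (\<not> good_pivot (val p')) + ?e)"
    if "p' \<in> set_pmf (trials p)" for p'
  proof (cases "valid p' \<and> good_pivot (val p')")
    case True
    have "p' \<in> R \<times> C" using trials_support that p by blast
    then have "expect_le (pass cs p') (\<lambda>y. of_bool (\<not> valid (fst y)) + of_bool (13 * length cs + d < snd y)) ?e"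
      using pass_valid[of p' cs] pass_time[of p' cs] True cs len by (intro expect_le_add) auto
    then show ?thesis by (rule expect_le_mono) (use len True in auto)
  next
    case False
    then show ?thesis by (intro expect_le_mono[OF expect_le_const[of _ "1"]]) auto
  qed
  have "expect_le (trials p) (\<lambda>p'. (of_bool (\<not> valid p') + of_bool (\<not> good_pivot (val p'))) + ?e)
     ((real (d * d) * (99 / 100) ^ d + (99 / 100) ^ d) + ?e)"
    by (intro expect_le_add expect_le_const trials_valid trials_good assms) auto
  then show "expect_le (trials p) (\<lambda>p'. of_bool (\<not> valid p') + of_bool (\<not> good_pivot (val p')) + ?e)
     ((real (d * d) + 2 + card C) * (99 / 100) ^ d)"
  proof (rule expect_le_mono)
    have "real (card C) * (1 / 2) ^ d \<le> real (card C) * (99 / 100) ^ d"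
      by (intro mult_left_mono power_mono) auto
    then show "(real (d * d) * (99 / 100) ^ d + (99 / 100) ^ d) + ?e \<le> (real (d * d) + 2 + card C) * (99 / 100) ^ d"
      by (simp add: algebra_simps)
  qed auto
qed

end

section \<open>The reduction step as a program\<close>

lemma regs_set_reg [simp]: "regs (set_reg r v s) = (regs s)(r := v)"
  by (simp add: set_reg_def)

lemma mem_set_reg [simp]: "mem (set_reg r v s) = mem s"
  by (simp add: set_reg_def)

lemma regs_set_mem [simp]: "regs (set_mem a v s) = regs s"
  by (simp add: set_mem_def)

lemma mem_set_mem [simp]: "mem (set_mem a v s) = (mem s)(a := v)"
  by (simp add: set_mem_def)

lemma set_reg_set_reg [simp]: "set_reg r v (set_reg r u s) = set_reg r v s"
  by (simp add: set_reg_def)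

text \<open>Deterministic loops are treated as random loops over the unit type, so that
  \<open>refines_While\<close> covers both kinds.\<close>

lemma loop_pmf_return: "loop_pmf (\<lambda>_. True) (\<lambda>_ _. return_pmf ()) k () = return_pmf ()"
  by (induction k) (auto simp: bind_return_pmf)

notation Seq (infixr ";;" 60)

text \<open>
  Register 0 holds n, registers 3 and 4 the numbers of remaining rows and columns, register 5 the
  sample size d, register 6 the round counter, registers 7 and 8 the position of the pivot. The
  remaining rows are at addresses 1, 2, ..., the remaining columns at n + 1, n + 2, .... With
  the flag \<open>f\<close> a piece of code works on the transposed matrix with reversed order.
\<close>

definition cmp :: "bool \<Rightarrow> nat \<Rightarrow> nat \<Rightarrow> nat \<Rightarrow> nat \<Rightarrow> nat \<Rightarrow> com" where
  "cmp f t a b c e = (if f then Compare t (Reg e) (Reg c) (Reg b) (Reg a)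
     else Compare t (Reg a) (Reg b) (Reg c) (Reg e))"

definition base :: "bool \<Rightarrow> expr" where
  "base f = (if f then Reg 0 else Num 0)"

definition size_reg :: "bool \<Rightarrow> nat" where
  "size_reg f = (if f then 4 else 3)"

definition decr :: "nat \<Rightarrow> com" where
  "decr r = Assign r (Sub (Reg r) (Num 1))"

definition pick :: "bool \<Rightarrow> nat \<Rightarrow> com" where
  "pick f v = Draw v (Reg (size_reg f)) ;; Assign v (Load (Add (base f) (Reg v)))"

text \<open>Supplies the initial pivot: a column minimum has rank 0 and is therefore valid, and the
  trials can start from it.\<close>

definition column_min_code :: "bool \<Rightarrow> com" where
  "column_min_code f =
     (Assign 8 (Load (Add (base (\<not> f)) (Num 1))) ;;
      Assign 7 (Load (Add (base f) (Num 1))) ;;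
      Assign 9 (Reg (size_reg f))) ;;
     While (Reg 9)
       (Assign 11 (Load (Add (base f) (Reg 9))) ;;
        cmp f 14 11 8 7 8 ;;
        Cond (Reg 14) (Assign 7 (Reg 11)) Skip ;;
        decr 9)"

definition count_code :: "bool \<Rightarrow> com" where
  "count_code f = While (Reg 10)
     (pick f 15 ;;
      (cmp f 14 15 12 11 12 ;; Assign 13 (Add (Reg 13) (Reg 14)) ;; decr 10))"

definition trial_code :: "bool \<Rightarrow> com" where
  "trial_code f =
     pick (\<not> f) 12 ;;
     pick f 11 ;;
     (Assign 13 (Num 0) ;; Assign 10 (Reg 5)) ;;
     count_code f ;;
     (cmp f 14 7 8 11 12 ;;
      Cond (Reg 14)
        (Cond (Less (Reg 5) (Mul (Num 3) (Reg 13))) Skip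
          (Assign 7 (Reg 11) ;; Assign 8 (Reg 12)))
        Skip ;;
      decr 9)"

definition trials_code :: "bool \<Rightarrow> com" where
  "trials_code f = Assign 9 (Mul (Reg 5) (Reg 5)) ;; While (Reg 9) (trial_code f)"

text \<open>The product in the guard is a conjunction: probes are left, and the kept entry still
  exceeds the pivot.\<close>

definition probe_loop_code :: "bool \<Rightarrow> com" where
  "probe_loop_code f = While (Mul (Reg 10) (Reg 14))
     (pick f 15 ;;
      (cmp f 13 15 12 11 12 ;;
       Cond (Reg 13) (Assign 11 (Reg 15)) Skip ;;
       cmp f 14 7 8 11 12 ;;
       decr 10))"

definition probe_code :: "bool \<Rightarrow> com" where
  "probe_code f =
     Assign 12 (Load (Add (base (\<not> f)) (Reg 9))) ;;
     pick f 11 ;;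
     (Assign 10 (Reg 5) ;; cmp f 14 7 8 11 12) ;;
     probe_loop_code f ;;
     (Cond (Reg 14) (Assign 7 (Reg 11) ;; Assign 8 (Reg 12)) Skip ;; decr 9)"

definition pass_code :: "bool \<Rightarrow> com" where
  "pass_code f = Assign 9 (Reg (size_reg (\<not> f))) ;; While (Reg 9) (probe_code f)"

definition delete_code :: "bool \<Rightarrow> com" where
  "delete_code f = Assign 9 (Reg (size_reg f)) ;;
     While (Reg 9)
       (Assign 11 (Load (Add (base f) (Reg 9))) ;;
        cmp f 14 7 8 11 8 ;;
        Cond (Reg 14)
          (Store (Add (base f) (Reg 9)) (Load (Add (base f) (Reg (size_reg f)))) ;;
           decr (size_reg f))
          Skip ;;
        decr 9)"

definition reduce_code :: "bool \<Rightarrow> com" where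
  "reduce_code f = column_min_code f ;; trials_code f ;; pass_code f ;; delete_code f"

lemma loopfree_cmp [simp]: "loopfree (cmp f t a b c e)"
  and weight_cmp [simp]: "weight (cmp f t a b c e) = 1"
  and loopfree_decr [simp]: "loopfree (decr r)"
  and weight_decr [simp]: "weight (decr r) = 1"
  by (auto simp: cmp_def decr_def)

section \<open>Orientation of the matrix and layout of the arrays\<close>

text \<open>Transposition swaps the row and column conditions of a saddlepoint, and the minus sign
  restores their order. So one analysis covers the deletion of rows and of columns.\<close>

definition flipped :: "bool \<Rightarrow> (nat \<Rightarrow> nat \<Rightarrow> int) \<Rightarrow> nat \<Rightarrow> nat \<Rightarrow> int" where
  "flipped f A i j = (if f then - A j i else A i j)"

lemma exec_cmp:
  assumes "regs s a < n" "regs s b < n" "regs s c < n" "regs s e < n"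
  shows "exec N n A (cmp f t a b c e) s =
    set_reg t (of_bool (flipped f A (regs s a) (regs s b) < flipped f A (regs s c) (regs s e))) s"
  using assms by (simp add: cmp_def flipped_def compare_entries_def)

definition offset :: "nat \<Rightarrow> bool \<Rightarrow> nat" where
  "offset n f = (if f then n else 0)"

definition holds_array :: "nat \<Rightarrow> bool \<Rightarrow> nat list \<Rightarrow> state \<Rightarrow> bool" where
  "holds_array n f xs s \<longleftrightarrow> regs s (size_reg f) = length xs \<and>
     (\<forall>i<length xs. mem s (offset n f + Suc i) = xs ! i)"

definition proper :: "nat \<Rightarrow> nat list \<Rightarrow> bool" where
  "proper n xs \<longleftrightarrow> xs \<noteq> [] \<and> distinct xs \<and> set xs \<subseteq> {..<n}"

lemma proper_length: "proper n xs \<Longrightarrow> 1 \<le> length xs \<and> length xs \<le> n"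
proof -
  assume "proper n xs"
  then have "card (set xs) \<le> card {..<n}" "distinct xs" "xs \<noteq> []"
    using card_mono[of "{..<n}" "set xs"] by (auto simp: proper_def)
  then show ?thesis by (simp add: distinct_card Suc_le_eq)
qed

text \<open>\<open>xs\<close> is the array being reduced and \<open>cs\<close> the other one;
  \<open>f\<close> tells which of them holds rows of \<open>A\<close>. \<open>z\<close> pins down
  register 6, the round counter, which a reduction must preserve.\<close>

locale reduction =
  fixes n N :: nat and A :: "nat \<Rightarrow> nat \<Rightarrow> int" and d :: nat and f :: bool
    and xs cs :: "nat list" and z :: nat
  assumes N: "N = (n + 2) ^ 4" and dist: "distinct_entries n A"
    and d: "1 \<le> d" "d * d \<le> n"
    and xs: "proper n xs" and cs: "proper n cs"
begin

abbreviation B :: "nat \<Rightarrow> nat \<Rightarrow> int" where "B \<equiv> flipped f A"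

lemma N_gt: "3 * n < N" "3 < N"
proof -
  have "(n + 2) * 8 \<le> (n + 2) * (n + 2) ^ 3"
    using power_mono[of 2 "n + 2" 3] by (intro mult_left_mono) auto
  then have "8 * n + 16 \<le> N" unfolding N by (simp add: power_numeral_reduce)
  then show "3 * n < N" "3 < N" by auto
qed

sublocale submatrix "set xs" "set cs" B d
proof
  fix j assume "j \<in> set cs"
  then show "inj_on (\<lambda>r. B r j) (set xs)"
    using dist xs cs
    by (fastforce simp: distinct_entries_def proper_def flipped_def inj_on_def subset_iff)
qed (use xs cs d in \<open>auto simp: proper_def\<close>)

lemma xs_less: "x \<in> set xs \<Longrightarrow> x < n" and cs_less: "x \<in> set cs \<Longrightarrow> x < n"
  using xs cs by (auto simp: proper_def)

definition env :: "state \<Rightarrow> bool" where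
  "env s \<longleftrightarrow> regs s 0 = n \<and> regs s 5 = d \<and> regs s 6 = z \<and>
     holds_array n f xs s \<and> holds_array n (\<not> f) cs s"

lemma env_set_reg [simp]: "7 \<le> r \<Longrightarrow> env (set_reg r v s) \<longleftrightarrow> env s"
  by (auto simp: env_def holds_array_def size_reg_def)

lemma env_regs:
  assumes "env s"
  shows "regs s 0 = n" "regs s 5 = d" "regs s (size_reg f) = length xs"
    "regs s (size_reg (\<not> f)) = length cs"
  using assms by (auto simp: env_def holds_array_def)

lemma eval_base:
  assumes "regs s 0 = n" "eval N s e \<le> n"
  shows "eval N s (Add (base g) e) = offset n g + eval N s e"
  using assms N_gt by (auto simp: base_def offset_def)

lemma load_row:
  assumes "env s" "eval N s e = Suc i" "i < length xs"
  shows "eval N s (Load (Add (base f) e)) = xs ! i"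
proof -
  have "eval N s e \<le> n" using assms proper_length[OF xs] by simp
  then have "eval N s (Add (base f) e) = offset n f + Suc i"
    using eval_base[of s e f] assms by (simp add: env_regs)
  then show ?thesis using assms by (simp add: env_def holds_array_def)
qed

lemma load_col:
  assumes "env s" "eval N s e = Suc i" "i < length cs"
  shows "eval N s (Load (Add (base (\<not> f)) e)) = cs ! i"
proof -
  have "eval N s e \<le> n" using assms proper_length[OF cs] by simp
  then have "eval N s (Add (base (\<not> f)) e) = offset n (\<not> f) + Suc i"
    using eval_base[of s e "\<not> f"] assms by (simp add: env_regs)
  then show ?thesis using assms by (simp add: env_def holds_array_def)
qed

text \<open>A distinct list is a bijection from its indices to its elements, so a uniform index
  yields a uniform element.\<close>

lemma pick_refines:
  assumes "proper n ys" "env s" "7 \<le> v" "regs s (size_reg g) = length ys"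
    "\<And>s i e. env s \<Longrightarrow> eval N s e = Suc i \<Longrightarrow> i < length ys \<Longrightarrow>
       eval N s (Load (Add (base g) e)) = ys ! i"
    "\<And>y t. y \<in> set ys \<Longrightarrow> t \<le> 3 \<Longrightarrow> Q y t (set_reg v y s)"
  shows "refines N n A (pick g v) s (pmf_of_set (set ys)) Q"
proof -
  define m where "m = length ys"
  have ys: "ys \<noteq> []" "distinct ys" using assms(1) by (auto simp: proper_def)
  have "refines N n A (pick g v) s (bind_pmf (pmf_of_set {1..m}) (\<lambda>i. return_pmf (ys ! (i - 1)))) Q"
    unfolding pick_def
  proof (rule refines_Seq)
    have "refines N n A (Draw v (Reg (size_reg g))) s (pmf_of_set {1..eval N s (Reg (size_reg g))})
       (\<lambda>i t s'. t = 1 \<and> 1 \<le> i \<and> i \<le> m \<and> s' = set_reg v i s)"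
      by (rule refines_Draw) (use assms proper_length[OF assms(1)] in \<open>auto simp: m_def\<close>)
    then show "refines N n A (Draw v (Reg (size_reg g))) s (pmf_of_set {1..m})
       (\<lambda>i t s'. t = 1 \<and> 1 \<le> i \<and> i \<le> m \<and> s' = set_reg v i s)"
      using assms(4) by (simp add: m_def)
  next
    fix i t :: nat and s' assume *: "t = 1 \<and> 1 \<le> i \<and> i \<le> m \<and> s' = set_reg v i s"
    have "eval N s' (Load (Add (base g) (Reg v))) = ys ! (i - 1)"
      by (rule assms(5)) (use * assms(2,3) in \<open>auto simp: m_def\<close>)
    moreover have "ys ! (i - 1) \<in> set ys" using * by (auto simp: m_def)
    ultimately show "refines N n A (Assign v (Load (Add (base g) (Reg v)))) s' (return_pmf (ys ! (i - 1)))
       (\<lambda>b' t'. Q b' (t + 1 + t'))"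
      using * assms(6) by (intro refines_loopfree) auto
  qed
  moreover have "bij_betw (\<lambda>i. ys ! (i - 1)) {1..m} (set ys)"
  proof (rule bij_betw_imageI)
    show "inj_on (\<lambda>i. ys ! (i - 1)) {1..m}"
      using ys by (auto simp: inj_on_def m_def nth_eq_iff_index_eq)
    show "(\<lambda>i. ys ! (i - 1)) ` {1..m} = set ys"
    proof (intro set_eqI iffI)
      fix y assume "y \<in> set ys"
      then obtain i where "i < m" "y = ys ! i" by (auto simp: in_set_conv_nth m_def)
      then show "y \<in> (\<lambda>i. ys ! (i - 1)) ` {1..m}" by (intro image_eqI[of _ _ "Suc i"]) auto
    qed (auto simp: m_def)
  qed
  then have "map_pmf (\<lambda>i. ys ! (i - 1)) (pmf_of_set {1..m}) = pmf_of_set (set ys)"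
    using ys by (intro map_pmf_of_set_bij_betw) (auto simp: m_def Suc_le_eq)
  ultimately show ?thesis by (simp add: map_pmf_def)
qed

lemma pick_row:
  assumes "env s" "7 \<le> v" "\<And>y t. y \<in> set xs \<Longrightarrow> t \<le> 3 \<Longrightarrow> Q y t (set_reg v y s)"
  shows "refines N n A (pick f v) s (pmf_of_set (set xs)) Q"
  by (rule pick_refines) (use assms xs load_row env_regs in auto)

lemma pick_col:
  assumes "env s" "7 \<le> v" "\<And>y t. y \<in> set cs \<Longrightarrow> t \<le> 3 \<Longrightarrow> Q y t (set_reg v y s)"
  shows "refines N n A (pick (\<not> f) v) s (pmf_of_set (set cs)) Q"
  by (rule pick_refines) (use assms cs load_col env_regs in auto)

lemma exec_decr [simp]: "exec N n A (decr r) s = set_reg r (regs s r - 1) s"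
  using N_gt by (simp add: decr_def)

section \<open>Refinement proofs for the pieces of a reduction\<close>

lemma count_refines:
  assumes s: "env s" "regs s 10 = d" "regs s 13 = 0" "regs s 11 < n" "regs s 12 < n"
  shows "refines N n A (count_code f) s (count (regs s 11) (regs s 12))
    (\<lambda>a t s'. t \<le> 11 * d + 1 \<and> env s' \<and> regs s' 13 = a \<and> a \<le> d \<and>
       (\<forall>r\<in>{7, 8, 9, 11, 12}. regs s' r = regs s r))"
  unfolding count_code_def count_def
\<comment> \<open>The 11 steps per iteration: at most 3 for \<open>pick\<close>, 1 for the
  sequencing, 5 for the loop-free rest, and 2 for the loop itself.\<close>
proof (rule refines_While[where I = "\<lambda>k a t s'. t + 11 * k \<le> 11 * d \<and> env s' \<and> regs s' 10 = k \<and>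
      regs s' 13 = a \<and> a + k \<le> d \<and> (\<forall>r\<in>{7, 8, 9, 11, 12}. regs s' r = regs s r)" and t = 0])
  fix k a t s'
  assume I: "t + 11 * Suc k \<le> 11 * d \<and> env s' \<and> regs s' 10 = Suc k \<and>
      regs s' 13 = a \<and> a + Suc k \<le> d \<and> (\<forall>r\<in>{7, 8, 9, 11, 12}. regs s' r = regs s r)"
  have "d \<le> n" using d(2) by (cases d) auto
  show "refines N n A (pick f 15 ;; (cmp f 14 15 12 11 12 ;; Assign 13 (Add (Reg 13) (Reg 14)) ;; decr 10)) s'
     (map_pmf (\<lambda>x. if B x (regs s 12) < B (regs s 11) (regs s 12) then Suc a else a) (pmf_of_set (set xs)))
     (\<lambda>b' t' s''. t + t' + 2 + 11 * k \<le> 11 * d \<and> env s'' \<and> regs s'' 10 = k \<and> regs s'' 13 = b' \<and>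
         b' + k \<le> d \<and> (\<forall>r\<in>{7, 8, 9, 11, 12}. regs s'' r = regs s r))"
    unfolding map_pmf_def
  proof (rule refines_Seq[OF pick_row[where Q = "\<lambda>y t s''. y \<in> set xs \<and> t \<le> 3 \<and> s'' = set_reg 15 y s'"]])
    fix y t' :: nat and s'' assume y: "y \<in> set xs \<and> t' \<le> 3 \<and> s'' = set_reg 15 y s'"
    then show "refines N n A (cmp f 14 15 12 11 12 ;; Assign 13 (Add (Reg 13) (Reg 14)) ;; decr 10) s''
       (return_pmf (if B y (regs s 12) < B (regs s 11) (regs s 12) then Suc a else a))
       (\<lambda>b' t'' s''. t + (t' + 1 + t'') + 2 + 11 * k \<le> 11 * d \<and> env s'' \<and> regs s'' 10 = k \<and>
           regs s'' 13 = b' \<and> b' + k \<le> d \<and> (\<forall>r\<in>{7, 8, 9, 11, 12}. regs s'' r = regs s r))"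
      using I s xs_less[of y] N_gt \<open>d \<le> n\<close>
      by (intro refines_loopfree) (auto simp: exec_cmp)
  qed (use I in auto)
qed (use s in auto)

end

lemma refines_Seq_loopfree:
  assumes "loopfree c" "\<And>t. t \<le> weight c \<Longrightarrow> refines N n A d (exec N n A c s) D (\<lambda>b t'. Q b (t + 1 + t'))"
  shows "refines N n A (Seq c d) s D Q"
proof -
  have "refines N n A (Seq c d) s (bind_pmf (return_pmf ()) (\<lambda>_. D)) Q"
    by (rule refines_Seq[OF loopfree_refines[OF assms(1)]]) (use assms(2) in auto)
  then show ?thesis by (simp add: bind_return_pmf)
qed

context reduction
begin

lemma d_le: "d \<le> n"
  using d(2) by (cases d) auto

lemma trial_refines:
  assumes s: "env s" "(regs s 7, regs s 8) = p" "p \<in> set xs \<times> set cs"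
  shows "refines N n A (trial_code f) s (trial p)
    (\<lambda>p' t s'. t \<le> 11 * d + 25 \<and> env s' \<and> (regs s' 7, regs s' 8) = p' \<and> regs s' 9 = regs s 9 - 1)"
  unfolding trial_code_def trial_def
proof (rule refines_Seq[OF pick_col[where Q = "\<lambda>y t s'. y \<in> set cs \<and> t \<le> 3 \<and> s' = set_reg 12 y s"]])
  fix c t1 :: nat and s1 assume 1: "c \<in> set cs \<and> t1 \<le> 3 \<and> s1 = set_reg 12 c s"
  show "refines N n A (pick f 11 ;; (Assign 13 (Num 0) ;; Assign 10 (Reg 5)) ;; count_code f ;;
      (cmp f 14 7 8 11 12 ;; Cond (Reg 14) (Cond (Less (Reg 5) (Mul (Num 3) (Reg 13))) Skip
          (Assign 7 (Reg 11) ;; Assign 8 (Reg 12))) Skip ;; decr 9)) s1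
     (pmf_of_set (set xs) \<bind> (\<lambda>r. map_pmf (\<lambda>a. if val p < B r c \<and> 3 * a \<le> d then (r, c) else p) (count r c)))
     (\<lambda>b' t' s'. t1 + 1 + t' \<le> 11 * d + 25 \<and> env s' \<and> (regs s' 7, regs s' 8) = b' \<and> regs s' 9 = regs s 9 - 1)"
  proof (rule refines_Seq[OF pick_row[where Q = "\<lambda>y t s'. y \<in> set xs \<and> t \<le> 3 \<and> s' = set_reg 11 y s1"]])
    fix r t2 :: nat and s2 assume 2: "r \<in> set xs \<and> t2 \<le> 3 \<and> s2 = set_reg 11 r s1"
    define s3 where "s3 = set_reg 10 d (set_reg 13 0 s2)"
    have s3: "exec N n A (Assign 13 (Num 0) ;; Assign 10 (Reg 5)) s2 = s3"
      using 1 2 s by (simp add: s3_def env_regs)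
    have env3: "env s3" using 1 2 s by (simp add: s3_def)
    have regs3: "regs s3 7 = fst p" "regs s3 8 = snd p" "regs s3 9 = regs s 9" "regs s3 11 = r" "regs s3 12 = c"
      using 1 2 s by (auto simp: s3_def)
    have regs3': "regs s3 10 = d" "regs s3 13 = 0" by (simp_all add: s3_def)
    have lt: "r < n" "c < n" "fst p < n" "snd p < n" using 1 2 s xs_less cs_less by auto
    show "refines N n A ((Assign 13 (Num 0) ;; Assign 10 (Reg 5)) ;; count_code f ;;
        (cmp f 14 7 8 11 12 ;; Cond (Reg 14) (Cond (Less (Reg 5) (Mul (Num 3) (Reg 13))) Skip
            (Assign 7 (Reg 11) ;; Assign 8 (Reg 12))) Skip ;; decr 9)) s2
       (map_pmf (\<lambda>a. if val p < B r c \<and> 3 * a \<le> d then (r, c) else p) (count r c))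
       (\<lambda>b' t' s'. t1 + 1 + (t2 + 1 + t') \<le> 11 * d + 25 \<and> env s' \<and> (regs s' 7, regs s' 8) = b' \<and>
          regs s' 9 = regs s 9 - 1)"
      unfolding map_pmf_def
    proof (rule refines_Seq_loopfree, simp, unfold s3, rule refines_Seq)
      show "refines N n A (count_code f) s3 (count r c)
        (\<lambda>a t s'. t \<le> 11 * d + 1 \<and> env s' \<and> regs s' 13 = a \<and> a \<le> d \<and>
           (\<forall>r\<in>{7, 8, 9, 11, 12}. regs s' r = regs s3 r))"
        using count_refines[OF env3] lt regs3 regs3' by simp
    next
      fix t3 a t4 s4
      assume 3: "t3 \<le> weight (Assign 13 (Num 0) ;; Assign 10 (Reg 5))"
        and 4: "t4 \<le> 11 * d + 1 \<and> env s4 \<and> regs s4 13 = a \<and> a \<le> d \<and>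
           (\<forall>r\<in>{7, 8, 9, 11, 12}. regs s4 r = regs s3 r)"
      have regs4: "regs s4 7 = fst p" "regs s4 8 = snd p" "regs s4 9 = regs s 9" "regs s4 11 = r" "regs s4 12 = c"
        using 4 regs3 by auto
      \<comment> \<open>The code evaluates \<open>3 * a\<close> modulo \<open>N\<close>; since
        \<open>a \<le> d \<le> n\<close>, nothing wraps around.\<close>
      have "3 * a < N" "3 mod N = 3" using 4 N_gt d_le by auto
      then show "refines N n A (cmp f 14 7 8 11 12 ;; Cond (Reg 14) (Cond (Less (Reg 5) (Mul (Num 3) (Reg 13))) Skip
            (Assign 7 (Reg 11) ;; Assign 8 (Reg 12))) Skip ;; decr 9) s4
         (return_pmf (if val p < B r c \<and> 3 * a \<le> d then (r, c) else p))
         (\<lambda>b' t' s'. t1 + 1 + (t2 + 1 + (t3 + 1 + (t4 + 1 + t'))) \<le> 11 * d + 25 \<and> env s' \<and>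
             (regs s' 7, regs s' 8) = b' \<and> regs s' 9 = regs s 9 - 1)"
        using 1 2 3 4 regs4 lt N_gt
        by (intro refines_loopfree) (auto simp: exec_cmp env_regs prod_eq_iff not_less)
    qed
  qed (use 1 s in auto)
qed (use s in auto)

lemma trials_refines:
  assumes s: "env s" "(regs s 7, regs s 8) = p" "p \<in> set xs \<times> set cs"
  shows "refines N n A (trials_code f) s (trials p)
    (\<lambda>p' t s'. t \<le> d * d * (11 * d + 27) + 3 \<and> env s' \<and> (regs s' 7, regs s' 8) = p')"
  unfolding trials_code_def trials_def
proof (rule refines_Seq_loopfree)
  fix t0 assume t0: "t0 \<le> weight (Assign 9 (Mul (Reg 5) (Reg 5)))"
  have ex: "exec N n A (Assign 9 (Mul (Reg 5) (Reg 5))) s = set_reg 9 (d * d) s"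
    using s d N_gt by (simp add: env_regs)
  show "refines N n A (While (Reg 9) (trial_code f)) (exec N n A (Assign 9 (Mul (Reg 5) (Reg 5))) s)
     (loop_pmf (\<lambda>_. True) (\<lambda>_. trial) (d * d) p)
     (\<lambda>p' t' s'. t0 + 1 + t' \<le> d * d * (11 * d + 27) + 3 \<and> env s' \<and> (regs s' 7, regs s' 8) = p')"
    unfolding ex
  proof (rule refines_While[where t = 0 and I = "\<lambda>k p t s'. t + k * (11 * d + 27) \<le> d * d * (11 * d + 27) \<and> env s' \<and>
        (regs s' 7, regs s' 8) = p \<and> regs s' 9 = k \<and> p \<in> set xs \<times> set cs"])
    fix k p t s'
    assume I: "t + Suc k * (11 * d + 27) \<le> d * d * (11 * d + 27) \<and> env s' \<and>
        (regs s' 7, regs s' 8) = p \<and> regs s' 9 = Suc k \<and> p \<in> set xs \<times> set cs"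
    show "refines N n A (trial_code f) s' (trial p)
       (\<lambda>b' t' s'. t + t' + 2 + k * (11 * d + 27) \<le> d * d * (11 * d + 27) \<and> env s' \<and>
        (regs s' 7, regs s' 8) = b' \<and> regs s' 9 = k \<and> b' \<in> set xs \<times> set cs)"
      by (rule refines_mono[OF trial_refines[of s' p]]) (use I trial_support in auto)
  qed (use s t0 in auto)
qed simp

lemma probe_loop_refines:
  assumes s: "env s" "(regs s 7, regs s 8) = p" "p \<in> set xs \<times> set cs"
    "regs s 11 \<in> set xs" "regs s 12 < n" "regs s 10 = d" "regs s 14 = of_bool (val p < B (regs s 11) (regs s 12))"
  shows "refines N n A (probe_loop_code f) s (probe_loop (regs s 12) (val p) d (regs s 11, 0))
    (\<lambda>y t s'. t \<le> 17 * snd y + 1 \<and> env s' \<and> regs s' 11 = fst y \<and> fst y \<in> set xs \<and>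
       regs s' 14 = of_bool (val p < B (fst y) (regs s 12)) \<and>
       (\<forall>r\<in>{7, 8, 9, 12}. regs s' r = regs s r))"
  unfolding probe_loop_code_def probe_loop_def
proof (rule refines_While[where t = 0 and I = "\<lambda>k y t s'. t \<le> 17 * snd y \<and> env s' \<and> regs s' 10 = k \<and> k \<le> d \<and>
       regs s' 11 = fst y \<and> fst y \<in> set xs \<and>
       regs s' 14 = of_bool (val p < B (fst y) (regs s 12)) \<and> (\<forall>r\<in>{7, 8, 9, 12}. regs s' r = regs s r)"])
  fix k and y :: "nat \<times> nat" and t s'
  assume I: "t \<le> 17 * snd y \<and> env s' \<and> regs s' 10 = k \<and> k \<le> d \<and>
       regs s' 11 = fst y \<and> fst y \<in> set xs \<and>
       regs s' 14 = of_bool (val p < B (fst y) (regs s 12)) \<and> (\<forall>r\<in>{7, 8, 9, 12}. regs s' r = regs s r)"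
  then have "k < N" using d_le N_gt by auto
  then show "(eval N s' (Mul (Reg 10) (Reg 14)) \<noteq> 0) = (0 < k \<and> (case y of (q, t) \<Rightarrow> val p < B q (regs s 12)))"
    using I by (auto simp: split_def)
next
  fix k and y :: "nat \<times> nat" and t s'
  assume I: "t \<le> 17 * snd y \<and> env s' \<and> regs s' 10 = Suc k \<and> Suc k \<le> d \<and>
       regs s' 11 = fst y \<and> fst y \<in> set xs \<and>
       regs s' 14 = of_bool (val p < B (fst y) (regs s 12)) \<and> (\<forall>r\<in>{7, 8, 9, 12}. regs s' r = regs s r)"
  obtain q u where y: "y = (q, u)" by (cases y)
  have lt: "q < n" "fst p < n" "snd p < n" using I s xs_less cs_less y by auto
  show "refines N n A (pick f 15 ;; (cmp f 13 15 12 11 12 ;; Cond (Reg 13) (Assign 11 (Reg 15)) Skip ;;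
       cmp f 14 7 8 11 12 ;; decr 10)) s'
     (case y of (q, u) \<Rightarrow> map_pmf (\<lambda>x. (if B x (regs s 12) < B q (regs s 12) then x else q, Suc u)) (pmf_of_set (set xs)))
     (\<lambda>y' t' s''. t + t' + 2 \<le> 17 * snd y' \<and> env s'' \<and> regs s'' 10 = k \<and> k \<le> d \<and>
       regs s'' 11 = fst y' \<and> fst y' \<in> set xs \<and>
       regs s'' 14 = of_bool (val p < B (fst y') (regs s 12)) \<and> (\<forall>r\<in>{7, 8, 9, 12}. regs s'' r = regs s r))"
    unfolding y prod.case map_pmf_def
  proof (rule refines_Seq[OF pick_row[where Q = "\<lambda>x t s''. x \<in> set xs \<and> t \<le> 3 \<and> s'' = set_reg 15 x s'"]])
    fix x t' :: nat and s'' assume x: "x \<in> set xs \<and> t' \<le> 3 \<and> s'' = set_reg 15 x s'"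
    then show "refines N n A (cmp f 13 15 12 11 12 ;; Cond (Reg 13) (Assign 11 (Reg 15)) Skip ;;
         cmp f 14 7 8 11 12 ;; decr 10) s''
       (return_pmf (if B x (regs s 12) < B q (regs s 12) then x else q, Suc u))
       (\<lambda>y' t'' s''. t + (t' + 1 + t'') + 2 \<le> 17 * snd y' \<and> env s'' \<and> regs s'' 10 = k \<and> k \<le> d \<and>
         regs s'' 11 = fst y' \<and> fst y' \<in> set xs \<and>
         regs s'' 14 = of_bool (val p < B (fst y') (regs s 12)) \<and> (\<forall>r\<in>{7, 8, 9, 12}. regs s'' r = regs s r))"
      using I s(1-5,7) xs_less[of x] lt y by (intro refines_loopfree) (auto simp: exec_cmp)
  qed (use I in auto)
qed (use s in auto)

lemma probe_refines:
  assumes s: "env s" "(regs s 7, regs s 8) = p" "p \<in> set xs \<times> set cs" "regs s 9 = Suc k" "k < length cs"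
  shows "refines N n A (probe_code f) s (probe (cs ! k) p)
    (\<lambda>y t s'. t \<le> 17 * snd y + 20 \<and> env s' \<and> (regs s' 7, regs s' 8) = fst y \<and> regs s' 9 = k)"
  unfolding probe_code_def probe_def
proof (rule refines_Seq_loopfree)
  fix t0 assume t0: "t0 \<le> weight (Assign 12 (Load (Add (base (\<not> f)) (Reg 9))))"
  define s0 where "s0 = set_reg 12 (cs ! k) s"
  have ex: "exec N n A (Assign 12 (Load (Add (base (\<not> f)) (Reg 9)))) s = s0"
    using load_col[of s "Reg 9" k] s by (simp add: s0_def)
  have env0: "env s0" using s by (simp add: s0_def)
  have ck: "cs ! k \<in> set cs" using s by simp
  show "refines N n A (pick f 11 ;; (Assign 10 (Reg 5) ;; cmp f 14 7 8 11 12) ;; probe_loop_code f ;;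
       (Cond (Reg 14) (Assign 7 (Reg 11) ;; Assign 8 (Reg 12)) Skip ;; decr 9))
      (exec N n A (Assign 12 (Load (Add (base (\<not> f)) (Reg 9)))) s)
     (pmf_of_set (set xs) \<bind> (\<lambda>q. map_pmf (\<lambda>(q, t). (if val p < B q (cs ! k) then (q, cs ! k) else p, t))
         (probe_loop (cs ! k) (val p) d (q, 0))))
     (\<lambda>y t' s'. t0 + 1 + t' \<le> 17 * snd y + 20 \<and> env s' \<and> (regs s' 7, regs s' 8) = fst y \<and> regs s' 9 = k)"
    unfolding ex
  proof (rule refines_Seq[OF pick_row[where Q = "\<lambda>x t s''. x \<in> set xs \<and> t \<le> 3 \<and> s'' = set_reg 11 x s0"]])
    fix q t1 :: nat and s1 assume 1: "q \<in> set xs \<and> t1 \<le> 3 \<and> s1 = set_reg 11 q s0"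
    have lt: "q < n" "cs ! k < n" "fst p < n" "snd p < n" using 1 s ck xs_less cs_less by auto
    define s2 where "s2 = set_reg 14 (of_bool (val p < B q (cs ! k))) (set_reg 10 d s1)"
    have s2: "exec N n A (Assign 10 (Reg 5) ;; cmp f 14 7 8 11 12) s1 = s2"
      using 1 s lt by (auto simp: s2_def s0_def exec_cmp env_regs)
    have env2: "env s2" using 1 env0 by (simp add: s2_def)
    have regs2: "regs s2 7 = fst p" "regs s2 8 = snd p" "regs s2 9 = Suc k" "regs s2 11 = q" "regs s2 12 = cs ! k"
      "regs s2 10 = d" "regs s2 14 = of_bool (val p < B q (cs ! k))"
      using 1 s by (auto simp: s2_def s0_def)
    show "refines N n A ((Assign 10 (Reg 5) ;; cmp f 14 7 8 11 12) ;; probe_loop_code f ;;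
         (Cond (Reg 14) (Assign 7 (Reg 11) ;; Assign 8 (Reg 12)) Skip ;; decr 9)) s1
       (map_pmf (\<lambda>(q, t). (if val p < B q (cs ! k) then (q, cs ! k) else p, t))
         (probe_loop (cs ! k) (val p) d (q, 0)))
       (\<lambda>y t' s'. t0 + 1 + (t1 + 1 + t') \<le> 17 * snd y + 20 \<and> env s' \<and> (regs s' 7, regs s' 8) = fst y \<and> regs s' 9 = k)"
      unfolding map_pmf_def
    proof (rule refines_Seq_loopfree, simp, unfold s2, rule refines_Seq)
      show "refines N n A (probe_loop_code f) s2 (probe_loop (cs ! k) (val p) d (q, 0))
        (\<lambda>y t s'. t \<le> 17 * snd y + 1 \<and> env s' \<and> regs s' 11 = fst y \<and> fst y \<in> set xs \<and>
         regs s' 14 = of_bool (val p < B (fst y) (cs ! k)) \<and>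
         (\<forall>r\<in>{7, 8, 9, 12}. regs s' r = regs s2 r))"
        using probe_loop_refines[of s2 p] env2 regs2 s(3) 1 lt by simp
    next
      fix t2 and y :: "nat \<times> nat" and t3 s3
      assume 2: "t2 \<le> weight (Assign 10 (Reg 5) ;; cmp f 14 7 8 11 12)"
        and 3: "t3 \<le> 17 * snd y + 1 \<and> env s3 \<and> regs s3 11 = fst y \<and> fst y \<in> set xs \<and>
         regs s3 14 = of_bool (val p < B (fst y) (cs ! k)) \<and>
         (\<forall>r\<in>{7, 8, 9, 12}. regs s3 r = regs s2 r)"
      have regs3: "regs s3 7 = fst p" "regs s3 8 = snd p" "regs s3 9 = Suc k" "regs s3 12 = cs ! k"
        using 3 regs2 by auto
      show "refines N n A (Cond (Reg 14) (Assign 7 (Reg 11) ;; Assign 8 (Reg 12)) Skip ;; decr 9) s3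
         (return_pmf (case y of (q, t) \<Rightarrow> (if val p < B q (cs ! k) then (q, cs ! k) else p, t)))
         (\<lambda>y t' s'. t0 + 1 + (t1 + 1 + (t2 + 1 + (t3 + 1 + t'))) \<le> 17 * snd y + 20 \<and> env s' \<and>
            (regs s' 7, regs s' 8) = fst y \<and> regs s' 9 = k)"
        using t0 1 2 3 regs3 by (intro refines_loopfree) (auto simp: split_def prod_eq_iff)
    qed
  qed (use env0 in auto)
qed simp

lemma pass_refines:
  assumes s: "env s" "(regs s 7, regs s 8) = p" "p \<in> set xs \<times> set cs"
  shows "refines N n A (pass_code f) s (pass cs p)
    (\<lambda>y t s'. t \<le> 17 * snd y + 22 * length cs + 3 \<and> env s' \<and> (regs s' 7, regs s' 8) = fst y)"
  unfolding pass_code_def pass_def pass_from_def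
proof (rule refines_Seq_loopfree)
  fix t0 assume t0: "t0 \<le> weight (Assign 9 (Reg (size_reg (\<not> f))))"
  have ex: "exec N n A (Assign 9 (Reg (size_reg (\<not> f)))) s = set_reg 9 (length cs) s"
    using s by (simp add: env_regs)
  show "refines N n A (While (Reg 9) (probe_code f)) (exec N n A (Assign 9 (Reg (size_reg (\<not> f)))) s)
     (loop_pmf (\<lambda>_. True) (\<lambda>k (p, T). map_pmf (\<lambda>(p', t). (p', T + t)) (probe (cs ! k) p)) (length cs) (p, 0))
     (\<lambda>y t' s'. t0 + 1 + t' \<le> 17 * snd y + 22 * length cs + 3 \<and> env s' \<and> (regs s' 7, regs s' 8) = fst y)"
    unfolding ex
  \<comment> \<open>22 is the fixed cost 20 of \<open>probe_code\<close> plus the 2 steps of the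
    loop.\<close>
  proof (rule refines_While[where t = 0 and I = "\<lambda>k y t s'. t + 22 * k \<le> 17 * snd y + 22 * length cs \<and> env s' \<and>
        (regs s' 7, regs s' 8) = fst y \<and> regs s' 9 = k \<and> k \<le> length cs \<and> fst y \<in> set xs \<times> set cs"])
    fix k and y :: "(nat \<times> nat) \<times> nat" and t s'
    assume I: "t + 22 * Suc k \<le> 17 * snd y + 22 * length cs \<and> env s' \<and>
        (regs s' 7, regs s' 8) = fst y \<and> regs s' 9 = Suc k \<and> Suc k \<le> length cs \<and> fst y \<in> set xs \<times> set cs"
    have ck: "cs ! k \<in> set cs" using I by simp
    have "refines N n A (probe_code f) s' (probe (cs ! k) (fst y) \<bind> (\<lambda>x. return_pmf (fst x, snd y + snd x)))
       (\<lambda>y t' s'. t + t' + 2 + 22 * k \<le> 17 * snd y + 22 * length cs \<and> env s' \<and>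
        (regs s' 7, regs s' 8) = fst y \<and> regs s' 9 = k \<and> k \<le> length cs \<and> fst y \<in> set xs \<times> set cs)"
    proof -
      have "refines N n A (probe_code f) s' (probe (cs ! k) (fst y))
         (\<lambda>x t' s'. t + t' + 2 + 22 * k \<le> 17 * (snd y + snd x) + 22 * length cs \<and> env s' \<and>
        (regs s' 7, regs s' 8) = fst x \<and> regs s' 9 = k \<and> k \<le> length cs \<and> fst x \<in> set xs \<times> set cs)"
        by (rule refines_mono[OF probe_refines[of s' "fst y" k]]) (use I probe_support[OF _ _ ck, of _ "fst y"] in auto)
      then show ?thesis
        unfolding refines_def map_pmf_def[symmetric] pmf.rel_map by simp
    qed
    then show "refines N n A (probe_code f) s'
       (case y of (p, T) \<Rightarrow> map_pmf (\<lambda>(p', t). (p', T + t)) (probe (cs ! k) p))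
       (\<lambda>y t' s'. t + t' + 2 + 22 * k \<le> 17 * snd y + 22 * length cs \<and> env s' \<and>
        (regs s' 7, regs s' 8) = fst y \<and> regs s' 9 = k \<and> k \<le> length cs \<and> fst y \<in> set xs \<times> set cs)"
      by (simp add: split_def map_pmf_def)
  qed (use s t0 in auto)
qed simp

lemma column_min_refines:
  assumes s: "env s"
  shows "refines N n A (column_min_code f) s (return_pmf ())
    (\<lambda>_ t s'. t \<le> 14 * length xs + 7 \<and> env s' \<and> (regs s' 7, regs s' 8) \<in> set xs \<times> set cs \<and>
       valid (regs s' 7, regs s' 8))"
  unfolding column_min_code_def
proof (rule refines_Seq_loopfree)
  let ?init = "Assign 8 (Load (Add (base (\<not> f)) (Num 1))) ;; Assign 7 (Load (Add (base f) (Num 1))) ;;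
      Assign 9 (Reg (size_reg f))"
  let ?body = "Assign 11 (Load (Add (base f) (Reg 9))) ;; cmp f 14 11 8 7 8 ;;
        Cond (Reg 14) (Assign 7 (Reg 11)) Skip ;; decr 9"
  fix t0 assume t0: "t0 \<le> weight ?init"
  have len: "0 < length xs" "0 < length cs" using proper_length[OF xs] proper_length[OF cs] by auto
  have e1: "eval N u (Num 1) = Suc 0" for u using N_gt by simp
  have s0: "exec N n A ?init s = set_reg 9 (length xs) (set_reg 7 (xs ! 0) (set_reg 8 (cs ! 0) s))"
    using load_col[OF s e1] load_row[OF _ e1, of "set_reg 8 (cs ! 0) s"] s len
    by (simp add: env_regs del: eval.simps(3,1)) (auto simp: size_reg_def split: if_splits)
  let ?c = "cs ! 0"
  have c: "?c \<in> set cs" using len by simp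
  have "refines N n A (While (Reg 9) ?body) (exec N n A ?init s) (loop_pmf (\<lambda>_. True) (\<lambda>_ _. return_pmf ()) (length xs) ())
     (\<lambda>_ t' s'. t0 + 1 + t' \<le> 14 * length xs + 7 \<and> env s' \<and> (regs s' 7, regs s' 8) \<in> set xs \<times> set cs \<and>
       valid (regs s' 7, regs s' 8))"
    unfolding s0
  proof (rule refines_While[where t = 0 and I = "\<lambda>k y t s'. t + 14 * k \<le> 14 * length xs \<and> env s' \<and>
        regs s' 7 \<in> set xs \<and> regs s' 8 = ?c \<and> regs s' 9 = k \<and> k \<le> length xs \<and>
        (\<forall>i. k \<le> i \<and> i < length xs \<longrightarrow> B (regs s' 7) ?c \<le> B (xs ! i) ?c)"])
    fix k y t s'
    assume I: "t + 14 * Suc k \<le> 14 * length xs \<and> env s' \<and>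
        regs s' 7 \<in> set xs \<and> regs s' 8 = ?c \<and> regs s' 9 = Suc k \<and> Suc k \<le> length xs \<and>
        (\<forall>i. Suc k \<le> i \<and> i < length xs \<longrightarrow> B (regs s' 7) ?c \<le> B (xs ! i) ?c)"
    have x: "xs ! k \<in> set xs" using I by simp
    have l: "eval N s' (Load (Add (base f) (Reg 9))) = xs ! k"
      by (rule load_row) (use I in auto)
    have min: "\<forall>i. k \<le> i \<and> i < length xs \<longrightarrow>
       B (if B (xs ! k) ?c < B (regs s' 7) ?c then xs ! k else regs s' 7) ?c \<le> B (xs ! i) ?c"
    proof (intro allI impI)
      fix i assume "k \<le> i \<and> i < length xs"
      then show "B (if B (xs ! k) ?c < B (regs s' 7) ?c then xs ! k else regs s' 7) ?c \<le> B (xs ! i) ?c"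
        using I by (cases "i = k") (auto simp: Suc_le_eq intro: order.trans[of _ "B (regs s' 7) ?c"])
    qed
    show "refines N n A ?body s' (return_pmf ()) (\<lambda>b' t' s''. t + t' + 2 + 14 * k \<le> 14 * length xs \<and> env s'' \<and>
        regs s'' 7 \<in> set xs \<and> regs s'' 8 = ?c \<and> regs s'' 9 = k \<and> k \<le> length xs \<and>
        (\<forall>i. k \<le> i \<and> i < length xs \<longrightarrow> B (regs s'' 7) ?c \<le> B (xs ! i) ?c))"
      using I x xs_less[of "xs ! k"] xs_less[of "regs s' 7"] cs_less[OF c] min
      by (intro refines_loopfree) (auto simp: exec_cmp l simp del: eval.simps(3) split: if_splits)
  next
    fix k y u t' s'
    assume I: "u + 14 * k \<le> 14 * length xs \<and> env s' \<and>
        regs s' 7 \<in> set xs \<and> regs s' 8 = ?c \<and> regs s' 9 = k \<and> k \<le> length xs \<and>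
        (\<forall>i. k \<le> i \<and> i < length xs \<longrightarrow> B (regs s' 7) ?c \<le> B (xs ! i) ?c)"
      and "k = 0 \<or> \<not> True" "0 + t' = u + 1"
    then have "below (regs s' 7) ?c = 0"
      by (auto simp: below_def in_set_conv_nth)
    then have "valid (regs s' 7, regs s' 8)" using I cardR by (simp add: valid_def)
    then show "t0 + 1 + t' \<le> 14 * length xs + 7 \<and> env s' \<and> (regs s' 7, regs s' 8) \<in> set xs \<times> set cs \<and>
       valid (regs s' 7, regs s' 8)"
      using I c t0 \<open>0 + t' = u + 1\<close> by auto
  qed (use s len in auto)
  then show "refines N n A (While (Reg 9) ?body) (exec N n A ?init s) (return_pmf ())
     (\<lambda>_ t' s'. t0 + 1 + t' \<le> 14 * length xs + 7 \<and> env s' \<and> (regs s' 7, regs s' 8) \<in> set xs \<times> set cs \<and>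
       valid (regs s' 7, regs s' 8))"
    unfolding loop_pmf_return .
qed simp

end

lemma refines_const:
  assumes "refines N n A c s (return_pmf ()) Q" "\<And>t s'. Q () t s' \<Longrightarrow> Q' y t s'"
  shows "refines N n A c s (return_pmf y) Q'"
proof -
  have "refines N n A c s (map_pmf (\<lambda>_. y) (return_pmf ())) Q'"
    using assms unfolding refines_def pmf.rel_map by (auto elim!: pmf.rel_mono_strong)
  then show ?thesis by simp
qed

section \<open>Sure and probable postconditions\<close>

text \<open>\<open>Q\<close> holds in every run and carries correctness; \<open>Q'\<close> may
  mention the time and fails with probability at most \<open>e\<close>. Both concern the same law
  \<open>E\<close>, so errors add up while correctness stays unconditional.\<close>

definition whp :: "nat \<Rightarrow> nat \<Rightarrow> (nat \<Rightarrow> nat \<Rightarrow> 'a::linorder) \<Rightarrow> com \<Rightarrow> state \<Rightarrow> real \<Rightarrow>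
    (state \<Rightarrow> bool) \<Rightarrow> (nat \<Rightarrow> state \<Rightarrow> bool) \<Rightarrow> bool" where
  "whp N n A c s e Q Q' \<longleftrightarrow> (\<exists>E. runs N n A (c, s) E \<and> (\<forall>x\<in>set_pmf E. Q (snd x)) \<and>
     expect_le E (\<lambda>x. of_bool (\<not> Q' (fst x) (snd x))) e)"

lemma whp_mono:
  assumes "whp N n A c s e Q Q'" "\<And>s'. Q s' \<Longrightarrow> R s'" "\<And>t s'. Q s' \<Longrightarrow> Q' t s' \<Longrightarrow> R' t s'" "e \<le> e'"
  shows "whp N n A c s e' R R'"
proof -
  obtain E where E: "runs N n A (c, s) E" "\<forall>x\<in>set_pmf E. Q (snd x)"
    "expect_le E (\<lambda>x. of_bool (\<not> Q' (fst x) (snd x))) e"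
    using assms(1) by (auto simp: whp_def)
  have "expect_le E (\<lambda>x. of_bool (\<not> R' (fst x) (snd x))) e'"
    by (rule expect_le_mono[OF E(3)]) (use E(2) assms in auto)
  then show ?thesis using E assms(2) by (auto simp: whp_def)
qed

lemma whp_trivial:
  assumes "whp N n A c s e Q Q'" "1 \<le> e'"
  shows "whp N n A c s e' Q R'"
proof -
  obtain E where E: "runs N n A (c, s) E" "\<forall>x\<in>set_pmf E. Q (snd x)"
    using assms(1) by (auto simp: whp_def)
  moreover have "expect_le E (\<lambda>x. of_bool (\<not> R' (fst x) (snd x))) e'"
    by (rule expect_le_mono[OF expect_le_const[of _ 1]]) (use assms in auto)
  ultimately show ?thesis by (auto simp: whp_def)
qed

text \<open>On the joint law \<open>W\<close> of the coupling, a failure of \<open>Q'\<close> forces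
  a failure of \<open>good\<close>, whose probability is known on the abstract side.\<close>

lemma whp_refines:
  assumes "refines N n A c s D Q0" "\<And>b t s'. b \<in> set_pmf D \<Longrightarrow> Q0 b t s' \<Longrightarrow> Q s'"
    "expect_le D (\<lambda>b. of_bool (\<not> good b)) e" "\<And>b t s'. b \<in> set_pmf D \<Longrightarrow> good b \<Longrightarrow> Q0 b t s' \<Longrightarrow> Q' t s'"
  shows "whp N n A c s e Q Q'"
proof -
  obtain E where E: "runs N n A (c, s) E" "rel_pmf (\<lambda>x b. Q0 b (fst x) (snd x)) E D"
    using assms(1) by (auto simp: refines_def)
  from E(2) obtain W where W: "\<And>x b. (x, b) \<in> set_pmf W \<Longrightarrow> Q0 b (fst x) (snd x)"
      "map_pmf fst W = E" "map_pmf snd W = D"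
    by (auto elim!: rel_pmf.cases)
  have bD: "b \<in> set_pmf D" if "(x, b) \<in> set_pmf W" for x b
    using that W(3) by force
  have "Q (snd x)" if "x \<in> set_pmf E" for x
  proof -
    have "x \<in> fst ` set_pmf W" using that unfolding W(2)[symmetric] by simp
    then obtain b where "(x, b) \<in> set_pmf W" by auto
    then show ?thesis using W(1) bD assms(2) by blast
  qed
  moreover have "expect_le W (\<lambda>y. of_bool (\<not> Q' (fst (fst y)) (snd (fst y)))) e"
  proof (rule expect_le_mono)
    show "expect_le W (\<lambda>y. of_bool (\<not> good (snd y))) e"
      using assms(3) unfolding W(3)[symmetric] by (simp add: expect_le_map)
    fix y assume "y \<in> set_pmf W"
    then have "(fst y, snd y) \<in> set_pmf W" by simp
    then show "of_bool (\<not> Q' (fst (fst y)) (snd (fst y))) \<le> (of_bool (\<not> good (snd y)) :: real)"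
      using W(1) bD assms(4) by fastforce
  qed simp
  then have "expect_le E (\<lambda>x. of_bool (\<not> Q' (fst x) (snd x))) e"
    unfolding W(2)[symmetric] by (simp add: expect_le_map)
  ultimately show ?thesis using E by (auto simp: whp_def)
qed

lemma whp_refines_return:
  assumes "refines N n A c s (return_pmf ()) (\<lambda>_ t s'. Q s' \<and> Q' t s')"
  shows "whp N n A c s 0 Q Q'"
  by (rule whp_refines[OF assms, of Q "\<lambda>_. True"]) (auto intro: expect_le_return)

text \<open>When the first part misses \<open>Q1'\<close>, the allowance for the second part reaches
  1 and so demands nothing of \<open>Q2'\<close>, while \<open>Q2\<close> is still required.\<close>

lemma whp_Seq:
  assumes "whp N n A c s e1 Q1 Q1'" "0 \<le> e1" "0 \<le> e2"
    "\<And>t s'. Q1 s' \<Longrightarrow> whp N n A d s' (e2 + of_bool (\<not> Q1' t s')) Q2 (\<lambda>t'. Q2' (t + 1 + t'))"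
  shows "whp N n A (Seq c d) s (e1 + e2) Q2 Q2'"
proof -
  obtain E where E: "runs N n A (c, s) E" "\<forall>x\<in>set_pmf E. Q1 (snd x)"
    "expect_le E (\<lambda>x. of_bool (\<not> Q1' (fst x) (snd x))) e1"
    using assms(1) by (auto simp: whp_def)
  have "\<forall>x\<in>set_pmf E. \<exists>G. runs N n A (d, snd x) G \<and> (\<forall>y\<in>set_pmf G. Q2 (snd y)) \<and>
      expect_le G (\<lambda>y. of_bool (\<not> Q2' (fst x + 1 + fst y) (snd y))) (e2 + of_bool (\<not> Q1' (fst x) (snd x)))"
  proof
    fix x assume "x \<in> set_pmf E"
    then have "Q1 (snd x)" using E(2) by blast
    from assms(4)[OF this, of "fst x"]
    show "\<exists>G. runs N n A (d, snd x) G \<and> (\<forall>y\<in>set_pmf G. Q2 (snd y)) \<and>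
      expect_le G (\<lambda>y. of_bool (\<not> Q2' (fst x + 1 + fst y) (snd y))) (e2 + of_bool (\<not> Q1' (fst x) (snd x)))"
      unfolding whp_def .
  qed
  from bchoice[OF this] obtain G where G: "\<And>x. x \<in> set_pmf E \<Longrightarrow> runs N n A (d, snd x) (G x) \<and> (\<forall>y\<in>set_pmf (G x). Q2 (snd y)) \<and>
      expect_le (G x) (\<lambda>y. of_bool (\<not> Q2' (fst x + 1 + fst y) (snd y))) (e2 + of_bool (\<not> Q1' (fst x) (snd x)))"
    by blast
  define H where "H = bind_pmf E (\<lambda>x. map_pmf (apfst (\<lambda>u. fst x + 1 + u)) (G x))"
  have "runs N n A (Seq c d, s) H"
    unfolding H_def using G by (intro runs_Seq E(1)) auto
  moreover have "\<forall>y\<in>set_pmf H. Q2 (snd y)"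
    using G by (auto simp: H_def)
  moreover have "expect_le H (\<lambda>x. of_bool (\<not> Q2' (fst x) (snd x))) (e1 + e2)"
    unfolding H_def
  proof (rule expect_le_bind)
    show "expect_le E (\<lambda>x. of_bool (\<not> Q1' (fst x) (snd x)) + e2) (e1 + e2)"
      using assms E(3) by (intro expect_le_add expect_le_const) auto
    show "expect_le (map_pmf (apfst (\<lambda>u. fst x + 1 + u)) (G x)) (\<lambda>x. of_bool (\<not> Q2' (fst x) (snd x)))
        (of_bool (\<not> Q1' (fst x) (snd x)) + e2)" if "x \<in> set_pmf E" for x
      using G[OF that] by (simp add: expect_le_map add.commute)
  qed
  ultimately show ?thesis by (auto simp: whp_def)
qed

lemma whp_step:
  assumes "c \<noteq> Skip" "step N n A (c, s) = return_pmf (d, s')"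
    "whp N n A d s' e Q (\<lambda>t. Q' (Suc t))"
  shows "whp N n A c s e Q Q'"
proof -
  obtain E where "runs N n A (d, s') E" "\<forall>x\<in>set_pmf E. Q (snd x)"
    "expect_le E (\<lambda>x. of_bool (\<not> Q' (Suc (fst x)) (snd x))) e"
    using assms(3) by (auto simp: whp_def)
  then show ?thesis
    unfolding whp_def using runs_step_return[OF assms(1,2)]
    by (intro exI[of _ "map_pmf (apfst Suc) E"]) (auto simp: expect_le_map)
qed

text \<open>A deleted entry is overwritten by the last one, scanning from the end of the array.\<close>

lemma swap_delete:
  assumes "distinct ys" "k < length ys"
  shows "distinct (butlast (ys[k := last ys]))" "set (butlast (ys[k := last ys])) = set ys - {ys ! k}"
proof -
  obtain zs l where ys: "ys = zs @ [l]" using assms(2) by (cases ys rule: rev_cases) auto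
  have "distinct (butlast (ys[k := last ys])) \<and> set (butlast (ys[k := last ys])) = set ys - {ys ! k}"
  proof (cases "k = length zs")
    case True
    then show ?thesis using assms ys by auto
  next
    case False
    then have "k < length zs" using assms ys by simp
    then show ?thesis using assms ys
      by (auto simp: list_update_append nth_append set_update_distinct distinct_list_update)
  qed
  then show "distinct (butlast (ys[k := last ys]))" "set (butlast (ys[k := last ys])) = set ys - {ys ! k}"
    by auto
qed

section \<open>Deleting rows while keeping the saddlepoint\<close>

context reduction
begin

lemma delete_refines:
  assumes s: "env s" "(regs s 7, regs s 8) = p" "p \<in> set xs \<times> set cs"
  shows "refines N n A (delete_code f) s (return_pmf ())
    (\<lambda>_ t s'. t \<le> 13 * length xs + 3 \<and> regs s' 0 = n \<and> regs s' 5 = d \<and> regs s' 6 = z \<and>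
       holds_array n (\<not> f) cs s' \<and>
       (\<exists>ys. proper n ys \<and> holds_array n f ys s' \<and> set ys = {x\<in>set xs. \<not> val p < B x (snd p)}))"
  unfolding delete_code_def
proof (rule refines_Seq_loopfree)
  let ?Q = "\<lambda>t0 t s'. t0 + 1 + t \<le> 13 * length xs + 3 \<and> regs s' 0 = n \<and> regs s' 5 = d \<and> regs s' 6 = z \<and>
       holds_array n (\<not> f) cs s' \<and>
       (\<exists>ys. proper n ys \<and> holds_array n f ys s' \<and> set ys = {x\<in>set xs. \<not> val p < B x (snd p)})"
  let ?c1 = "Assign 11 (Load (Add (base f) (Reg 9)))"
  let ?c2 = "Cond (Reg 14) (Store (Add (base f) (Reg 9)) (Load (Add (base f) (Reg (size_reg f)))) ;; decr (size_reg f)) Skip"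
  let ?body = "?c1 ;; cmp f 14 7 8 11 8 ;; ?c2 ;; decr 9"
  define gone where "gone x \<longleftrightarrow> val p < B x (snd p)" for x
  \<comment> \<open>The first \<open>k\<close> entries are untouched. What overwrites a deleted
    entry comes from the end and has been examined before, so no entry is skipped. Behind position
    \<open>k\<close> the order is lost, and only the set is recorded.\<close>
  define I where "I k t s' \<longleftrightarrow> t + 13 * k \<le> 13 * length xs \<and> regs s' 0 = n \<and> regs s' 5 = d \<and> regs s' 6 = z \<and>
     holds_array n (\<not> f) cs s' \<and> (regs s' 7, regs s' 8) = p \<and> regs s' 9 = k \<and>
     (\<exists>ys. holds_array n f ys s' \<and> k \<le> length ys \<and> length ys \<le> length xs \<and> take k ys = take k xs \<and>
        distinct ys \<and> set ys = set xs - {x\<in>set (drop k xs). gone x})" for k t s'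
  fix t0 assume t0: "t0 \<le> weight (Assign 9 (Reg (size_reg f)))"
  have ex: "exec N n A (Assign 9 (Reg (size_reg f))) s = set_reg 9 (length xs) s"
    using s by (simp add: env_regs)
  have lt: "fst p < n" "snd p < n" using s xs_less cs_less by auto
  have "refines N n A (While (Reg 9) ?body) (set_reg 9 (length xs) s) (loop_pmf (\<lambda>_. True) (\<lambda>_ _. return_pmf ()) (length xs) ())
     (\<lambda>_ t s'. ?Q t0 t s')"
  proof (rule refines_While[where t = 0 and I = "\<lambda>k _. I k"])
    show "I (length xs) 0 (set_reg 9 (length xs) s)"
      using s xs unfolding I_def env_def
      by (auto simp: holds_array_def size_reg_def proper_def intro!: exI[of _ xs])
  next
    fix k t s' assume "I k t s'"
    then show "(eval N s' (Reg 9) \<noteq> 0) = (0 < k \<and> True)" by (simp add: I_def)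
  next
    fix k t s' and b :: unit
    assume I: "I (Suc k) t s'"
    then obtain ys where ys: "holds_array n f ys s'" "Suc k \<le> length ys" "length ys \<le> length xs"
        "take (Suc k) ys = take (Suc k) xs" "distinct ys" "set ys = set xs - {x\<in>set (drop (Suc k) xs). gone x}"
      by (auto simp: I_def)
    have len: "length xs \<le> n" using proper_length[OF xs] by simp
    have yk: "ys ! k = xs ! k" using ys(4) by (metis lessI nth_take)
    have xk: "xs ! k < n" using xs_less[of "xs ! k"] ys by simp
    have r: "regs s' 0 = n" "regs s' 9 = Suc k" "regs s' 7 = fst p" "regs s' 8 = snd p" "regs s' (size_reg f) = length ys"
      using I ys(1) by (auto simp: I_def holds_array_def)
    define s1 where "s1 = set_reg 14 (of_bool (gone (xs ! k))) (set_reg 11 (xs ! k) s')"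
    have "eval N s' (Load (Add (base f) (Reg 9))) = xs ! k"
      using eval_base[of s' "Reg 9" f] r ys len yk by (simp add: holds_array_def)
    then have s1: "exec N n A (cmp f 14 7 8 11 8) (exec N n A ?c1 s') = s1"
      using lt xk r by (simp add: exec_cmp s1_def gone_def del: eval.simps(3))
    have r1: "regs s1 0 = n" "regs s1 9 = Suc k" "regs s1 (size_reg f) = length ys" "regs s1 14 = of_bool (gone (xs ! k))"
      using r by (auto simp: s1_def size_reg_def)
    have dk: "set (drop k xs) = insert (xs ! k) (set (drop (Suc k) xs))"
      using ys by (metis Cons_nth_drop_Suc Suc_le_lessD list.simps(15) order.trans)
    have I': "I k (t + t' + 2) (exec N n A ?body s')" if "t' \<le> weight ?body" for t'
    proof (cases "gone (xs ! k)")
      case False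
      then have "exec N n A ?body s' = set_reg 9 k s1"
        using s1 r1 by simp
      moreover have "set ys = set xs - {x\<in>set (drop k xs). gone x}" using ys dk False by auto
      moreover have "take k ys = take k xs"
        using arg_cong[OF ys(4), of "take k"] by simp
      moreover have "holds_array n g ws (set_reg 9 k s1) \<longleftrightarrow> holds_array n g ws s'" for g ws
        by (auto simp: holds_array_def s1_def size_reg_def)
      moreover have "regs s1 r = (if r = 14 then 0 else if r = 11 then xs ! k else regs s' r)" for r
        using False by (simp add: s1_def)
      ultimately show ?thesis using I that ys unfolding I_def
        by (intro conjI exI[of _ ys]) (auto simp del: exec.simps)
    next
      case True
      define zs where "zs = butlast (ys[k := last ys])"
      have "eval N s1 (Add (base f) (Reg 9)) = offset n f + Suc k"
        using eval_base[of s1 "Reg 9" f] r1 ys len by simp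
      moreover have "eval N s1 (Load (Add (base f) (Reg (size_reg f)))) = last ys"
      proof -
        have "eval N s1 (Add (base f) (Reg (size_reg f))) = offset n f + Suc (length ys - 1)"
          using eval_base[of s1 "Reg (size_reg f)" f] r1 ys len by simp
        moreover have "mem s1 (offset n f + Suc (length ys - 1)) = ys ! (length ys - 1)"
          using ys(1,2) unfolding holds_array_def s1_def by (auto simp del: add_Suc_right)
        moreover have "ys \<noteq> []" using ys(2) by auto
        ultimately show ?thesis by (simp add: last_conv_nth)
      qed
      ultimately have eq: "exec N n A ?body s' =
          set_reg 9 k (set_reg (size_reg f) (length ys - 1) (set_mem (offset n f + Suc k) (last ys) s1))"
        using s1 r1 True by (simp add: size_reg_def del: eval.simps(3,4))
      have zs: "length zs = length ys - 1" "distinct zs" "set zs = set ys - {xs ! k}"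
        using swap_delete[of ys k] ys yk by (auto simp: zs_def)
      have "take k zs = take k xs"
      proof -
        have "take k zs = take k (ys[k := last ys])"
          using ys(2) by (simp add: zs_def take_butlast)
        also have "\<dots> = take k ys" by simp
        also have "\<dots> = take k xs" using arg_cong[OF ys(4), of "take k"] by simp
        finally show ?thesis .
      qed
      moreover have "holds_array n f zs (exec N n A ?body s')"
        unfolding eq holds_array_def
      proof (intro conjI allI impI)
        fix i assume "i < length zs"
        then have "zs ! i = ys[k := last ys] ! i" "i < length ys"
          using zs(1) by (auto simp: zs_def nth_butlast)
        then show "mem (set_reg 9 k (set_reg (size_reg f) (length ys - 1) (set_mem (offset n f + Suc k) (last ys) s1)))
            (offset n f + Suc i) = zs ! i"
          using ys(1) by (auto simp: holds_array_def s1_def nth_list_update)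
      qed (auto simp: zs size_reg_def)
      moreover have "holds_array n (\<not> f) cs (exec N n A ?body s')"
        using I proper_length[OF cs] ys len unfolding eq I_def holds_array_def s1_def
        by (auto simp: size_reg_def offset_def)
      moreover have "set zs = set xs - {x\<in>set (drop k xs). gone x}" using zs ys dk True by auto
      moreover have "k \<le> length zs" "length zs \<le> length xs" using ys zs(1) by auto
      moreover have "regs (exec N n A ?body s') r = (if r = 9 then k else if r = size_reg f then length ys - 1
          else if r = 14 then 1 else if r = 11 then xs ! k else regs s' r)" for r
        unfolding eq s1_def using True by simp
      moreover have "size_reg f \<in> {3, 4}" by (simp add: size_reg_def)
      ultimately show ?thesis using I that zs(2) unfolding I_def
        by (intro conjI exI[of _ zs]) (auto simp del: exec.simps)
    qed
    show "refines N n A ?body s' (return_pmf ()) (\<lambda>_ t'. I k (t + t' + 2))"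
      by (rule refines_loopfree) (use I' in \<open>auto simp: cmp_def decr_def simp del: exec.simps\<close>)
  next
    fix k b u t' s'
    assume I: "I k u s'" "k = 0 \<or> \<not> True" "0 + t' = u + 1"
    then obtain ys where ys: "holds_array n f ys s'" "distinct ys" "set ys = {x\<in>set xs. \<not> gone x}"
      by (auto simp: I_def)
    \<comment> \<open>The pivot does not exceed itself, so its own row survives and the array stays
      nonempty.\<close>
    have "fst p \<in> set ys" using ys s by (auto simp: gone_def)
    then have "proper n ys" using ys xs by (auto simp: proper_def)
    then show "?Q t0 t' s'" using I ys t0 by (auto simp: I_def gone_def)
  qed
  then show "refines N n A (While (Reg 9) ?body) (exec N n A (Assign 9 (Reg (size_reg f))) s) (return_pmf ())
     (\<lambda>_ t s'. ?Q t0 t s')"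
    unfolding ex loop_pmf_return .
qed simp

text \<open>Entries of a column are distinct, so besides the rows below the pivot only its own row
  survives. Sizes minus one are what is halved, so that iterated integer halving ends with a single
  row.\<close>

lemma survivors:
  assumes "valid p" "p \<in> set xs \<times> set cs" "set ys = {x\<in>set xs. \<not> val p < B x (snd p)}" "distinct ys"
  shows "2 * (length ys - 1) \<le> length xs - 1"
proof -
  have "set ys \<subseteq> insert (fst p) {x\<in>set xs. B x (snd p) < val p}"
  proof
    fix x assume x: "x \<in> set ys"
    then have "x = fst p" if "B x (snd p) = val p"
      using that inj[of "snd p"] assms by (auto dest: inj_onD)
    then show "x \<in> insert (fst p) {x\<in>set xs. B x (snd p) < val p}" using x assms by force
  qed
  then have "card (set ys) \<le> card (insert (fst p) {x\<in>set xs. B x (snd p) < val p})"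
    by (intro card_mono) auto
  also have "\<dots> \<le> Suc (below (fst p) (snd p))" unfolding below_def by (rule card_insert_le_m1) auto
  finally have "length ys \<le> Suc (below (fst p) (snd p))" using assms(4) by (simp add: distinct_card)
  moreover have "card (set xs) = length xs" using xs by (simp add: proper_def distinct_card)
  ultimately show ?thesis using assms(1) by (simp add: valid_def)
qed

text \<open>The extremal conditions refer to the whole matrix, hence they apply to any surviving row
  \<open>r\<close> and to the column of the pivot. With \<open>f\<close> the two conditions swap
  roles.\<close>

lemma saddle_survives:
  assumes "strict_saddlepoint n A i j" "\<forall>j\<in>set cs. \<exists>r\<in>set xs. B r j \<le> val p" "p \<in> set xs \<times> set cs"
    "(if f then i else j) \<in> set cs"
  shows "\<not> val p < B (if f then j else i) (snd p)"
proof
  assume *: "val p < B (if f then j else i) (snd p)"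
  obtain r where r: "r \<in> set xs" "B r (if f then i else j) \<le> val p" using assms by blast
  have "r < n" "snd p < n" using r xs_less cs_less assms(3) by auto
  then have "A i j \<le> A r j" "A i r \<le> A i j" "A i (snd p) \<le> A i j" "A i j \<le> A (snd p) j"
    using assms(1) unfolding strict_saddlepoint_def by (metis order.refl less_imp_le)+
  then show False using * r(2) by (auto simp: flipped_def split: if_splits)
qed

end

text \<open>The form of \<open>whp_Seq\<close> used from here on: the case of a failed first part is
  settled once, by \<open>whp_trivial\<close>.\<close>

lemma whp_seq:
  assumes "whp N n A c s e1 Q1 Q1'" "0 \<le> e1" "0 \<le> e2"
    "\<And>s'. Q1 s' \<Longrightarrow> whp N n A d s' e2 (P s') (P' s')"
    "\<And>s' s''. Q1 s' \<Longrightarrow> P s' s'' \<Longrightarrow> Q2 s''"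
    "\<And>t s' t' s''. Q1 s' \<Longrightarrow> Q1' t s' \<Longrightarrow> P s' s'' \<Longrightarrow> P' s' t' s'' \<Longrightarrow> Q2' (t + 1 + t') s''"
  shows "whp N n A (Seq c d) s (e1 + e2) Q2 Q2'"
proof (rule whp_Seq[OF assms(1-3)])
  fix t s' assume "Q1 s'"
  show "whp N n A d s' (e2 + of_bool (\<not> Q1' t s')) Q2 (\<lambda>t'. Q2' (t + 1 + t'))"
  proof (cases "Q1' t s'")
    case True
    then show ?thesis
      using whp_mono[OF assms(4)[OF \<open>Q1 s'\<close>]] assms(5,6) \<open>Q1 s'\<close> by simp
  next
    case False
    have "whp N n A d s' (e2 + of_bool (\<not> Q1' t s')) (P s') (\<lambda>t'. Q2' (t + 1 + t'))"
      by (rule whp_trivial[OF assms(4)[OF \<open>Q1 s'\<close>]]) (use False assms(3) in auto)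
    then show ?thesis by (rule whp_mono) (use assms(5) \<open>Q1 s'\<close> in auto)
  qed
qed

lemma whp_loopfree:
  assumes "loopfree c" "Q (exec N n A c s)" "\<And>t. t \<le> weight c \<Longrightarrow> Q' t (exec N n A c s)"
  shows "whp N n A c s 0 Q Q'"
  by (rule whp_refines_return, rule refines_loopfree) (use assms in auto)

section \<open>The whole algorithm\<close>

definition round_code :: com where
  "round_code = reduce_code False ;; reduce_code True ;; Assign 6 (Div (Reg 6) (Num 2))"

locale saddle_search =
  fixes n N :: nat and A :: "nat \<Rightarrow> nat \<Rightarrow> int" and d :: nat
  assumes N: "N = (n + 2) ^ 4" and dist: "distinct_entries n A"
    and d: "1 \<le> d" "d ^ 4 \<le> n" "n < (d + 1) ^ 4"
begin

definition inv :: "state \<Rightarrow> bool" where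
  "inv s \<longleftrightarrow> regs s 0 = n \<and> regs s 5 = d \<and> (\<exists>xs cs. proper n xs \<and> proper n cs \<and>
     holds_array n False xs s \<and> holds_array n True cs s \<and>
     (\<forall>i j. strict_saddlepoint n A i j \<longrightarrow> i \<in> set xs \<and> j \<in> set cs))"

text \<open>The error of \<open>pivot_search\<close> with \<open>n\<close> in place of the number of
  remaining columns, so that it is the same for every reduction.\<close>

definition err :: real where
  "err = (real (d * d) + 2 + n) * (99 / 100) ^ d"

lemma dd: "d * d \<le> n"
proof -
  have "d ^ 2 \<le> d ^ 4" using d by (intro power_increasing) auto
  then show ?thesis using d by (simp add: power2_eq_square)
qed

lemma err_nonneg: "0 \<le> err"
  by (simp add: err_def)

lemma reduce_whp:
  assumes "inv s"
  shows "whp N n A (reduce_code f) s err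
    (\<lambda>s'. inv s' \<and> regs s' 6 = regs s 6 \<and> regs s' (size_reg f) \<le> regs s (size_reg f) \<and>
       regs s' (size_reg (\<not> f)) = regs s (size_reg (\<not> f)))
    (\<lambda>t s'. 2 * (regs s' (size_reg f) - 1) \<le> regs s (size_reg f) - 1 \<and>
       t \<le> 300 * (regs s (size_reg f) + regs s (size_reg (\<not> f)) + d ^ 3))"
    (is "whp _ _ _ _ _ _ ?Q ?Q'")
proof -
  obtain rows cols where rc: "proper n rows" "proper n cols"
     "holds_array n False rows s" "holds_array n True cols s"
     "\<And>i j. strict_saddlepoint n A i j \<Longrightarrow> i \<in> set rows \<and> j \<in> set cols"
    using assms by (auto simp: inv_def)
  define xs where "xs = (if f then cols else rows)"
  define cs where "cs = (if f then rows else cols)"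
  define z where "z = regs s 6"
  interpret reduction n N A d f xs cs z
    by unfold_locales (use N dist d dd rc in \<open>auto simp: xs_def cs_def\<close>)
  have env: "env s" unfolding env_def
    using assms[unfolded inv_def] rc(3,4) by (cases f) (simp_all add: xs_def cs_def z_def)
  have len: "1 \<le> length xs" "1 \<le> length cs" "length cs = card (set cs)" "length cs \<le> n"
    using proper_length[OF xs] proper_length[OF cs] cs by (auto simp: proper_def distinct_card)
  have size: "regs s (size_reg f) = length xs" "regs s (size_reg (\<not> f)) = length cs"
    using env by (auto simp: env_regs)
  have post: "?Q s'"
    if "regs s' 0 = n" "regs s' 5 = d" "regs s' 6 = z" "holds_array n (\<not> f) cs s'"
      "proper n ys" "holds_array n f ys s'" "set ys = {x\<in>set xs. \<not> val p < B x (snd p)}"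
      "p \<in> set xs \<times> set cs" "\<forall>j\<in>set cs. \<exists>r\<in>set xs. B r j \<le> val p" for s' ys p
  proof -
    have "length ys \<le> length xs"
    proof -
      have "set ys \<subseteq> set xs" using that(7) by auto
      then have "card (set ys) \<le> card (set xs)" by (intro card_mono) auto
      then show ?thesis using that(5) xs by (simp add: proper_def distinct_card)
    qed
    moreover have "(if f then j else i) \<in> set ys \<and> (if f then i else j) \<in> set cs"
      if "strict_saddlepoint n A i j" for i j
      using saddle_survives[OF that \<open>\<forall>j\<in>set cs. _\<close> \<open>p \<in> _\<close>] rc(5)[OF that] \<open>set ys = _\<close>
      by (auto simp: xs_def cs_def)
    then have "inv s'" using that cs
      unfolding inv_def by (cases f) (auto 4 4 simp del: not_less)
    ultimately show ?thesis using that size by (auto simp: z_def holds_array_def)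
  qed
  have 1: "whp N n A (column_min_code f) s 0
     (\<lambda>s'. env s' \<and> (regs s' 7, regs s' 8) \<in> set xs \<times> set cs \<and> valid (regs s' 7, regs s' 8))
     (\<lambda>t s'. t \<le> 14 * length xs + 7)"
    by (rule whp_refines_return, rule refines_mono[OF column_min_refines[OF env]]) auto
  have 2: "whp N n A (trials_code f ;; pass_code f ;; delete_code f) s1 err ?Q
      (\<lambda>t s'. 2 * (regs s' (size_reg f) - 1) \<le> length xs - 1 \<and>
         t \<le> d * d * (11 * d + 27) + 3 + (17 * (13 * length cs + d) + 22 * length cs + 3) + 13 * length xs + 5)"
    if s1: "env s1 \<and> (regs s1 7, regs s1 8) \<in> set xs \<times> set cs \<and> valid (regs s1 7, regs s1 8)" for s1
  proof -
    define p where "p = (regs s1 7, regs s1 8)"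
    have p: "p \<in> set xs \<times> set cs" "valid p" using s1 by (auto simp: p_def)
    define D where "D = trials p \<bind> pass cs"
    have D: "fst y \<in> set xs \<times> set cs" "\<forall>j\<in>set cs. \<exists>r\<in>set xs. B r j \<le> val (fst y)" if "y \<in> set_pmf D" for y
      using that pass_support[of y cs] trials_support[OF _ p(1)] by (auto simp: D_def)
    let ?R = "\<lambda>y t s'. t \<le> d * d * (11 * d + 27) + 3 + (17 * snd y + 22 * length cs + 3) + 13 * length xs + 5 \<and>
       regs s' 0 = n \<and> regs s' 5 = d \<and> regs s' 6 = z \<and> holds_array n (\<not> f) cs s' \<and>
       (\<exists>ys. proper n ys \<and> holds_array n f ys s' \<and> set ys = {x\<in>set xs. \<not> val (fst y) < B x (snd (fst y))})"
    have "refines N n A (trials_code f ;; pass_code f ;; delete_code f) s1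
        (trials p \<bind> (\<lambda>p'. pass cs p' \<bind> (\<lambda>y. return_pmf y))) ?R"
    proof (rule refines_Seq[OF trials_refines[of s1 p]])
      fix p' t1 s2
      assume p': "p' \<in> set_pmf (trials p)"
        and 3: "t1 \<le> d * d * (11 * d + 27) + 3 \<and> env s2 \<and> (regs s2 7, regs s2 8) = p'"
      have p'': "p' \<in> set xs \<times> set cs" using trials_support[OF p' p(1)] by simp
      show "refines N n A (pass_code f ;; delete_code f) s2 (pass cs p' \<bind> (\<lambda>y. return_pmf y))
         (\<lambda>y t. ?R y (t1 + 1 + t))"
      proof (rule refines_Seq[OF pass_refines[of s2 p']])
        fix y t2 s3
        assume y: "y \<in> set_pmf (pass cs p')"
          and 4: "t2 \<le> 17 * snd y + 22 * length cs + 3 \<and> env s3 \<and> (regs s3 7, regs s3 8) = fst y"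
        have "fst y \<in> set xs \<times> set cs" using pass_support[OF y p''] by simp
        then show "refines N n A (delete_code f) s3 (return_pmf y) (\<lambda>y t. ?R y (t1 + 1 + (t2 + 1 + t)))"
          using 3 4 by (intro refines_const[OF delete_refines[of s3 "fst y"]]) auto
      qed (use 3 p'' in auto)
    qed (use s1 p in \<open>auto simp: p_def\<close>)
    then have refines: "refines N n A (trials_code f ;; pass_code f ;; delete_code f) s1 D ?R"
      by (simp add: D_def bind_return_pmf')
    have Q: "?Q s'" if y: "y \<in> set_pmf D" "?R y t s'" for y t s'
    proof -
      obtain ys where "proper n ys" "holds_array n f ys s'"
          "set ys = {x\<in>set xs. \<not> val (fst y) < B x (snd (fst y))}" using y(2) by auto
      from post[OF _ _ _ _ this D[OF y(1)]] y(2) show ?thesis by simp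
    qed
    show ?thesis
    proof (cases "(99 / 100) ^ d \<le> (1 / 2 :: real)")
      case True
      show ?thesis
      proof (rule whp_refines[OF refines, where Q = ?Q and
            good = "\<lambda>y. valid (fst y) \<and> snd y \<le> 13 * card (set cs) + d"])
        show "?Q s'" if "y \<in> set_pmf D" "?R y t s'" for y t s' by (rule Q[OF that])
        show "expect_le D (\<lambda>y. of_bool (\<not> (valid (fst y) \<and> snd y \<le> 13 * card (set cs) + d))) err"
          unfolding D_def
          by (rule expect_le_mono[OF pivot_search[OF p(2,1) refl _ True]])
            (use cs len in \<open>auto simp: proper_def err_def intro!: mult_right_mono\<close>)
        fix y t s'
        assume y: "y \<in> set_pmf D" "valid (fst y) \<and> snd y \<le> 13 * card (set cs) + d" "?R y t s'"
        then obtain ys where ys: "proper n ys" "holds_array n f ys s'"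
            "set ys = {x\<in>set xs. \<not> val (fst y) < B x (snd (fst y))}" by auto
        have "2 * (length ys - 1) \<le> length xs - 1"
          using survivors[of "fst y" ys] y D ys by (auto simp: proper_def)
        then show "2 * (regs s' (size_reg f) - 1) \<le> length xs - 1 \<and>
            t \<le> d * d * (11 * d + 27) + 3 + (17 * (13 * length cs + d) + 22 * length cs + 3) + 13 * length xs + 5"
          using y ys(2) len by (auto simp: holds_array_def)
      qed
    next
      case False
      \<comment> \<open>For small \<open>d\<close> the tail bounds say nothing, but then
        \<open>err\<close> is at least 1 and only the sure postcondition has to be shown.\<close>
      have "2 * (1 / 2 :: real) \<le> err" unfolding err_def
        using False by (intro mult_mono) auto
      then have "1 \<le> err" by simp
      have "whp N n A (trials_code f ;; pass_code f ;; delete_code f) s1 1 ?Q (\<lambda>_ _. True)"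
      proof (rule whp_refines[OF refines, where Q = ?Q and good = "\<lambda>_. True"])
        show "?Q s'" if "y \<in> set_pmf D" "?R y t s'" for y t s' by (rule Q[OF that])
        show "expect_le D (\<lambda>_. of_bool (\<not> True)) 1" by (rule expect_le_mono[OF expect_le_const[of _ 1]]) auto
      qed
      then show ?thesis by (rule whp_trivial) (use \<open>1 \<le> err\<close> in auto)
    qed
  qed
  have "whp N n A (reduce_code f) s (0 + err) ?Q ?Q'"
    unfolding reduce_code_def
  proof (rule whp_seq[OF 1 _ _ 2])
    define W where "W = d * d * (11 * d + 27)"
    have "d * d * 1 \<le> d * d * d" "d * 1 \<le> d * (d * d)" using d by (intro mult_le_mono; simp)+
    then have dle: "d * d * (11 * d + 27) \<le> 38 * d ^ 3" "d \<le> d ^ 3" "1 \<le> d ^ 3"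
      using d(1) by (auto simp: algebra_simps power3_eq_cube)
    fix t t' s''
    assume t: "t \<le> 14 * length xs + 7"
      and t': "2 * (regs s'' (size_reg f) - 1) \<le> length xs - 1 \<and>
         t' \<le> d * d * (11 * d + 27) + 3 + (17 * (13 * length cs + d) + 22 * length cs + 3) + 13 * length xs + 5"
    define D where "D = d ^ 3"
    \<comment> \<open>The coefficients add up to 27 for \<open>length xs\<close>, 243 for
      \<open>length cs\<close> and 55 for \<open>D\<close>; 300 also absorbs the constants.\<close>
    have "t + 1 + t' \<le> 300 * (length xs + length cs + D)"
      using t conjunct2[OF t', folded W_def] dle[folded W_def D_def] len(1,2) by simp
    then have "t + 1 + t' \<le> 300 * (length xs + length cs + d ^ 3)" by (simp only: D_def)
    then show "2 * (regs s'' (size_reg f) - 1) \<le> regs s (size_reg f) - 1 \<and>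
       t + 1 + t' \<le> 300 * (regs s (size_reg f) + regs s (size_reg (\<not> f)) + d ^ 3)"
      unfolding size using t' by simp
  qed (use err_nonneg in auto)
  then show ?thesis by simp
qed

text \<open>
  Register 6 is halved in every round, and so is the number of rows and columns minus one.
\<close>

definition small :: "state \<Rightarrow> bool" where
  "small s \<longleftrightarrow> regs s 3 - 1 \<le> regs s 6 \<and> regs s 4 - 1 \<le> regs s 6"

lemma round_whp:
  assumes "inv s"
  shows "whp N n A round_code s (2 * err)
    (\<lambda>s'. inv s' \<and> regs s' 6 = regs s 6 div 2)
    (\<lambda>t s'. small s \<longrightarrow> small s' \<and> t \<le> 1200 * regs s 6 + 600 * d ^ 3 + 1203)"
proof -
  have N2: "2 mod N = 2" "1 < N"
  proof -
    have "2 ^ 4 \<le> (n + 2) ^ 4" by (intro power_mono) auto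
    then show "2 mod N = 2" "1 < N" by (auto simp: N)
  qed
  have asg: "whp N n A (Assign 6 (Div (Reg 6) (Num 2))) s 0
     (\<lambda>s'. inv s' \<and> regs s' 6 = regs s 6 div 2 \<and> regs s' 3 = regs s 3 \<and> regs s' 4 = regs s 4) (\<lambda>t s'. t \<le> 1)"
    if "inv s" for s
    by (rule whp_loopfree) (use that N2 in \<open>auto simp: inv_def holds_array_def size_reg_def\<close>)
  have two: "whp N n A (reduce_code True ;; Assign 6 (Div (Reg 6) (Num 2))) s (err + 0)
    (\<lambda>s'. inv s' \<and> regs s' 6 = regs s 6 div 2 \<and> regs s' 3 = regs s 3)
    (\<lambda>t s'. 2 * (regs s' 4 - 1) \<le> regs s 4 - 1 \<and> t \<le> 300 * (regs s 4 + regs s 3 + d ^ 3) + 2)"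
    if "inv s" for s
    by (rule whp_seq[OF reduce_whp[OF that] _ _ asg]) (use err_nonneg in \<open>auto simp: size_reg_def\<close>)
  have "whp N n A round_code s (err + (err + 0))
    (\<lambda>s'. inv s' \<and> regs s' 6 = regs s 6 div 2)
    (\<lambda>t s'. small s \<longrightarrow> small s' \<and> t \<le> 1200 * regs s 6 + 600 * d ^ 3 + 1203)"
    unfolding round_code_def
  proof (rule whp_seq[OF reduce_whp[OF assms] _ _ two])
    fix t s' t' s''
    assume 1: "inv s' \<and> regs s' 6 = regs s 6 \<and> regs s' (size_reg False) \<le> regs s (size_reg False) \<and>
         regs s' (size_reg (\<not> False)) = regs s (size_reg (\<not> False))"
      "2 * (regs s' (size_reg False) - 1) \<le> regs s (size_reg False) - 1 \<and>
         t \<le> 300 * (regs s (size_reg False) + regs s (size_reg (\<not> False)) + d ^ 3)"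
      "inv s'' \<and> regs s'' 6 = regs s' 6 div 2 \<and> regs s'' 3 = regs s' 3"
      "2 * (regs s'' 4 - 1) \<le> regs s' 4 - 1 \<and> t' \<le> 300 * (regs s' 4 + regs s' 3 + d ^ 3) + 2"
    \<comment> \<open>Both sizes are at most register 6 plus 1 throughout, so each reduction costs
      at most \<open>300 * (2 * regs s 6 + 2 + d ^ 3)\<close>.\<close>
    show "small s \<longrightarrow> small s'' \<and> t + 1 + t' \<le> 1200 * regs s 6 + 600 * d ^ 3 + 1203"
      using 1 by (auto simp: small_def size_reg_def)
  qed (use err_nonneg in auto)
  then show ?thesis by simp
qed

text \<open>Register 6 alone decides the number of rounds. As it is halved each time, the terms
  \<open>1200 * regs s 6\<close> sum to at most twice the first one; 1205 is 1203 plus 2 steps of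
  the loop.\<close>

lemma loop_whp:
  assumes "inv s" "regs s 6 < 2 ^ l"
  shows "whp N n A (While (Reg 6) round_code) s (l * (2 * err)) inv
    (\<lambda>t s'. small s \<longrightarrow> regs s' 3 \<le> 1 \<and> regs s' 4 \<le> 1 \<and>
       t \<le> 1 + 2400 * regs s 6 + l * (600 * d ^ 3 + 1205))"
  using assms
proof (induction l arbitrary: s)
  case 0
  then have "regs s 6 = 0" by simp
  have "refines N n A (While (Reg 6) round_code) s (return_pmf ())
      (\<lambda>_ t s'. t = 1 \<and> s' = s)"
    by (rule refines_step[OF _ step.simps(8)]) (auto simp: \<open>regs s 6 = 0\<close> intro!: refines_Skip)
  then have "whp N n A (While (Reg 6) round_code) s 0 inv
    (\<lambda>t s'. small s \<longrightarrow> regs s' 3 \<le> 1 \<and> regs s' 4 \<le> 1 \<and> t \<le> 1)"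
    by (intro whp_refines_return) (auto elim!: refines_mono simp: 0 small_def \<open>regs s 6 = 0\<close>)
  then show ?case using \<open>regs s 6 = 0\<close> by simp
next
  case (Suc l)
  show ?case
  proof (cases "regs s 6 = 0")
    case True
    then have "whp N n A (While (Reg 6) round_code) s (l * (2 * err)) inv
    (\<lambda>t s'. small s \<longrightarrow> regs s' 3 \<le> 1 \<and> regs s' 4 \<le> 1 \<and>
       t \<le> 1 + 2400 * regs s 6 + l * (600 * d ^ 3 + 1205))"
      using Suc by (intro Suc.IH) auto
    then show ?thesis
      by (rule whp_mono) (use err_nonneg in \<open>auto simp: algebra_simps\<close>)
  next
    case False
    have "whp N n A (round_code ;; While (Reg 6) round_code) s (2 * err + l * (2 * err)) inv
      (\<lambda>t s'. small s \<longrightarrow> regs s' 3 \<le> 1 \<and> regs s' 4 \<le> 1 \<and>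
       Suc t \<le> 1 + 2400 * regs s 6 + Suc l * (600 * d ^ 3 + 1205))"
    proof (rule whp_seq[OF round_whp[OF Suc.prems(1)]])
      fix s' assume "inv s' \<and> regs s' 6 = regs s 6 div 2"
      then show "whp N n A (While (Reg 6) round_code) s' (l * (2 * err)) inv
        (\<lambda>t s''. small s' \<longrightarrow> regs s'' 3 \<le> 1 \<and> regs s'' 4 \<le> 1 \<and>
         t \<le> 1 + 2400 * regs s' 6 + l * (600 * d ^ 3 + 1205))"
        using Suc by (intro Suc.IH) auto
    qed (use err_nonneg in auto)
    then have "whp N n A (While (Reg 6) round_code) s (2 * err + l * (2 * err)) inv
      (\<lambda>t s'. small s \<longrightarrow> regs s' 3 \<le> 1 \<and> regs s' 4 \<le> 1 \<and>
       t \<le> 1 + 2400 * regs s 6 + Suc l * (600 * d ^ 3 + 1205))"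
      using False by (intro whp_step[OF _ step.simps(8)]) auto
    then show ?thesis by (simp add: algebra_simps)
  qed
qed

end

section \<open>Exhaustive verification and initialisation\<close>

definition verify_code :: com where
  "verify_code = (Assign 13 (Num 1) ;; Assign 15 (Reg 0)) ;;
     While (Reg 15)
       (decr 15 ;;
        Compare 14 (Reg 15) (Reg 12) (Reg 11) (Reg 12) ;;
        Cond (Reg 14) (Assign 13 (Num 0)) Skip ;;
        Compare 14 (Reg 11) (Reg 12) (Reg 11) (Reg 15) ;;
        Cond (Reg 14) (Assign 13 (Num 0)) Skip)"

definition search_row_code :: com where
  "search_row_code = While (Reg 10)
     (Assign 12 (Load (Add (base True) (Reg 10))) ;;
      verify_code ;;
      (Cond (Reg 13) (Assign 6 (Num 1) ;; Assign 1 (Reg 11) ;; Assign 2 (Reg 12)) Skip ;; decr 10))"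

text \<open>Tests every remaining pair, since after unlucky rounds there may be many and the answer
  must still be right. After lucky rounds there is at most one pair, and the cost is linear.\<close>

definition search_code :: com where
  "search_code = (Assign 6 (Num 0) ;; Assign 9 (Reg 3)) ;;
     While (Reg 9)
       ((Assign 11 (Load (Add (base False) (Reg 9))) ;; Assign 10 (Reg 4)) ;;
        search_row_code ;;
        decr 9) ;;
     Assign 0 (Reg 6)"

text \<open>The largest power formed is \<open>(d + 1) ^ 4\<close>, which is below
  \<open>(n + 2) ^ 4\<close> because \<open>d \<le> n\<close>. This explains the exponent 4 of the
  word modulus.\<close>

definition root_code :: com where
  "root_code = (let e = Add (Reg 5) (Num 1) in
     While (Less (Mul (Mul e e) (Mul e e)) (Add (Reg 0) (Num 1))) (Assign 5 e))"

definition fill_code :: com where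
  "fill_code = Assign 9 (Reg 0) ;;
     While (Reg 9)
       (Store (Reg 9) (Sub (Reg 9) (Num 1)) ;;
        Store (Add (Reg 0) (Reg 9)) (Sub (Reg 9) (Num 1)) ;;
        decr 9)"

definition init_code :: com where
  "init_code = root_code ;; fill_code ;; (Assign 3 (Reg 0) ;; Assign 4 (Reg 0) ;; Assign 6 (Reg 0))"

definition saddle_code :: com where
  "saddle_code = init_code ;; While (Reg 6) round_code ;; search_code"

context saddle_search
begin

lemma n_pos: "1 \<le> n"
  using d one_le_power[of d 4] by linarith

lemma N_large: "3 * n + 3 < N" "(d + 1) ^ 4 < N"
proof -
  have "(n + 2) * 8 \<le> (n + 2) * (n + 2) ^ 3"
    using power_mono[of 2 "n + 2" 3] by (intro mult_left_mono) auto
  then have "8 * n + 16 \<le> N" unfolding N by (simp add: power_numeral_reduce)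
  then show "3 * n + 3 < N" by auto
  have "d \<le> n" using dd by (cases d) auto
  then show "(d + 1) ^ 4 < N" unfolding N by (intro power_strict_mono) auto
qed

lemma mod_N [simp]: "n mod N = n" "1 mod N = 1" "Suc 0 mod N = Suc 0" "0 mod N = 0"
  "N \<noteq> Suc 0" "N \<noteq> 1"
  using N_large by auto

lemma decr_exec [simp]: "exec N n A (decr r) s = set_reg r (regs s r - 1) s"
  by (simp add: decr_def)

text \<open>For distinct entries a strict inequality is the failure of the reverse one, and that
  failure also holds at \<open>u = i\<close> and \<open>u = j\<close>. So the verification loop
  needs no tests on indices.\<close>

lemma saddle_iff:
  assumes "i < n" "j < n"
  shows "strict_saddlepoint n A i j \<longleftrightarrow> (\<forall>u<n. \<not> A u j < A i j \<and> \<not> A i j < A i u)"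
proof -
  have "A i j \<noteq> A u j" if "u < n" "u \<noteq> i" for u
    using dist assms that by (auto simp: distinct_entries_def inj_on_def)
  moreover have "A i u \<noteq> A i j" if "u < n" "u \<noteq> j" for u
    using dist assms that by (auto simp: distinct_entries_def inj_on_def)
  ultimately show ?thesis using assms
    by (auto simp: strict_saddlepoint_def not_less) (metis order.refl less_imp_le le_neq_trans)+
qed

lemma verify_refines:
  assumes s: "regs s 0 = n" "regs s 11 < n" "regs s 12 < n"
  shows "refines N n A verify_code s (return_pmf ())
    (\<lambda>_ t s'. t \<le> 20 * n + 5 \<and> mem s' = mem s \<and> (\<forall>r. r \<notin> {13, 14, 15} \<longrightarrow> regs s' r = regs s r) \<and>
       (regs s' 13 \<noteq> 0 \<longleftrightarrow> strict_saddlepoint n A (regs s 11) (regs s 12)))"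
  unfolding verify_code_def
proof (rule refines_Seq_loopfree)
  let ?i = "regs s 11" and ?j = "regs s 12"
  let ?init = "Assign 13 (Num 1) ;; Assign 15 (Reg 0)"
  let ?body = "decr 15 ;; Compare 14 (Reg 15) (Reg 12) (Reg 11) (Reg 12) ;;
        Cond (Reg 14) (Assign 13 (Num 0)) Skip ;;
        Compare 14 (Reg 11) (Reg 12) (Reg 11) (Reg 15) ;;
        Cond (Reg 14) (Assign 13 (Num 0)) Skip"
  fix t0 assume t0: "t0 \<le> weight ?init"
  have ex: "exec N n A ?init s = set_reg 15 n (set_reg 13 1 s)" using s by simp
  have "refines N n A (While (Reg 15) ?body) (set_reg 15 n (set_reg 13 1 s))
     (loop_pmf (\<lambda>_. True) (\<lambda>_ _. return_pmf ()) n ())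
     (\<lambda>_ t s'. t0 + 1 + t \<le> 20 * n + 5 \<and> mem s' = mem s \<and> (\<forall>r. r \<notin> {13, 14, 15} \<longrightarrow> regs s' r = regs s r) \<and>
       (regs s' 13 \<noteq> 0 \<longleftrightarrow> strict_saddlepoint n A ?i ?j))"
  proof (rule refines_While[where t = 0 and I = "\<lambda>k _ t s'. t + 20 * k \<le> 20 * n \<and> k \<le> n \<and> regs s' 15 = k \<and>
       mem s' = mem s \<and> (\<forall>r. r \<notin> {13, 14, 15} \<longrightarrow> regs s' r = regs s r) \<and>
       (regs s' 13 \<noteq> 0 \<longleftrightarrow> (\<forall>u. k \<le> u \<and> u < n \<longrightarrow> \<not> A u ?j < A ?i ?j \<and> \<not> A ?i ?j < A ?i u))"])
    fix k t and b :: unit and s' :: state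
    assume I: "t + 20 * Suc k \<le> 20 * n \<and> Suc k \<le> n \<and> regs s' 15 = Suc k \<and>
       mem s' = mem s \<and> (\<forall>r. r \<notin> {13, 14, 15} \<longrightarrow> regs s' r = regs s r) \<and>
       (regs s' 13 \<noteq> 0 \<longleftrightarrow> (\<forall>u. Suc k \<le> u \<and> u < n \<longrightarrow> \<not> A u ?j < A ?i ?j \<and> \<not> A ?i ?j < A ?i u))"
    have all: "(\<forall>u. k \<le> u \<and> u < n \<longrightarrow> P u) \<longleftrightarrow> P k \<and> (\<forall>u. Suc k \<le> u \<and> u < n \<longrightarrow> P u)" for P
      using I by (metis Suc_leD Suc_leI le_neq_implies_less le_refl Suc_le_lessD)
    define ok where "ok \<longleftrightarrow> (\<forall>u. Suc k \<le> u \<and> u < n \<longrightarrow> \<not> A u ?j < A ?i ?j \<and> \<not> A ?i ?j < A ?i u)"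
    have I2: "t + 20 * Suc k \<le> 20 * n" "k < n" "regs s' 15 = Suc k" "mem s' = mem s"
      "\<And>r. r \<noteq> 13 \<Longrightarrow> r \<noteq> 14 \<Longrightarrow> r \<noteq> 15 \<Longrightarrow> regs s' r = regs s r" "regs s' 13 \<noteq> 0 \<longleftrightarrow> ok"
      using I by (auto simp: ok_def)
    show "refines N n A ?body s' (return_pmf ()) (\<lambda>_ t' s''. t + t' + 2 + 20 * k \<le> 20 * n \<and> k \<le> n \<and> regs s'' 15 = k \<and>
       mem s'' = mem s \<and> (\<forall>r. r \<notin> {13, 14, 15} \<longrightarrow> regs s'' r = regs s r) \<and>
       (regs s'' 13 \<noteq> 0 \<longleftrightarrow> (\<forall>u. k \<le> u \<and> u < n \<longrightarrow> \<not> A u ?j < A ?i ?j \<and> \<not> A ?i ?j < A ?i u)))"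
      unfolding all ok_def[symmetric] using I2 s
      by (intro refines_loopfree) (auto simp: compare_entries_def)
  qed (use s t0 saddle_iff[OF s(2,3)] in auto)
  then show "refines N n A (While (Reg 15) ?body) (exec N n A ?init s) (return_pmf ())
     (\<lambda>_ t s'. t0 + 1 + t \<le> 20 * n + 5 \<and> mem s' = mem s \<and> (\<forall>r. r \<notin> {13, 14, 15} \<longrightarrow> regs s' r = regs s r) \<and>
       (regs s' 13 \<noteq> 0 \<longleftrightarrow> strict_saddlepoint n A ?i ?j))"
    unfolding ex loop_pmf_return .
qed simp

text \<open>After the rounds register 6 changes its role: it now flags that registers 1 and 2 hold a
  saddlepoint.\<close>

definition found :: "state \<Rightarrow> bool" where
  "found s \<longleftrightarrow> (regs s 6 \<noteq> 0 \<longrightarrow> strict_saddlepoint n A (regs s 1) (regs s 2))"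

lemma search_row_refines:
  assumes s: "regs s 0 = n" "regs s 11 < n" "regs s 10 = length cs" "found s"
    and cs: "proper n cs" "\<And>i. i < length cs \<Longrightarrow> mem s (n + Suc i) = cs ! i"
  shows "refines N n A search_row_code s (return_pmf ())
    (\<lambda>_ t s'. t \<le> length cs * (20 * n + 20) + 1 \<and> mem s' = mem s \<and>
       (\<forall>r. r \<in> {0, 3, 4, 5, 9, 11} \<longrightarrow> regs s' r = regs s r) \<and> found s' \<and>
       (regs s' 6 = 0 \<longrightarrow> regs s 6 = 0 \<and> (\<forall>j\<in>set cs. \<not> strict_saddlepoint n A (regs s 11) j)))"
proof -
  let ?T = "20 * n + 20"
  define I where "I k t s' \<longleftrightarrow> t + k * ?T \<le> length cs * ?T \<and> k \<le> length cs \<and> regs s' 10 = k \<and> mem s' = mem s \<and>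
       (\<forall>r. r \<in> {0, 3, 4, 5, 9, 11} \<longrightarrow> regs s' r = regs s r) \<and> found s' \<and>
       (regs s' 6 = 0 \<longrightarrow> regs s 6 = 0 \<and> (\<forall>i. k \<le> i \<and> i < length cs \<longrightarrow> \<not> strict_saddlepoint n A (regs s 11) (cs ! i)))"
    for k t s'
  have "refines N n A search_row_code s (loop_pmf (\<lambda>_. True) (\<lambda>_ _. return_pmf ()) (length cs) ())
    (\<lambda>_ t s'. t \<le> length cs * ?T + 1 \<and> mem s' = mem s \<and>
       (\<forall>r. r \<in> {0, 3, 4, 5, 9, 11} \<longrightarrow> regs s' r = regs s r) \<and> found s' \<and>
       (regs s' 6 = 0 \<longrightarrow> regs s 6 = 0 \<and> (\<forall>j\<in>set cs. \<not> strict_saddlepoint n A (regs s 11) j)))"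
    unfolding search_row_code_def
  proof (rule refines_While[where t = 0 and I = "\<lambda>k _. I k"])
    show "I (length cs) 0 s" using s by (auto simp: I_def)
  next
    fix k b t s'
    assume I: "I (Suc k) t s'"
    have "cs ! k \<in> set cs" using I by (simp add: I_def)
    then have ck: "cs ! k < n" using cs(1) by (auto simp: proper_def)
    define s1 where "s1 = set_reg 12 (cs ! k) s'"
    have len: "length cs \<le> n" using proper_length[OF cs(1)] by simp
    have ex: "exec N n A (Assign 12 (Load (Add (base True) (Reg 10)))) s' = s1"
    proof -
      have "(n + Suc k) mod N = n + Suc k" using len N_large I by (auto simp: I_def)
      then show ?thesis using I s cs(2)[of k] by (simp add: I_def s1_def base_def)
    qed
    have s1: "regs s1 0 = n" "regs s1 11 < n" "regs s1 12 = cs ! k" "regs s1 11 = regs s 11"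
      using I s by (auto simp: I_def s1_def)
    have "refines N n A (Assign 12 (Load (Add (base True) (Reg 10))) ;; verify_code ;;
      (Cond (Reg 13) (Assign 6 (Num 1) ;; Assign 1 (Reg 11) ;; Assign 2 (Reg 12)) Skip ;; decr 10)) s'
      (return_pmf () \<bind> (\<lambda>_. return_pmf ())) (\<lambda>_ t'. I k (t + t' + 2))"
    proof (rule refines_Seq_loopfree, simp, unfold ex, rule refines_Seq[OF verify_refines])
      fix t1 t2 and s2 :: state and b :: unit
      assume 1: "t1 \<le> weight (Assign 12 (Load (Add (base True) (Reg 10))))"
        and 2: "t2 \<le> 20 * n + 5 \<and> mem s2 = mem s1 \<and> (\<forall>r. r \<notin> {13, 14, 15} \<longrightarrow> regs s2 r = regs s1 r) \<and>
         (regs s2 13 \<noteq> 0 \<longleftrightarrow> strict_saddlepoint n A (regs s1 11) (regs s1 12))"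
      have r2: "regs s2 r = (if r = 12 then cs ! k else regs s' r)" if "r \<noteq> 13" "r \<noteq> 14" "r \<noteq> 15" for r
        using 2 that by (auto simp: s1_def)
      have sad: "regs s2 13 \<noteq> 0 \<longleftrightarrow> strict_saddlepoint n A (regs s 11) (cs ! k)" using 2 s1 by simp
      have all: "(\<forall>i. k \<le> i \<and> i < length cs \<longrightarrow> P i) \<longleftrightarrow> P k \<and> (\<forall>i. Suc k \<le> i \<and> i < length cs \<longrightarrow> P i)" for P
        using I unfolding I_def by (metis Suc_leD Suc_leI le_neq_implies_less le_refl Suc_le_lessD)
      show "refines N n A (Cond (Reg 13) (Assign 6 (Num 1) ;; Assign 1 (Reg 11) ;; Assign 2 (Reg 12)) Skip ;; decr 10) s2
         (return_pmf ()) (\<lambda>_ t'. I k (t + (t1 + 1 + (t2 + 1 + t')) + 2))"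
      proof (rule refines_loopfree)
        let ?c = "Cond (Reg 13) (Assign 6 (Num 1) ;; Assign 1 (Reg 11) ;; Assign 2 (Reg 12)) Skip ;; decr 10"
        fix t3 assume 3: "t3 \<le> weight ?c"
        have time: "t + (t1 + 1 + (t2 + 1 + t3)) + 2 + k * ?T \<le> length cs * ?T"
          using I 1 2 3 by (simp add: I_def)
        show "I k (t + (t1 + 1 + (t2 + 1 + t3)) + 2) (exec N n A ?c s2)"
        proof (cases "regs s2 13 = 0")
          case True
          then have "exec N n A ?c s2 = set_reg 10 k s2" using r2[of 10] I by (simp add: I_def)
          moreover have "\<not> strict_saddlepoint n A (regs s 11) (cs ! k)" using sad True by simp
          moreover have "mem s2 = mem s'" using 2 by (simp add: s1_def)
          ultimately show ?thesis using I time r2 unfolding I_def all found_def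
            by (simp del: exec.simps)
        next
          case False
          then have "exec N n A ?c s2 = set_reg 10 k (set_reg 2 (cs ! k) (set_reg 1 (regs s 11) (set_reg 6 1 s2)))"
            using r2[of 10] r2[of 11] r2[of 12] I by (simp add: I_def)
          moreover have "strict_saddlepoint n A (regs s 11) (cs ! k)" using sad False by simp
          moreover have "mem s2 = mem s'" using 2 by (simp add: s1_def)
          ultimately show ?thesis using I time r2 unfolding I_def all found_def
            by (simp del: exec.simps)
        qed
      qed simp
    qed (use s1 ck in auto)
    then show "refines N n A (Assign 12 (Load (Add (base True) (Reg 10))) ;; verify_code ;;
      (Cond (Reg 13) (Assign 6 (Num 1) ;; Assign 1 (Reg 11) ;; Assign 2 (Reg 12)) Skip ;; decr 10)) s'
      (return_pmf ()) (\<lambda>_ t'. I k (t + t' + 2))" by (simp add: bind_return_pmf)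
  qed (auto simp: I_def in_set_conv_nth)
  then show ?thesis unfolding loop_pmf_return .
qed

lemma search_refines:
  assumes "inv s"
  shows "refines N n A search_code s (return_pmf ())
    (\<lambda>_ t s'. correct_output n A (result s') \<and>
       t \<le> regs s 3 * (regs s 4 * (20 * n + 20) + 10) + 10)"
proof -
  obtain xs cs where rc: "proper n xs" "proper n cs"
     "holds_array n False xs s" "holds_array n True cs s"
     "\<And>i j. strict_saddlepoint n A i j \<Longrightarrow> i \<in> set xs \<and> j \<in> set cs"
    using assms by (auto simp: inv_def)
  have s: "regs s 0 = n" "regs s 3 = length xs" "regs s 4 = length cs"
    "\<And>i. i < length xs \<Longrightarrow> mem s (Suc i) = xs ! i" "\<And>i. i < length cs \<Longrightarrow> mem s (n + Suc i) = cs ! i"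
    using assms rc by (auto simp: inv_def holds_array_def size_reg_def offset_def)
  let ?T = "length cs * (20 * n + 20) + 10"
  let ?init = "Assign 6 (Num 0) ;; Assign 9 (Reg 3)"
  let ?load = "Assign 11 (Load (Add (base False) (Reg 9))) ;; Assign 10 (Reg 4)"
  define I where "I k t s' \<longleftrightarrow> t + k * ?T \<le> length xs * ?T \<and> k \<le> length xs \<and> regs s' 9 = k \<and> mem s' = mem s \<and>
       (\<forall>r. r \<in> {0, 3, 4, 5} \<longrightarrow> regs s' r = regs s r) \<and> found s' \<and>
       (regs s' 6 = 0 \<longrightarrow> (\<forall>i. k \<le> i \<and> i < length xs \<longrightarrow> (\<forall>j\<in>set cs. \<not> strict_saddlepoint n A (xs ! i) j)))"
    for k t s'
  have "refines N n A search_code s (loop_pmf (\<lambda>_. True) (\<lambda>_ _. return_pmf ()) (length xs) () \<bind> (\<lambda>_. return_pmf ()))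
    (\<lambda>_ t s'. correct_output n A (result s') \<and> t \<le> length xs * ?T + 10)"
    unfolding search_code_def
  proof (rule refines_Seq_loopfree)
    fix t0 assume t0: "t0 \<le> weight ?init"
    have ex: "exec N n A ?init s = set_reg 9 (length xs) (set_reg 6 0 s)" using s by simp
    show "refines N n A (While (Reg 9) (?load ;; search_row_code ;; decr 9) ;; Assign 0 (Reg 6))
       (exec N n A ?init s) (loop_pmf (\<lambda>_. True) (\<lambda>_ _. return_pmf ()) (length xs) () \<bind> (\<lambda>_. return_pmf ()))
       (\<lambda>_ t s'. correct_output n A (result s') \<and> t0 + 1 + t \<le> length xs * ?T + 10)"
      unfolding ex
    proof (rule refines_Seq)
      show "refines N n A (While (Reg 9) (?load ;; search_row_code ;; decr 9)) (set_reg 9 (length xs) (set_reg 6 0 s))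
         (loop_pmf (\<lambda>_. True) (\<lambda>_ _. return_pmf ()) (length xs) ()) (\<lambda>_ t s'. \<exists>u. t = u + 1 \<and> I 0 u s')"
      proof (rule refines_While[where t = 0 and I = "\<lambda>k _. I k"])
        show "I (length xs) 0 (set_reg 9 (length xs) (set_reg 6 0 s))" by (auto simp: I_def found_def)
      next
        fix k b t s'
        assume I: "I (Suc k) t s'"
        have "xs ! k \<in> set xs" using I by (simp add: I_def)
        then have xk: "xs ! k < n" using rc(1) by (auto simp: proper_def)
        have len: "length xs \<le> n" using proper_length[OF rc(1)] by simp
        define s1 where "s1 = set_reg 10 (length cs) (set_reg 11 (xs ! k) s')"
        have ex1: "exec N n A ?load s' = s1"
        proof -
          have "Suc k mod N = Suc k" using len N_large I by (auto simp: I_def)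
          then show ?thesis using I s(1-3) s(4)[of k] by (simp add: I_def s1_def base_def)
        qed
        have s1: "regs s1 11 = xs ! k" "regs s1 6 = regs s' 6" "mem s1 = mem s" "found s1 \<longleftrightarrow> found s'"
            "regs s1 0 = n" "regs s1 10 = length cs" "regs s1 9 = Suc k"
            "\<And>r. r \<in> {0, 3, 4, 5} \<Longrightarrow> regs s1 r = regs s r"
          using I s by (auto simp: s1_def I_def found_def)
        have all: "(\<forall>i. k \<le> i \<and> i < length xs \<longrightarrow> P i) \<longleftrightarrow> P k \<and> (\<forall>i. Suc k \<le> i \<and> i < length xs \<longrightarrow> P i)" for P
          using I unfolding I_def by (metis Suc_leD Suc_leI le_neq_implies_less le_refl Suc_le_lessD)
        have "refines N n A (?load ;; search_row_code ;; decr 9) s' (return_pmf () \<bind> (\<lambda>_. return_pmf ()))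
          (\<lambda>_ t'. I k (t + t' + 2))"
        proof (rule refines_Seq_loopfree, simp, unfold ex1, rule refines_Seq[OF search_row_refines[OF _ _ _ _ rc(2)]])
          fix t1 t2 and s2 :: state and b :: unit
          assume 1: "t1 \<le> weight ?load"
            and 2: "t2 \<le> length cs * (20 * n + 20) + 1 \<and> mem s2 = mem s1 \<and>
             (\<forall>r. r \<in> {0, 3, 4, 5, 9, 11} \<longrightarrow> regs s2 r = regs s1 r) \<and> found s2 \<and>
             (regs s2 6 = 0 \<longrightarrow> regs s1 6 = 0 \<and> (\<forall>j\<in>set cs. \<not> strict_saddlepoint n A (regs s1 11) j))"
          show "refines N n A (decr 9) s2 (return_pmf ()) (\<lambda>_ t'. I k (t + (t1 + 1 + (t2 + 1 + t')) + 2))"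
            using I 1 2 s1 unfolding I_def all
            by (intro refines_loopfree) (auto simp: found_def)
        qed (use I s1 xk s(5) in \<open>auto simp: I_def\<close>)
        then show "refines N n A (?load ;; search_row_code ;; decr 9) s' (return_pmf ())
          (\<lambda>_ t'. I k (t + t' + 2))" by (simp add: bind_return_pmf)
      qed (auto simp: I_def)
    next
      fix t1 s1 and b :: unit
      assume "\<exists>u. t1 = u + 1 \<and> I 0 u s1"
      then have I: "t1 \<le> length xs * ?T + 1" "found s1"
          "regs s1 6 = 0 \<longrightarrow> (\<forall>i<length xs. \<forall>j\<in>set cs. \<not> strict_saddlepoint n A (xs ! i) j)"
        by (auto simp: I_def)
      then have none: "regs s1 6 = 0 \<longrightarrow> (\<forall>i j. \<not> strict_saddlepoint n A i j)"
        using rc(5) by (metis in_set_conv_nth)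
      show "refines N n A (Assign 0 (Reg 6)) s1 (return_pmf ())
         (\<lambda>_ t s'. correct_output n A (result s') \<and> t0 + 1 + (t1 + 1 + t) \<le> length xs * ?T + 10)"
        using I(1,2) none t0 by (intro refines_loopfree) (auto simp: correct_output_def result_def found_def)
    qed
  qed simp
  then show ?thesis unfolding loop_pmf_return s(2,3) by (simp add: bind_return_pmf)
qed

lemma root_refines:
  "refines N n A root_code (init_state n) (return_pmf ())
    (\<lambda>_ t s'. t \<le> 3 * d + 1 \<and> regs s' 0 = n \<and> regs s' 5 = d)"
proof -
  define e where "e = Add (Reg 5) (Num 1)"
  have "refines N n A root_code (init_state n) (loop_pmf (\<lambda>_. True) (\<lambda>_ _. return_pmf ()) d ())
    (\<lambda>_ t s'. t \<le> 3 * d + 1 \<and> regs s' 0 = n \<and> regs s' 5 = d)"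
    unfolding root_code_def Let_def e_def[symmetric]
  proof (rule refines_While[where t = 0 and I = "\<lambda>k _ t s'. t + 3 * k \<le> 3 * d \<and> k \<le> d \<and> regs s' 0 = n \<and> regs s' 5 = d - k"])
    fix k t and b :: unit and s' :: state
    assume I: "t + 3 * k \<le> 3 * d \<and> k \<le> d \<and> regs s' 0 = n \<and> regs s' 5 = d - k"
    define x where "x = d - k + 1"
    have "x ^ 4 \<le> (d + 1) ^ 4" unfolding x_def by (intro power_mono) auto
    then have x4: "x ^ 4 < N" using N_large(2) by (rule le_less_trans)
    have "x ^ 1 \<le> x ^ 4" "x ^ 2 \<le> x ^ 4" by (intro power_increasing; simp add: x_def)+
    then have "x < N" "x * x < N" using x4 by (auto simp: power2_eq_square)
    then have "eval N s' e = x" using I by (simp add: e_def x_def)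
    then have ev: "eval N s' (Mul (Mul e e) (Mul e e)) = x ^ 4"
      using \<open>x * x < N\<close> x4 by (simp add: power4_eq_xxxx mult.assoc)
    have "eval N s' (Add (Reg 0) (Num 1)) = n + 1" using I N_large by simp
    moreover have "x ^ 4 < n + 1 \<longleftrightarrow> 0 < k"
    proof (cases "k = 0")
      case True
      then show ?thesis using d by (simp add: x_def)
    next
      case False
      then have "x ^ 4 \<le> d ^ 4" using I unfolding x_def by (intro power_mono) auto
      then have "x ^ 4 \<le> n" using d(2) by (rule order_trans)
      then show ?thesis using False by simp
    qed
    ultimately show "(eval N s' (Less (Mul (Mul e e) (Mul e e)) (Add (Reg 0) (Num 1))) \<noteq> 0) = (0 < k \<and> True)"
      using ev N_large by (simp del: eval.simps add: eval.simps(9))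
  next
    fix k t and b :: unit and s' :: state
    assume I: "t + 3 * Suc k \<le> 3 * d \<and> Suc k \<le> d \<and> regs s' 0 = n \<and> regs s' 5 = d - Suc k"
    have "d \<le> n" using dd by (cases d) auto
    then have "Suc (d - Suc k) mod N = d - k" using I N_large by auto
    then show "refines N n A (Assign 5 e) s' (return_pmf ())
       (\<lambda>_ t' s'. t + t' + 2 + 3 * k \<le> 3 * d \<and> k \<le> d \<and> regs s' 0 = n \<and> regs s' 5 = d - k)"
      using I by (intro refines_loopfree) (auto simp: e_def)
  qed (auto simp: init_state_def)
  then show ?thesis unfolding loop_pmf_return .
qed

lemma fill_refines:
  assumes s: "regs s 0 = n" "regs s 5 = d"
  shows "refines N n A fill_code s (return_pmf ())
    (\<lambda>_ t s'. t \<le> 7 * n + 3 \<and> regs s' 0 = n \<and> regs s' 5 = d \<and>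
       (\<forall>i<n. mem s' (Suc i) = i \<and> mem s' (n + Suc i) = i))"
  unfolding fill_code_def
proof (rule refines_Seq_loopfree)
  let ?body = "Store (Reg 9) (Sub (Reg 9) (Num 1)) ;; Store (Add (Reg 0) (Reg 9)) (Sub (Reg 9) (Num 1)) ;; decr 9"
  fix t0 assume t0: "t0 \<le> weight (Assign 9 (Reg 0))"
  have ex: "exec N n A (Assign 9 (Reg 0)) s = set_reg 9 n s" using s by simp
  have "refines N n A (While (Reg 9) ?body) (set_reg 9 n s) (loop_pmf (\<lambda>_. True) (\<lambda>_ _. return_pmf ()) n ())
    (\<lambda>_ t s'. t0 + 1 + t \<le> 7 * n + 3 \<and> regs s' 0 = n \<and> regs s' 5 = d \<and>
       (\<forall>i<n. mem s' (Suc i) = i \<and> mem s' (n + Suc i) = i))"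
  proof (rule refines_While[where t = 0 and I = "\<lambda>k _ t s'. t + 7 * k \<le> 7 * n \<and> k \<le> n \<and> regs s' 9 = k \<and>
       regs s' 0 = n \<and> regs s' 5 = d \<and> (\<forall>i. k \<le> i \<and> i < n \<longrightarrow> mem s' (Suc i) = i \<and> mem s' (n + Suc i) = i)"])
    fix k t and b :: unit and s' :: state
    assume I: "t + 7 * Suc k \<le> 7 * n \<and> Suc k \<le> n \<and> regs s' 9 = Suc k \<and>
       regs s' 0 = n \<and> regs s' 5 = d \<and> (\<forall>i. Suc k \<le> i \<and> i < n \<longrightarrow> mem s' (Suc i) = i \<and> mem s' (n + Suc i) = i)"
    then have "(n + Suc k) mod N = n + Suc k" using N_large by auto
    then have ex: "exec N n A ?body s' = set_reg 9 k (set_mem (n + Suc k) k (set_mem (Suc k) k s'))"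
      using I by simp
    show "refines N n A ?body s' (return_pmf ()) (\<lambda>_ t' s'. t + t' + 2 + 7 * k \<le> 7 * n \<and> k \<le> n \<and> regs s' 9 = k \<and>
       regs s' 0 = n \<and> regs s' 5 = d \<and> (\<forall>i. k \<le> i \<and> i < n \<longrightarrow> mem s' (Suc i) = i \<and> mem s' (n + Suc i) = i))"
    proof (rule refines_loopfree)
      fix t' assume "t' \<le> weight ?body"
      then show "t + t' + 2 + 7 * k \<le> 7 * n \<and> k \<le> n \<and> regs (exec N n A ?body s') 9 = k \<and>
         regs (exec N n A ?body s') 0 = n \<and> regs (exec N n A ?body s') 5 = d \<and>
         (\<forall>i. k \<le> i \<and> i < n \<longrightarrow> mem (exec N n A ?body s') (Suc i) = i \<and> mem (exec N n A ?body s') (n + Suc i) = i)"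
        unfolding ex using I by auto
    qed simp
  qed (use s t0 in auto)
  then show "refines N n A (While (Reg 9) ?body) (exec N n A (Assign 9 (Reg 0)) s) (return_pmf ())
    (\<lambda>_ t s'. t0 + 1 + t \<le> 7 * n + 3 \<and> regs s' 0 = n \<and> regs s' 5 = d \<and>
       (\<forall>i<n. mem s' (Suc i) = i \<and> mem s' (n + Suc i) = i))"
    unfolding ex loop_pmf_return .
qed simp

lemma init_whp:
  "whp N n A init_code (init_state n) 0 (\<lambda>s'. inv s' \<and> regs s' 6 = n \<and> small s')
    (\<lambda>t s'. t \<le> 3 * d + 7 * n + 12)"
proof (rule whp_refines_return)
  have "refines N n A init_code (init_state n) (return_pmf () \<bind> (\<lambda>_. return_pmf () \<bind> (\<lambda>_. return_pmf ())))
     (\<lambda>_ t s'. (inv s' \<and> regs s' 6 = n \<and> small s') \<and> t \<le> 3 * d + 7 * n + 12)"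
    unfolding init_code_def
  proof (rule refines_Seq[OF root_refines], rule refines_Seq[OF fill_refines])
    fix t1 t2 and s1 s2 :: state and b b' :: unit
    assume 1: "t1 \<le> 3 * d + 1 \<and> regs s1 0 = n \<and> regs s1 5 = d"
      and 2: "t2 \<le> 7 * n + 3 \<and> regs s2 0 = n \<and> regs s2 5 = d \<and>
       (\<forall>i<n. mem s2 (Suc i) = i \<and> mem s2 (n + Suc i) = i)"
    let ?s = "set_reg 6 n (set_reg 4 n (set_reg 3 n s2))"
    have "proper n [0..<n]" using n_pos by (auto simp: proper_def)
    moreover have "holds_array n False [0..<n] ?s" "holds_array n True [0..<n] ?s"
      using 2 by (auto simp: holds_array_def size_reg_def offset_def)
    ultimately have "inv ?s" using 2 unfolding inv_def
      by (intro conjI exI[of _ "[0..<n]"]) (auto simp: strict_saddlepoint_def)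
    then show "refines N n A (Assign 3 (Reg 0) ;; Assign 4 (Reg 0) ;; Assign 6 (Reg 0)) s2 (return_pmf ())
      (\<lambda>_ t s'. (inv s' \<and> regs s' 6 = n \<and> small s') \<and> t1 + 1 + (t2 + 1 + t) \<le> 3 * d + 7 * n + 12)"
      using 1 2 by (intro refines_loopfree) (auto simp: small_def)
  qed auto
  then show "refines N n A init_code (init_state n) (return_pmf ())
     (\<lambda>_ t s'. (inv s' \<and> regs s' 6 = n \<and> small s') \<and> t \<le> 3 * d + 7 * n + 12)"
    by (simp add: bind_return_pmf)
qed

lemma saddle_whp:
  "whp N n A saddle_code (init_state n) (8 * (d + 1) * err) (\<lambda>s'. correct_output n A (result s'))
    (\<lambda>t s'. t \<le> 20000 * n)"
proof -
  \<comment> \<open>From \<open>n < (d + 1) ^ 4\<close> and \<open>d + 1 < 2 ^ (d + 1)\<close>.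
    Though far from logarithmic, this bound on the rounds suffices, since \<open>l * d ^ 3\<close>
    is of order \<open>d ^ 4\<close> and \<open>d ^ 4 \<le> n\<close>.\<close>
  define l where "l = 4 * (d + 1)"
  have "d + 1 < 2 ^ (d + 1)" by (rule less_exp)
  then have "(d + 1) ^ 4 \<le> (2 ^ (d + 1)) ^ 4" by (intro power_mono) auto
  also have "\<dots> = 2 ^ l" by (simp only: l_def power_mult[symmetric] mult.commute)
  finally have nl: "n < 2 ^ l" using d(3) by simp
  have d4: "d * d ^ 3 \<le> n" using d(2) by (simp add: power_numeral_reduce)
  have d3: "d ^ 3 \<le> n" using d by (intro order_trans[OF power_increasing[of 3 4 d]]) auto
  have d1: "d \<le> n" using dd by (cases d) auto
  have ld: "l * (600 * d ^ 3 + 1205) \<le> 14440 * n"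
  proof -
    have "l * (600 * d ^ 3 + 1205) = 2400 * (d * d ^ 3) + 2400 * d ^ 3 + 4820 * d + 4820"
      by (simp add: l_def algebra_simps)
    then show ?thesis using d4 d3 d1 n_pos by linarith
  qed
  have loop: "whp N n A (While (Reg 6) round_code ;; search_code) s (l * (2 * err) + 0)
     (\<lambda>s'. correct_output n A (result s'))
     (\<lambda>t s'. t \<le> 1 + 2400 * n + l * (600 * d ^ 3 + 1205) + 1 + (20 * n + 40))"
    if s: "inv s \<and> regs s 6 = n \<and> small s" for s
  proof (rule whp_seq[OF loop_whp])
    fix s' assume "inv s'"
    then show "whp N n A search_code s' 0 (\<lambda>s''. correct_output n A (result s''))
       (\<lambda>t s''. t \<le> regs s' 3 * (regs s' 4 * (20 * n + 20) + 10) + 10)"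
      by (intro whp_refines_return search_refines)
  next
    fix t s' t' s''
    assume "small s \<longrightarrow> regs s' 3 \<le> 1 \<and> regs s' 4 \<le> 1 \<and> t \<le> 1 + 2400 * regs s 6 + l * (600 * d ^ 3 + 1205)"
      and t': "t' \<le> regs s' 3 * (regs s' 4 * (20 * n + 20) + 10) + 10"
    then have 1: "regs s' 3 \<le> 1" "regs s' 4 \<le> 1" "t \<le> 1 + 2400 * n + l * (600 * d ^ 3 + 1205)"
      using s by auto
    have "regs s' 3 * (regs s' 4 * (20 * n + 20) + 10) \<le> 1 * (1 * (20 * n + 20) + 10)"
      using 1 by (intro mult_le_mono add_le_mono) auto
    then have "t' \<le> 20 * n + 40" using t' by simp
    with 1(3) have "t + t' \<le> (1 + 2400 * n + l * (600 * d ^ 3 + 1205)) + (20 * n + 40)" by (rule add_le_mono)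
    then show "t + 1 + t' \<le> 1 + 2400 * n + l * (600 * d ^ 3 + 1205) + 1 + (20 * n + 40)" by simp
  qed (use s nl err_nonneg in auto)
  have "whp N n A saddle_code (init_state n) (0 + (l * (2 * err) + 0)) (\<lambda>s'. correct_output n A (result s'))
    (\<lambda>t s'. t \<le> 20000 * n)"
    unfolding saddle_code_def
    by (rule whp_seq[OF init_whp _ _ loop]) (use err_nonneg ld d1 n_pos in auto)
  then show ?thesis by (simp add: l_def algebra_simps)
qed

end

section \<open>From laws of halting times to executions\<close>

text \<open>\<open>E\<close> is a probability law on finite halting times, so its mass up to
  \<open>t\<close> tends to 1; this is almost sure termination.\<close>

lemma whp_execute:
  assumes "whp N n A c s e Q (\<lambda>t _. t \<le> T)" "0 \<le> e"
  shows "C \<in> set_pmf (run N n A t (c, s)) \<Longrightarrow> halted C \<Longrightarrow> Q (snd C)"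
    and "(\<lambda>t. measure_pmf.prob (run N n A t (c, s)) {C. halted C}) \<longlonglongrightarrow> 1"
    and "1 - e \<le> measure_pmf.prob (run N n A T (c, s)) {C. halted C}"
proof -
  obtain E where E: "runs N n A (c, s) E" "\<forall>x\<in>set_pmf E. Q (snd x)"
    "expect_le E (\<lambda>x. of_bool (\<not> fst x \<le> T)) e"
    using assms(1) by (auto simp: whp_def)
  show "Q (snd C)" if "C \<in> set_pmf (run N n A t (c, s))" "halted C"
    using runs_halted_state[OF E(1) that] E(2) by auto
  have "(\<lambda>t. measure_pmf.prob E {x. fst x \<le> t}) \<longlonglongrightarrow> measure_pmf.prob E (\<Union>t. {x. fst x \<le> t})"
    by (intro measure_pmf.finite_Lim_measure_incseq) (auto simp: incseq_def)
  moreover have "(\<Union>t. {x :: nat \<times> state. fst x \<le> t}) = UNIV" by auto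
  ultimately show "(\<lambda>t. measure_pmf.prob (run N n A t (c, s)) {C. halted C}) \<longlonglongrightarrow> 1"
    by (simp add: runs_prob_halted[OF E(1)])
  have "measure_pmf.prob E {x. \<not> fst x \<le> T} \<le> e"
    using E(3) expect_le_prob[OF assms(2)] by blast
  moreover have "measure_pmf.prob E (UNIV - {x. fst x \<le> T}) = 1 - measure_pmf.prob E {x. fst x \<le> T}"
    using measure_pmf.prob_compl[of "{x. fst x \<le> T}" E] by simp
  moreover have "UNIV - {x. fst x \<le> T} = {x :: nat \<times> state. \<not> fst x \<le> T}" by auto
  ultimately show "1 - e \<le> measure_pmf.prob (run N n A T (c, s)) {C. halted C}"
    by (simp add: runs_prob_halted[OF E(1)])
qed

text \<open>Ranks replace the entries so that the order can be reversed by negation.\<close>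

definition rank_matrix :: "nat \<Rightarrow> (nat \<Rightarrow> nat \<Rightarrow> 'a::linorder) \<Rightarrow> nat \<Rightarrow> nat \<Rightarrow> int" where
  "rank_matrix n A i j = int (card {p \<in> {..<n} \<times> {..<n}. A (fst p) (snd p) < A i j})"

lemma rank_matrix_less:
  assumes "i < n" "j < n"
  shows "rank_matrix n A i j < rank_matrix n A k l \<longleftrightarrow> A i j < A k l"
proof
  assume less: "A i j < A k l"
  have "{p \<in> {..<n} \<times> {..<n}. A (fst p) (snd p) < A i j} \<subset>
      {p \<in> {..<n} \<times> {..<n}. A (fst p) (snd p) < A k l}"
  proof (rule psubsetI)
    show "{p \<in> {..<n} \<times> {..<n}. A (fst p) (snd p) < A i j} \<subseteq>
        {p \<in> {..<n} \<times> {..<n}. A (fst p) (snd p) < A k l}"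
      using less by (blast intro: less_trans)
    have "(i, j) \<in> {p \<in> {..<n} \<times> {..<n}. A (fst p) (snd p) < A k l}" using assms less by simp
    then show "{p \<in> {..<n} \<times> {..<n}. A (fst p) (snd p) < A i j} \<noteq>
        {p \<in> {..<n} \<times> {..<n}. A (fst p) (snd p) < A k l}" by fastforce
  qed
  then show "rank_matrix n A i j < rank_matrix n A k l"
    unfolding rank_matrix_def by (simp add: psubset_card_mono)
next
  assume less: "rank_matrix n A i j < rank_matrix n A k l"
  show "A i j < A k l"
  proof (rule ccontr)
    assume "\<not> A i j < A k l"
    then have "{p \<in> {..<n} \<times> {..<n}. A (fst p) (snd p) < A k l} \<subseteq>
      {p \<in> {..<n} \<times> {..<n}. A (fst p) (snd p) < A i j}" by auto
    then have "rank_matrix n A k l \<le> rank_matrix n A i j"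
      unfolding rank_matrix_def by (simp add: card_mono)
    then show False using less by simp
  qed
qed

lemma strict_saddlepoint_rank:
  "strict_saddlepoint n (rank_matrix n A) i j \<longleftrightarrow> strict_saddlepoint n A i j"
  unfolding strict_saddlepoint_def using rank_matrix_less by blast

lemma distinct_rank:
  assumes "distinct_entries n A"
  shows "distinct_entries n (rank_matrix n A)"
  unfolding distinct_entries_def
proof (rule inj_onI)
  fix p q assume p: "p \<in> {..<n} \<times> {..<n}" "q \<in> {..<n} \<times> {..<n}"
    and eq: "(case p of (i, j) \<Rightarrow> rank_matrix n A i j) = (case q of (i, j) \<Rightarrow> rank_matrix n A i j)"
  have "\<not> A (fst p) (snd p) < A (fst q) (snd q)" "\<not> A (fst q) (snd q) < A (fst p) (snd p)"
    using rank_matrix_less[of "fst p" n "snd p" A "fst q" "snd q"]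
      rank_matrix_less[of "fst q" n "snd q" A "fst p" "snd p"] p eq by (auto simp: split_def)
  then have "A (fst p) (snd p) = A (fst q) (snd q)" by simp
  then show "p = q" using inj_onD[OF assms[unfolded distinct_entries_def], of p q] p
    by (simp add: split_def)
qed

section \<open>Asymptotics of the failure probability\<close>

definition root4 :: "nat \<Rightarrow> nat" where
  "root4 n = nat \<lfloor>real n powr (1 / 4)\<rfloor>"

lemma root4:
  assumes "1 \<le> n"
  shows "1 \<le> root4 n" "root4 n ^ 4 \<le> n" "n < (root4 n + 1) ^ 4"
    "real n powr (1 / 4) - 1 \<le> root4 n"
proof -
  define x where "x = real n powr (1 / 4)"
  have "real n powr 0 \<le> x" unfolding x_def using assms by (intro powr_mono) auto
  then have x: "1 \<le> x" using assms by simp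
  have x4: "x ^ 4 = n" unfolding x_def using assms by (simp add: powr_power)
  have r: "real (root4 n) \<le> x" "x < real (root4 n) + 1"
    using x unfolding root4_def x_def[symmetric] by linarith+
  show "1 \<le> root4 n" using x by (simp add: root4_def x_def le_nat_iff le_floor_iff)
  have "real (root4 n) ^ 4 \<le> x ^ 4" using r by (intro power_mono) auto
  then show "root4 n ^ 4 \<le> n" using x4 by (metis of_nat_le_iff of_nat_power)
  have "x ^ 4 < (real (root4 n) + 1) ^ 4" using r x by (intro power_strict_mono) auto
  then have "real n < real ((root4 n + 1) ^ 4)" using x4 by (simp add: add.commute)
  then show "n < (root4 n + 1) ^ 4" by (simp only: of_nat_less_iff)
  show "real n powr (1 / 4) - 1 \<le> root4 n" using r by (simp add: x_def)
qed

definition failure_bound :: "nat \<Rightarrow> real" where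
  "failure_bound n = 8 * (root4 n + 1) * ((real (root4 n * root4 n) + 2 + n) * (99 / 100) ^ root4 n)"

text \<open>Replaces the rounded root by \<open>n powr (1 / 4) - 1\<close> and
  \<open>99 / 100\<close> by \<open>exp (- 1 / 100)\<close>, which leaves a smooth expression for
  the asymptotic comparison.\<close>

lemma failure_bound_le:
  assumes "1 \<le> n"
  shows "failure_bound n \<le> 8 * (real n + 1) * (2 * real n + 2) * exp (- (real n powr (1 / 4) - 1) / 100)"
proof -
  let ?d = "root4 n"
  have "?d ^ 1 \<le> ?d ^ 4" "?d ^ 2 \<le> ?d ^ 4" using root4(1)[OF assms] by (intro power_increasing; simp)+
  then have d: "?d \<le> n" "?d * ?d \<le> n" using root4(2)[OF assms] by (auto simp: power2_eq_square)
  have "(99 / 100 :: real) \<le> exp (- 1 / 100)" using exp_ge_add_one_self[of "- 1 / 100"] by simp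
  then have "(99 / 100 :: real) ^ ?d \<le> exp (- 1 / 100) ^ ?d" by (intro power_mono) auto
  also have "\<dots> = exp (- real ?d / 100)" by (simp add: exp_of_nat_mult[symmetric])
  also have "\<dots> \<le> exp (- (real n powr (1 / 4) - 1) / 100)" using root4(4)[OF assms] by simp
  finally have e: "(99 / 100 :: real) ^ ?d \<le> exp (- (real n powr (1 / 4) - 1) / 100)" .
  have "real (?d * ?d) + 2 + n \<le> 2 * real n + 2" using d(2) by linarith
  moreover have "8 * (real ?d + 1) \<le> 8 * (real n + 1)" using d(1) by simp
  ultimately show ?thesis unfolding failure_bound_def mult.assoc[symmetric]
    using e by (intro mult_mono) (auto simp: mult.assoc)
qed

theorem theorem4:
  "\<exists>(P :: com) (w :: nat) (T :: nat \<Rightarrow> nat) (g :: nat \<Rightarrow> real).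
     0 < w \<and>
     (\<lambda>n. real (T n)) \<in> O(\<lambda>n. real n) \<and>
     (\<forall>n. 0 \<le> g n) \<and> g \<in> \<Omega>(\<lambda>n. real n powr (1 / 21)) \<and>
     (\<forall>n\<ge>1. \<forall>A :: nat \<Rightarrow> nat \<Rightarrow> 'a::linorder. distinct_entries n A \<longrightarrow>
        las_vegas_finds_saddlepoint w P n A \<and>
        prob_halted_within w P n A (T n) \<ge> 1 - exp (- g n))"
proof -
  \<comment> \<open>Makes \<open>exp (- g n)\<close> equal to the failure bound once that is at most
    1. Where the bound exceeds 1, \<open>g n = 0\<close> and the claim about the probability is
    trivial.\<close>
  define g where "g n = max 0 (- ln (failure_bound n))" for n
  have pos: "0 < failure_bound n" for n
    unfolding failure_bound_def by (intro mult_pos_pos add_nonneg_pos add_pos_nonneg) auto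
  \<comment> \<open>Any exponent below 1/4 could stand in place of 1/21, since the gap absorbs the
    polynomial factor and the division by 100.\<close>
  have "eventually (\<lambda>n. 8 * (real n + 1) * (2 * real n + 2) * exp (- (real n powr (1 / 4) - 1) / 100)
      \<le> exp (- (real n powr (1 / 21)))) sequentially"
    by real_asymp
  then have "eventually (\<lambda>n. norm (real n powr (1 / 21)) \<le> norm (g n)) sequentially"
    using eventually_ge_at_top[of 1]
  proof eventually_elim
    case (elim n)
    then have "failure_bound n \<le> exp (- (real n powr (1 / 21)))"
      using failure_bound_le[of n] by linarith
    then have "ln (failure_bound n) \<le> - (real n powr (1 / 21))"
      using pos[of n] by (metis ln_exp ln_le_cancel_iff exp_gt_zero)
    then show ?case by (simp add: g_def)
  qed
  then have g: "g \<in> \<Omega>(\<lambda>n. real n powr (1 / 21))"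
    by (intro landau_omega.bigI[of 1]) auto
  have main: "las_vegas_finds_saddlepoint 4 saddle_code n A \<and>
      1 - exp (- g n) \<le> prob_halted_within 4 saddle_code n A (20000 * n)"
    if n: "1 \<le> n" and A: "distinct_entries n A" for n and A :: "nat \<Rightarrow> nat \<Rightarrow> 'a"
  proof -
    define B where "B = rank_matrix n A"
    interpret saddle_search n "(n + 2) ^ 4" B "root4 n"
      by unfold_locales (use distinct_rank[OF A] root4[OF n] in \<open>auto simp: B_def\<close>)
    have exec: "execute 4 saddle_code n A t = run ((n + 2) ^ 4) n B t (saddle_code, init_state n)" for t
    proof -
      have "execute 4 saddle_code n A t = execute 4 saddle_code n B t"
        by (rule execute_cong) (simp add: B_def rank_matrix_less)
      then show ?thesis by (simp add: execute_def)
    qed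
    have out: "correct_output n B r \<longleftrightarrow> correct_output n A r" for r
      by (simp add: correct_output_def B_def strict_saddlepoint_rank split: option.split)
    have fb: "8 * (root4 n + 1) * err = failure_bound n"
      by (simp add: err_def failure_bound_def)
    note W = whp_execute[OF saddle_whp[unfolded fb] less_imp_le[OF pos]]
    have "las_vegas_finds_saddlepoint 4 saddle_code n A"
      unfolding las_vegas_finds_saddlepoint_def prob_halted_within_def exec
      using W(1,2) out by auto
    moreover have "1 - exp (- g n) \<le> prob_halted_within 4 saddle_code n A (20000 * n)"
    proof (cases "failure_bound n \<le> 1")
      case True
      then have "exp (- g n) = failure_bound n" using pos[of n] by (simp add: g_def max_def)
      then show ?thesis using W(3) by (simp add: prob_halted_within_def exec)
    next
      case False
      then have "g n = 0" by (simp add: g_def)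
      then show ?thesis by (simp add: prob_halted_within_def)
    qed
    ultimately show ?thesis by blast
  qed
  have "(\<lambda>n. real (20000 * n)) \<in> O(\<lambda>n. real n)" by simp
  then show ?thesis using g main
    by (intro exI[of _ saddle_code] exI[of _ 4] exI[of _ "\<lambda>n. 20000 * n"] exI[of _ g]) (auto simp: g_def)
qed

end
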